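(* Let $\mathbb{C}^*=\mathbb{C}\setminus\{0\}$ and let $\omega:\mathbb{C}^*\to\mathbb{C}$ and $\psi:\mathbb{C}^*\to\mathbb{C}^*$ be holomorphic. The following are equivalent: (1) $C_{\omega,\psi}$ is supercyclic on $H(\mathbb{C}^* )$. (2) $C_{\omega,\psi}$ satisfies the Frequent Hypercyclicity Criterion on $H(\mathbb{C}^* )$, and in particular is frequently hypercyclic, mixing and chaotic. (3) There exist $n\in\mathbb{N}$, $W\in H(\mathbb{C}^* )$ and $a\in\mathbb{D}^*$ so that either (i) $\omega(z)=z^n e^{W(z)}$ and $\psi(z)=az$ for all $z\in\mathbb{C}^*$, or (ii) $\omega(z)=z^{-n}e^{W(z)}$ and $\psi(z)=\frac{1}{a}z$ for all $z\in\mathbb{C}^*$.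
   Context: $\mathbb{N}=\{1,2,\dots\}$ and $\mathbb{D}^*=\{z\in\mathbb{C}:0<|z|<1\}$. For a domain $\Omega\subseteq\mathbb{C}$, $H(\Omega)$ is the space of holomorphic functions on $\Omega$ with the compact-open topology (a separable Fréchet space). For holomorphic $\omega:\Omega\to\mathbb{C}$ and $\psi:\Omega\to\Omega$, the weighted composition operator $C_{\omega,\psi}:H(\Omega)\to H(\Omega)$ is $C_{\omega,\psi}(f)(z)=\omega(z)\,f(\psi(z))$. An operator means a continuous linear self-map. Let $T$ be an operator on a separable Fréchet space $X$. $T$ is supercyclic if for some $f\in X$ the set $\{\lambda T^nf:\lambda\in\mathbb{C},\ n=0,1,\dots\}$ is dense in $X$. $T$ is mixing if for each pair of non-empty open $U,V\subseteq X$ there is an integer $n$ with $T^k(U)\cap V\ne\emptyset$ for each $k\ge n$. $T$ is chaotic if it is topologically transitive (for each pair of non-empty open $U,V\subseteq X$ there is $n$ with $T^n(U)\cap V\neq\emptyset$) and its set of periodic points $\{f\in X: T^rf=f \text{ for some } r\in\mathbb{N}\}$ is dense in $X$. $T$ is frequently hypercyclic if there is $f\in X$ so that $\liminf_{N\to\infty}\frac{\mathrm{card}\{0\le n\le N: T^nf\in U\}}{N+1}>0$ for each non-empty open $U\subseteq X$. $T$ satisfies the Frequent Hypercyclicity Criterion if there exist a dense subset $X_0$ of $X$ and a map $S:X_0\to X_0$ such that, for each $f\in X_0$: (i) $\sum_{n=1}^\infty T^n f$ converges unconditionally; (ii) $\sum_{n=1}^\infty S^n f$ converges unconditionally; (iii)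 $TSf=f$. *)

theory Defs
  imports "HOL-Complex_Analysis.Complex_Analysis" "HOL-Library.Function_Algebras"
begin

section \<open>Linear dynamics\<close>

text \<open>
  A topological vector space over the complex numbers is given by an abstract topology \<open>X\<close>, whose
  carrier \<open>topspace X\<close> is a subspace of an abelian group type, together with the scalar
  multiplication \<open>scl\<close>. The notions below are meant for operators \<open>T\<close> on \<open>X\<close> in the sense of
  \<open>operator_on\<close>; values of \<open>T\<close> outside \<open>topspace X\<close> are irrelevant.
\<close>

definition operator_on ::
    "'a::ab_group_add topology \<Rightarrow> (complex \<Rightarrow> 'a \<Rightarrow> 'a) \<Rightarrow> ('a \<Rightarrow> 'a) \<Rightarrow> bool" where
  "operator_on X scl T \<longleftrightarrow>
     continuous_map X X T \<and>
     (\<forall>f\<in>topspace X. \<forall>g\<in>topspace X. T (f + g) = T f + T g) \<and>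
     (\<forall>c. \<forall>f\<in>topspace X. T (scl c f) = scl c (T f))"

definition dense_in_space :: "'a topology \<Rightarrow> 'a set \<Rightarrow> bool" where
  "dense_in_space X D \<longleftrightarrow> D \<subseteq> topspace X \<and> X closure_of D = topspace X"

definition supercyclic ::
    "'a topology \<Rightarrow> (complex \<Rightarrow> 'a \<Rightarrow> 'a) \<Rightarrow> ('a \<Rightarrow> 'a) \<Rightarrow> bool" where
  "supercyclic X scl T \<longleftrightarrow>
     (\<exists>f\<in>topspace X. dense_in_space X {scl c ((T ^^ n) f) | c n. True})"

definition mixing :: "'a topology \<Rightarrow> ('a \<Rightarrow> 'a) \<Rightarrow> bool" where
  "mixing X T \<longleftrightarrow>
     (\<forall>U V. openin X U \<and> openin X V \<and> U \<noteq> {} \<and> V \<noteq> {} \<longrightarrow>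
        (\<exists>n. \<forall>k\<ge>n. (T ^^ k) ` U \<inter> V \<noteq> {}))"

definition topologically_transitive :: "'a topology \<Rightarrow> ('a \<Rightarrow> 'a) \<Rightarrow> bool" where
  "topologically_transitive X T \<longleftrightarrow>
     (\<forall>U V. openin X U \<and> openin X V \<and> U \<noteq> {} \<and> V \<noteq> {} \<longrightarrow>
        (\<exists>n. (T ^^ n) ` U \<inter> V \<noteq> {}))"

definition chaotic :: "'a topology \<Rightarrow> ('a \<Rightarrow> 'a) \<Rightarrow> bool" where
  "chaotic X T \<longleftrightarrow>
     topologically_transitive X T \<and>
     dense_in_space X {f \<in> topspace X. \<exists>r\<ge>1. (T ^^ r) f = f}"

definition frequently_hypercyclic :: "'a topology \<Rightarrow> ('a \<Rightarrow> 'a) \<Rightarrow> bool" where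
  "frequently_hypercyclic X T \<longleftrightarrow>
     (\<exists>f\<in>topspace X. \<forall>U. openin X U \<and> U \<noteq> {} \<longrightarrow>
        liminf (\<lambda>N. ereal (real (card {n. n \<le> N \<and> (T ^^ n) f \<in> U}) / real (N + 1))) > 0)"

text \<open>
  Unconditional convergence is convergence of the net of finite partial sums, as in the library's
  \<open>summable_on\<close>; the latter is not usable here since it refers to a type class topology.
\<close>

definition unconditionally_convergent ::
    "'a::ab_group_add topology \<Rightarrow> ('b \<Rightarrow> 'a) \<Rightarrow> 'b set \<Rightarrow> bool" where
  "unconditionally_convergent X x A \<longleftrightarrow>
     (\<exists>s. limitin X (sum x) s (finite_subsets_at_top A))"

definition frequent_hypercyclicity_criterion ::
    "'a::ab_group_add topology \<Rightarrow> ('a \<Rightarrow> 'a) \<Rightarrow> bool" where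
  "frequent_hypercyclicity_criterion X T \<longleftrightarrow>
     (\<exists>X0 S. dense_in_space X X0 \<and> S ` X0 \<subseteq> X0 \<and>
        (\<forall>f\<in>X0. unconditionally_convergent X (\<lambda>n. (T ^^ n) f) {1..} \<and>
                 unconditionally_convergent X (\<lambda>n. (S ^^ n) f) {1..} \<and>
                 T (S f) = f))"


section \<open>Spaces of holomorphic functions\<close>

text \<open>
  Functions on \<open>\<Omega>\<close> are represented by their extension by zero, so that equality of elements is
  equality on \<open>\<Omega>\<close> and the vector space operations are the pointwise ones of the function type.
\<close>

definition hol_space :: "complex set \<Rightarrow> (complex \<Rightarrow> complex) set" where
  "hol_space \<Omega> = {f. f holomorphic_on \<Omega> \<and> (\<forall>z. z \<notin> \<Omega> \<longrightarrow> f z = 0)}"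

definition hol_scale :: "complex \<Rightarrow> (complex \<Rightarrow> complex) \<Rightarrow> (complex \<Rightarrow> complex)" where
  "hol_scale c f = (\<lambda>z. c * f z)"

text \<open>
  The compact-open topology; note that the type class topology on functions is the topology of
  pointwise convergence.
\<close>

definition hol_topology :: "complex set \<Rightarrow> (complex \<Rightarrow> complex) topology" where
  "hol_topology \<Omega> = topology_generated_by
     {{f \<in> hol_space \<Omega>. f ` K \<subseteq> U} | K U. compact K \<and> K \<subseteq> \<Omega> \<and> open U}"

lemma topspace_hol_topology [simp]: "topspace (hol_topology \<Omega>) = hol_space \<Omega>"
proof -
  have "hol_space \<Omega> = {f \<in> hol_space \<Omega>. f ` {} \<subseteq> UNIV}"
    by simp
  moreover have "compact ({} :: complex set)" "{} \<subseteq> \<Omega>" "open (UNIV :: complex set)"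
    by simp_all
  ultimately have "hol_space \<Omega> \<in> {{f \<in> hol_space \<Omega>. f ` K \<subseteq> U} | K U. compact K \<and> K \<subseteq> \<Omega> \<and> open U}"
    by blast
  then show ?thesis
    unfolding hol_topology_def topology_generated_by_topspace by blast
qed

definition weighted_comp ::
    "complex set \<Rightarrow> (complex \<Rightarrow> complex) \<Rightarrow> (complex \<Rightarrow> complex) \<Rightarrow>
     (complex \<Rightarrow> complex) \<Rightarrow> (complex \<Rightarrow> complex)" where
  "weighted_comp \<Omega> \<omega> \<psi> f = (\<lambda>z. if z \<in> \<Omega> then \<omega> z * f (\<psi> z) else 0)"

lemma weighted_comp_in_hol_space:
  assumes "\<omega> holomorphic_on \<Omega>" "\<psi> holomorphic_on \<Omega>" "\<psi> ` \<Omega> \<subseteq> \<Omega>" "f \<in> hol_space \<Omega>"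
  shows "weighted_comp \<Omega> \<omega> \<psi> f \<in> hol_space \<Omega>"
proof -
  have "f holomorphic_on \<Omega>"
    using assms by (simp add: hol_space_def)
  then have "(\<lambda>z. \<omega> z * f (\<psi> z)) holomorphic_on \<Omega>"
    using assms holomorphic_on_compose_gen [of \<psi> \<Omega> f \<Omega>]
    by (intro holomorphic_on_mult) (auto simp: o_def)
  then have "weighted_comp \<Omega> \<omega> \<psi> f holomorphic_on \<Omega>"
    by (rule holomorphic_transform) (simp add: weighted_comp_def)
  then show ?thesis
    by (simp add: hol_space_def weighted_comp_def)
qed

lemma openin_hol_topology_subbasic:
  "compact K \<Longrightarrow> K \<subseteq> \<Omega> \<Longrightarrow> open U \<Longrightarrow> openin (hol_topology \<Omega>) {f \<in> hol_space \<Omega>. f ` K \<subseteq> U}"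
  unfolding hol_topology_def by (rule topology_generated_by_Basis) blast

lemma operator_on_weighted_comp:
  assumes \<omega>: "\<omega> holomorphic_on \<Omega>" and \<psi>: "\<psi> holomorphic_on \<Omega>" and maps: "\<psi> ` \<Omega> \<subseteq> \<Omega>"
  shows "operator_on (hol_topology \<Omega>) hol_scale (weighted_comp \<Omega> \<omega> \<psi>)"
proof -
  let ?T = "weighted_comp \<Omega> \<omega> \<psi>" and ?X = "hol_topology \<Omega>"
  have pre: "openin ?X {f \<in> hol_space \<Omega>. ?T f ` K \<subseteq> U}"
    if K: "compact K" "K \<subseteq> \<Omega>" and U: "open U" for K U
  proof (subst openin_subopen, rule ballI)
    fix f assume "f \<in> {f \<in> hol_space \<Omega>. ?T f ` K \<subseteq> U}"
    then have f: "f \<in> hol_space \<Omega>" "?T f ` K \<subseteq> U" by auto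
    have cont: "continuous_on K \<omega>" "continuous_on K (\<lambda>z. f (\<psi> z))"
    proof -
      show "continuous_on K \<omega>"
        using \<omega> K holomorphic_on_imp_continuous_on continuous_on_subset by blast
      have "(\<lambda>z. f (\<psi> z)) holomorphic_on \<Omega>"
        using \<psi> maps f holomorphic_on_compose_gen [of \<psi> \<Omega> f \<Omega>]
        by (auto simp: o_def hol_space_def)
      then show "continuous_on K (\<lambda>z. f (\<psi> z))"
        using K holomorphic_on_imp_continuous_on continuous_on_subset by blast
    qed
    have "\<exists>r A B. 0 < r \<and> open B \<and> \<omega> ` (K \<inter> cball z r) \<subseteq> A \<and>
            f ` (\<psi> ` (K \<inter> cball z r)) \<subseteq> B \<and> (\<forall>a\<in>A. \<forall>b\<in>B. a * b \<in> U)"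
      if z: "z \<in> K" for z
    proof -
      have "open ((\<lambda>p. fst p * snd p) -` U :: (complex \<times> complex) set)"
        by (intro open_vimage U continuous_intros)
      moreover have "(\<omega> z, f (\<psi> z)) \<in> (\<lambda>p. fst p * snd p) -` U"
        using z f K by (auto simp: weighted_comp_def)
      ultimately obtain A B where AB: "open A" "open B" "\<omega> z \<in> A" "f (\<psi> z) \<in> B"
          "A \<times> B \<subseteq> (\<lambda>p. fst p * snd p) -` U"
        by (auto elim!: open_prod_elim)
      obtain V1 where V1: "open V1" "K \<inter> \<omega> -` A = K \<inter> V1"
        using cont(1) AB(1) by (metis continuous_on_open_invariant inf_commute)
      obtain V2 where V2: "open V2" "K \<inter> (\<lambda>z. f (\<psi> z)) -` B = K \<inter> V2"
        using cont(2) AB(2) by (metis continuous_on_open_invariant inf_commute)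
      have "z \<in> V1 \<inter> V2"
        using V1 V2 AB z by blast
      then obtain r where "0 < r" "cball z r \<subseteq> V1 \<inter> V2"
        using V1 V2 open_contains_cball [of "V1 \<inter> V2"] by blast
      then show ?thesis
        using V1 V2 AB by (intro exI [of _ r] exI [of _ A] exI [of _ B]) auto
    qed
    then obtain r A B where rAB: "\<And>z. z \<in> K \<Longrightarrow> 0 < r z \<and> open (B z) \<and> \<omega> ` (K \<inter> cball z (r z)) \<subseteq> A z \<and>
            f ` (\<psi> ` (K \<inter> cball z (r z))) \<subseteq> B z \<and> (\<forall>a\<in>A z. \<forall>b\<in>B z. a * b \<in> U)"
      by metis
    obtain F where F: "F \<subseteq> K" "finite F" "K \<subseteq> (\<Union>z\<in>F. ball z (r z))"
    proof (rule compactE_image [OF K(1)])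
      show "\<And>z. z \<in> K \<Longrightarrow> open (ball z (r z))" by simp
      show "K \<subseteq> (\<Union>z\<in>K. ball z (r z))"
        using rAB by (meson UN_I centre_in_ball subsetI)
    qed
    define N where "N = (\<lambda>z. {g \<in> hol_space \<Omega>. g ` (\<psi> ` (K \<inter> cball z (r z))) \<subseteq> B z})"
    have N: "openin ?X (N z)" "f \<in> N z" if "z \<in> F" for z
    proof -
      have "continuous_on (K \<inter> cball z (r z)) \<psi>"
        using \<psi> K by (meson continuous_on_subset holomorphic_on_imp_continuous_on inf.coboundedI1)
      then have "compact (\<psi> ` (K \<inter> cball z (r z)))"
        using K by (intro compact_continuous_image compact_Int_closed) auto
      moreover have "\<psi> ` (K \<inter> cball z (r z)) \<subseteq> \<Omega>"
        using K maps by blast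
      moreover have "z \<in> K"
        using that F by blast
      ultimately show "openin ?X (N z)"
        unfolding N_def using rAB openin_hol_topology_subbasic by presburger
      show "f \<in> N z"
        unfolding N_def using f rAB [OF \<open>z \<in> K\<close>] by simp
    qed
    let ?W = "hol_space \<Omega> \<inter> (\<Inter>z\<in>F. N z)"
    have "openin ?X ?W"
    proof (cases "F = {}")
      case True
      then show ?thesis
        using openin_topspace [of ?X] by simp
    next
      case False
      then have "openin ?X (\<Inter>z\<in>F. N z)"
        using F N by (intro openin_INT2) auto
      then show ?thesis
        using openin_topspace [of ?X] by (simp add: openin_Int)
    qed
    moreover have "f \<in> ?W"
      using f N by blast
    moreover have "?W \<subseteq> {f \<in> hol_space \<Omega>. ?T f ` K \<subseteq> U}"
    proof (rule subsetI, intro CollectI conjI image_subsetI)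
      fix g assume "g \<in> ?W"
      then show "g \<in> hol_space \<Omega>" by simp
    next
      fix g w assume "g \<in> ?W" and w: "w \<in> K"
      then have g: "\<And>z. z \<in> F \<Longrightarrow> g \<in> N z" by simp
      obtain z0 where z0: "z0 \<in> F" "w \<in> ball z0 (r z0)"
        using F(3) w by blast
      obtain z where z: "z \<in> F" "w \<in> K \<inter> cball z (r z)"
        using w that [OF z0(1)] z0(2) by simp
      have "z \<in> K"
        using z F by blast
      note rz = rAB [OF this]
      have "\<omega> w \<in> A z"
        using rz z by blast
      moreover have "g (\<psi> w) \<in> B z"
        using g [OF z(1)] z(2) unfolding N_def by blast
      ultimately have "\<omega> w * g (\<psi> w) \<in> U"
        using rz by blast
      then show "?T g w \<in> U"
        using w K by (auto simp: weighted_comp_def)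
    qed
    ultimately show "\<exists>W. openin ?X W \<and> f \<in> W \<and> W \<subseteq> {f \<in> hol_space \<Omega>. ?T f ` K \<subseteq> U}"
      by blast
  qed
  have "continuous_map ?X (topology_generated_by
     {{f \<in> hol_space \<Omega>. f ` K \<subseteq> U} | K U. compact K \<and> K \<subseteq> \<Omega> \<and> open U}) ?T"
  proof (rule continuous_on_generated_topo)
    fix V assume "V \<in> {{f \<in> hol_space \<Omega>. f ` K \<subseteq> U} | K U. compact K \<and> K \<subseteq> \<Omega> \<and> open U}"
    then obtain K U where V: "V = {f \<in> hol_space \<Omega>. f ` K \<subseteq> U}" "compact K" "K \<subseteq> \<Omega>" "open U"
      by blast
    then have "?T -` V \<inter> topspace ?X = {f \<in> hol_space \<Omega>. ?T f ` K \<subseteq> U}"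
      using weighted_comp_in_hol_space [OF assms] by auto
    then show "openin ?X (?T -` V \<inter> topspace ?X)"
      using pre V by simp
  next
    show "?T ` topspace ?X \<subseteq> \<Union> {{f \<in> hol_space \<Omega>. f ` K \<subseteq> U} | K U. compact K \<and> K \<subseteq> \<Omega> \<and> open U}"
      using topspace_hol_topology [of \<Omega>] weighted_comp_in_hol_space [OF assms]
      unfolding hol_topology_def topology_generated_by_topspace by (simp add: image_subset_iff)
  qed
  then have "continuous_map ?X ?X ?T"
    by (simp add: hol_topology_def)
  then show ?thesis
    by (auto simp: operator_on_def hol_scale_def weighted_comp_def fun_eq_iff algebra_simps)
qed

end

theory Submission
  imports Defs "HOL-Computational_Algebra.Fundamental_Theorem_Algebra"
begin

text \<open>
  Write \<open>C f z = \<omega> z * f (\<psi> z)\<close> for the operator on the functions holomorphic in the punctured plane.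

  Let \<open>C\<close> be supercyclic. Up to a scalar factor the orbit of a supercyclic vector takes all pairs of
  values at two points approximately. If \<open>\<omega>\<close> had a zero, or if \<open>\<psi>\<close> identified two points, the orbit
  would only reach two complex lines of pairs (lemma \<open>orbit_not_in_two_lines\<close>). So \<open>\<omega>\<close> has no zeros
  and \<open>\<psi>\<close> is injective, and by Picard's theorem an injective self-map is \<open>z \<mapsto> a * z\<close> or \<open>z \<mapsto> a / z\<close>
  (\<open>injective_self_map_punctured_plane\<close>). The second form has two fixed points, at which the orbit is
  a pair of geometric sequences, too rigid to be dense (\<open>no_two_fixed_points\<close>).

  For \<open>\<psi> z = a * z\<close> write \<open>\<omega> z = z powi m * exp (W z)\<close>. The sign of \<open>m\<close> is decided by winding numbers:
  along a circle \<open>\<bar>z\<bar> = r\<close> the function \<open>(C ^^ n) f\<close> winds \<open>n * m + j\<close> times around \<open>0\<close>, where \<open>j\<close> is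
  the winding number of \<open>f\<close> along \<open>\<bar>z\<bar> = \<bar>a\<bar> ^ n * r\<close>. Since \<open>f\<close> is holomorphic, its winding number
  does not decrease with the radius (\<open>circle_index_mono\<close>). So if \<open>\<bar>a\<bar> \<le> 1\<close> and \<open>m \<le> 0\<close>, the winding numbers
  along the orbit are bounded above, and \<open>z powi k\<close> cannot be approximated for large \<open>k\<close>; similarly
  from below if \<open>\<bar>a\<bar> \<ge> 1\<close> and \<open>m \<ge> 0\<close>. Hence \<open>m \<ge> 1\<close> if \<open>\<bar>a\<bar> \<le> 1\<close> and \<open>m \<le> - 1\<close> if \<open>\<bar>a\<bar> \<ge> 1\<close>; in
  particular \<open>\<bar>a\<bar> \<noteq> 1\<close> (\<open>winding_obstruction\<close>).

  Conversely, let \<open>\<psi> z = a * z\<close> with \<open>0 < \<bar>a\<bar> < 1\<close> and \<open>m \<ge> 1\<close>. The equation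
  \<open>h z - h (a * z) = W z - c\<close> can be solved coefficientwise in the Laurent expansion
  (\<open>punctured_plane_coboundary\<close>). With \<open>e k z = z powi k * exp (h z)\<close> this gives
  \<open>C (e k) = exp c * a powi k * e (k + m)\<close>: the operator is a weighted shift in both directions. The
  weights of \<open>(C ^^ n) (e k)\<close> and of its inverse images are products of \<open>n\<close> factors tending to \<open>0\<close>
  geometrically, and beat the growth of \<open>e (k + n * m)\<close> on a compact set. So all series in the
  Frequent Hypercyclicity Criterion converge absolutely on a dense set. The case of \<open>1 / a\<close> is the
  same after replacing \<open>z\<close> by \<open>1 / z\<close>.

  Finally the criterion implies the dynamical properties. If \<open>u\<close> and \<open>v\<close> are in the dense set, then
  \<open>u + (S ^^ k) v\<close> starts near \<open>u\<close> and is mapped near \<open>v\<close>, which gives mixing; the two-sided sums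
  \<open>g + (\<Sum>j. (T ^^ (r * j)) g) + (\<Sum>j. (S ^^ (r * j)) g)\<close> are periodic and close to \<open>g\<close>; and placing
  \<open>(S ^^ n) (y l)\<close> at times \<open>n\<close> from pairwise distant sets of positive lower density, and summing,
  gives a frequently hypercyclic vector. The latter is also supercyclic, which closes the circle.
\<close>

section \<open>The compact-open topology\<close>

text \<open>
  For a subbasic set of functions mapping \<open>K\<close> into \<open>V\<close> the reason is that the compact set \<open>g ` K\<close> keeps
  a positive distance from the complement of \<open>V\<close>. Together with the next lemma this identifies the
  compact-open topology with that of uniform convergence on compact sets, which is the only form used
  later.
\<close>

lemma openin_hol_topologyD:
  assumes "openin (hol_topology \<Omega>) U" "g \<in> U"
  shows "\<exists>K e. compact K \<and> K \<subseteq> \<Omega> \<and> e > 0 \<and>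
           (\<forall>h\<in>hol_space \<Omega>. (\<forall>z\<in>K. norm (h z - g z) < e) \<longrightarrow> h \<in> U)"
proof -
  have "generate_topology_on {{f \<in> hol_space \<Omega>. f ` K \<subseteq> U} | K U. compact K \<and> K \<subseteq> \<Omega> \<and> open U} U"
    using assms(1) unfolding hol_topology_def by (rule openin_topology_generated_by)
  then show ?thesis
    using assms(2)
  proof (induction arbitrary: g)
    case Empty
    then show ?case by simp
  next
    case (Int a b)
    obtain K e where 1: "compact K" "K \<subseteq> \<Omega>" "e > 0"
        "\<forall>h\<in>hol_space \<Omega>. (\<forall>z\<in>K. norm (h z - g z) < e) \<longrightarrow> h \<in> a"
      using Int.IH(1) [of g] Int.prems by auto
    obtain L d where 2: "compact L" "L \<subseteq> \<Omega>" "d > 0"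
        "\<forall>h\<in>hol_space \<Omega>. (\<forall>z\<in>L. norm (h z - g z) < d) \<longrightarrow> h \<in> b"
      using Int.IH(2) [of g] Int.prems by auto
    show ?case
      using 1 2 by (intro exI [of _ "K \<union> L"] exI [of _ "min e d"]) (auto intro: compact_Un)
  next
    case (UN \<K>)
    then obtain k where "k \<in> \<K>" "g \<in> k" by blast
    with UN.IH [of k g] show ?case by (meson UnionI)
  next
    case (Basis s)
    then obtain K V where s: "s = {f \<in> hol_space \<Omega>. f ` K \<subseteq> V}" "compact K" "K \<subseteq> \<Omega>" "open V"
      by blast
    have g: "g holomorphic_on \<Omega>" "g ` K \<subseteq> V"
      using Basis s by (auto simp: hol_space_def)
    have "compact (g ` K)"
      using g s by (meson compact_continuous_image continuous_on_subset holomorphic_on_imp_continuous_on)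
    then obtain e where e: "e > 0" "{x. infdist x (g ` K) \<le> e} \<subseteq> V" if "g ` K \<noteq> {}"
      using compact_in_open_separated [of "g ` K" V] s g by metis
    show ?case
    proof (cases "K = {}")
      case True
      then show ?thesis
        using s by (intro exI [of _ "{}"] exI [of _ 1]) auto
    next
      case False
      then have e': "e > 0" "{x. infdist x (g ` K) \<le> e} \<subseteq> V"
        using e by auto
      have "h \<in> s" if h: "h \<in> hol_space \<Omega>" "\<forall>z\<in>K. norm (h z - g z) < e" for h
      proof -
        have "h z \<in> V" if "z \<in> K" for z
        proof -
          have "infdist (h z) (g ` K) \<le> dist (h z) (g z)"
            using that by (intro infdist_le) auto
          also have "\<dots> < e"
            using h that by (auto simp: dist_norm)
          finally show ?thesis
            using e' by auto
        qed
        then show ?thesis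
          using h s by auto
      qed
      then show ?thesis
        using e' s by (intro exI [of _ K] exI [of _ e]) auto
    qed
  qed
qed

text \<open>
  A uniform ball around \<open>g\<close> contains the finite intersection of the sets of functions that map a piece
  of \<open>K\<close>, on which \<open>g\<close> varies by at most \<open>e/3\<close>, into a ball of radius \<open>e/2\<close>.
\<close>

lemma openin_hol_topologyI:
  assumes U: "U \<subseteq> hol_space \<Omega>"
    and ball: "\<And>g. g \<in> U \<Longrightarrow> \<exists>K e. compact K \<and> K \<subseteq> \<Omega> \<and> e > 0 \<and>
           (\<forall>h\<in>hol_space \<Omega>. (\<forall>z\<in>K. norm (h z - g z) < e) \<longrightarrow> h \<in> U)"
  shows "openin (hol_topology \<Omega>) U"
proof (subst openin_subopen, rule ballI)
  fix g assume g: "g \<in> U"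
  then obtain K e where K: "compact K" "K \<subseteq> \<Omega>" "e > 0"
      "\<And>h. h \<in> hol_space \<Omega> \<Longrightarrow> (\<And>z. z\<in>K \<Longrightarrow> norm (h z - g z) < e) \<Longrightarrow> h \<in> U"
    using ball by meson
  have gH: "g \<in> hol_space \<Omega>"
    using g U by auto
  have cont: "continuous_on K g"
    using K gH by (auto simp: hol_space_def intro: continuous_on_subset holomorphic_on_imp_continuous_on)
  define N where "N = (\<lambda>p. {h \<in> hol_space \<Omega>. h ` (K \<inter> g -` cball p (e/3)) \<subseteq> ball p (e/2)})"
  obtain F where F: "F \<subseteq> g ` K" "finite F" "g ` K \<subseteq> (\<Union>p\<in>F. ball p (e/3))"
  proof (rule compactE_image)
    show "compact (g ` K)" by (intro compact_continuous_image cont K)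
    show "\<And>p. p \<in> g ` K \<Longrightarrow> open (ball p (e/3))" by simp
    show "g ` K \<subseteq> (\<Union>p\<in>g ` K. ball p (e/3))"
      using K by auto
  qed
  have N: "openin (hol_topology \<Omega>) (N p)" for p
  proof -
    have "closed (K \<inter> g -` cball p (e/3))"
      using cont K by (intro continuous_closed_preimage compact_imp_closed) auto
    then have "compact (K \<inter> g -` cball p (e/3))"
      by (metis K(1) compact_Int_closed inf.left_idem)
    then show ?thesis
      unfolding N_def using K by (intro openin_hol_topology_subbasic) auto
  qed
  have gN: "g \<in> N p" for p
    using K(3) gH by (auto simp: N_def)
  let ?W = "hol_space \<Omega> \<inter> (\<Inter>p\<in>F. N p)"
  have "openin (hol_topology \<Omega>) ?W"
  proof (cases "F = {}")
    case True
    then show ?thesis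
      using openin_topspace [of "hol_topology \<Omega>"] by simp
  next
    case False
    then have "openin (hol_topology \<Omega>) (\<Inter>p\<in>F. N p)"
      using F N by (intro openin_INT2) auto
    then show ?thesis
      using openin_topspace [of "hol_topology \<Omega>"] by (simp add: openin_Int)
  qed
  moreover have "g \<in> ?W"
    using gN gH by auto
  moreover have "?W \<subseteq> U"
  proof
    fix h assume h: "h \<in> ?W"
    show "h \<in> U"
    proof (rule K(4))
      show "h \<in> hol_space \<Omega>" using h by simp
    next
      fix z assume z: "z \<in> K"
      then obtain p where p: "p \<in> F" "g z \<in> ball p (e/3)"
        using F by blast
      then have "h z \<in> ball p (e/2)"
        using h z p(1) by (force simp: N_def dist_commute)
      then have "dist (h z) (g z) < e/2 + e/3"
        using p by (metis add_strict_mono dist_commute dist_triangle_lt mem_ball)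
      then show "norm (h z - g z) < e"
        using K by (simp add: dist_norm)
    qed
  qed
  ultimately show "\<exists>W. openin (hol_topology \<Omega>) W \<and> g \<in> W \<and> W \<subseteq> U"
    by blast
qed

text \<open>
  The slack \<open>e - d\<close> makes openness immediate; strict inequality at every point of \<open>K\<close> would first have
  to be converted into such a \<open>d\<close> by compactness.
\<close>

lemma openin_hol_ball:
  assumes "compact K" "K \<subseteq> \<Omega>" "f \<in> hol_space \<Omega>"
  shows "openin (hol_topology \<Omega>) {h \<in> hol_space \<Omega>. \<exists>d<e. \<forall>z\<in>K. norm (h z - f z) \<le> d}"
proof (rule openin_hol_topologyI)
  fix g assume "g \<in> {h \<in> hol_space \<Omega>. \<exists>d<e. \<forall>z\<in>K. norm (h z - f z) \<le> d}"
  then obtain d where d: "d < e" "\<forall>z\<in>K. norm (g z - f z) \<le> d" by blast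
  have "\<exists>c<e. \<forall>z\<in>K. norm (h z - f z) \<le> c" if "\<forall>z\<in>K. norm (h z - g z) < (e - d)/2" for h
  proof (intro exI conjI ballI)
    show "d + (e - d)/2 < e" using d by (simp add: field_simps)
    fix z assume "z \<in> K"
    then show "norm (h z - f z) \<le> d + (e - d)/2"
      using that d norm_triangle_ineq [of "h z - g z" "g z - f z"]
      by (smt (verit) diff_add_cancel add_diff_eq bspec)
  qed
  then show "\<exists>K' e'. compact K' \<and> K' \<subseteq> \<Omega> \<and> e' > 0 \<and>
      (\<forall>h\<in>hol_space \<Omega>. (\<forall>z\<in>K'. norm (h z - g z) < e') \<longrightarrow>
         h \<in> {h \<in> hol_space \<Omega>. \<exists>d<e. \<forall>z\<in>K. norm (h z - f z) \<le> d})"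
    using assms d by (intro exI [of _ K] exI [of _ "(e-d)/2"]) auto
qed auto

lemma limitin_hol_topology:
  "limitin (hol_topology \<Omega>) x s F \<longleftrightarrow>
     s \<in> hol_space \<Omega> \<and> (\<forall>\<^sub>F i in F. x i \<in> hol_space \<Omega>) \<and>
     (\<forall>K e. compact K \<and> K \<subseteq> \<Omega> \<and> e > 0 \<longrightarrow> (\<forall>\<^sub>F i in F. \<forall>z\<in>K. norm (x i z - s z) < e))"
  (is "?L = ?R")
proof
  assume L: ?L
  then have s: "s \<in> hol_space \<Omega>"
    by (simp add: limitin_def)
  moreover have "\<forall>\<^sub>F i in F. x i \<in> hol_space \<Omega>"
    using L openin_topspace [of "hol_topology \<Omega>"] s by (simp add: limitin_def)
  moreover have "\<forall>\<^sub>F i in F. \<forall>z\<in>K. norm (x i z - s z) < e"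
    if "compact K" "K \<subseteq> \<Omega>" "e > 0" for K e
  proof -
    have "s \<in> {h \<in> hol_space \<Omega>. \<exists>d<e. \<forall>z\<in>K. norm (h z - s z) \<le> d}"
      using s that by auto
    then have "\<forall>\<^sub>F i in F. x i \<in> {h \<in> hol_space \<Omega>. \<exists>d<e. \<forall>z\<in>K. norm (h z - s z) \<le> d}"
      by (rule limitinD [OF L openin_hol_ball [OF that(1,2) s]])
    then show ?thesis
      by (rule eventually_mono) (auto intro: le_less_trans)
  qed
  ultimately show ?R by blast
next
  assume R: ?R
  show ?L
    unfolding limitin_def
  proof (intro conjI allI impI)
    show "s \<in> topspace (hol_topology \<Omega>)" using R by simp
    fix U assume "openin (hol_topology \<Omega>) U \<and> s \<in> U"
    then obtain K e where K: "compact K" "K \<subseteq> \<Omega>" "e > 0"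
      "\<forall>h\<in>hol_space \<Omega>. (\<forall>z\<in>K. norm (h z - s z) < e) \<longrightarrow> h \<in> U"
      using openin_hol_topologyD by metis
    have "\<forall>\<^sub>F i in F. x i \<in> hol_space \<Omega> \<and> (\<forall>z\<in>K. norm (x i z - s z) < e)"
      using R K by (intro eventually_conj) auto
    then show "\<forall>\<^sub>F i in F. x i \<in> U"
      by eventually_elim (use K in auto)
  qed
qed

lemma dense_in_hol_space_iff:
  "dense_in_space (hol_topology \<Omega>) D \<longleftrightarrow>
     D \<subseteq> hol_space \<Omega> \<and>
     (\<forall>g\<in>hol_space \<Omega>. \<forall>K e. compact K \<and> K \<subseteq> \<Omega> \<and> e > 0 \<longrightarrow> (\<exists>d\<in>D. \<forall>z\<in>K. norm (d z - g z) < e))"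
  (is "?L = ?R")
proof
  assume L: ?L
  have "\<exists>d\<in>D. \<forall>z\<in>K. norm (d z - g z) < e"
    if g: "g \<in> hol_space \<Omega>" and K: "compact K" "K \<subseteq> \<Omega>" "e > 0" for g K e
  proof -
    have "g \<in> hol_topology \<Omega> closure_of D"
      using L g by (simp add: dense_in_space_def)
    moreover have "g \<in> {h \<in> hol_space \<Omega>. \<exists>d<e. \<forall>z\<in>K. norm (h z - g z) \<le> d}"
      using g K by auto
    ultimately obtain y where "y \<in> D" "y \<in> {h \<in> hol_space \<Omega>. \<exists>d<e. \<forall>z\<in>K. norm (h z - g z) \<le> d}"
      using openin_hol_ball [OF K(1,2) g, of e] unfolding in_closure_of by meson
    then show ?thesis
      by (intro bexI [of _ y]) auto
  qed
  then show ?R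
    using L by (auto simp: dense_in_space_def)
next
  assume R: ?R
  have "g \<in> hol_topology \<Omega> closure_of D" if g: "g \<in> hol_space \<Omega>" for g
    unfolding in_closure_of
  proof (intro conjI allI impI)
    show "g \<in> topspace (hol_topology \<Omega>)" using g by simp
    fix T assume "g \<in> T \<and> openin (hol_topology \<Omega>) T"
    then obtain K e where K: "compact K" "K \<subseteq> \<Omega>" "e > 0"
      "\<forall>h\<in>hol_space \<Omega>. (\<forall>z\<in>K. norm (h z - g z) < e) \<longrightarrow> h \<in> T"
      using openin_hol_topologyD by metis
    then obtain d where "d \<in> D" "\<forall>z\<in>K. norm (d z - g z) < e"
      using R g by meson
    then show "\<exists>y. y \<in> D \<and> y \<in> T"
      using K R by auto
  qed
  then show ?L
    using R closure_of_subset_topspace [of "hol_topology \<Omega>" D]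
    by (auto simp: dense_in_space_def)
qed

lemma hol_space_zero: "0 \<in> hol_space \<Omega>"
  by (auto simp: hol_space_def zero_fun_def)

lemma hol_space_add: "f \<in> hol_space \<Omega> \<Longrightarrow> g \<in> hol_space \<Omega> \<Longrightarrow> f + g \<in> hol_space \<Omega>"
  by (auto simp: hol_space_def plus_fun_def intro!: holomorphic_intros)

lemma hol_space_scale: "f \<in> hol_space \<Omega> \<Longrightarrow> hol_scale c f \<in> hol_space \<Omega>"
  by (auto simp: hol_space_def hol_scale_def intro!: holomorphic_intros)

lemma hol_space_sum: "(\<And>i. i \<in> A \<Longrightarrow> f i \<in> hol_space \<Omega>) \<Longrightarrow> sum f A \<in> hol_space \<Omega>"
  by (induction A rule: infinite_finite_induct) (auto intro: hol_space_zero hol_space_add)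

lemma sum_fun_apply: "sum f A z = (\<Sum>i\<in>A. f i z)"
  by (induction A rule: infinite_finite_induct) auto

text \<open>
  Sequences that are uniformly Cauchy on compact sets converge locally uniformly, and such limits of
  holomorphic functions are holomorphic.
\<close>

lemma hol_space_complete:
  assumes \<Omega>: "open \<Omega>" and x: "\<And>n::nat. x n \<in> hol_space \<Omega>"
    and Cauchy: "\<And>K e. compact K \<Longrightarrow> K \<subseteq> \<Omega> \<Longrightarrow> e > 0 \<Longrightarrow>
                   \<exists>M. \<forall>m\<ge>M. \<forall>n\<ge>m. \<forall>z\<in>K. norm (x n z - x m z) < e"
  obtains s where "limitin (hol_topology \<Omega>) x s sequentially"
proof -
  have unif: "uniformly_convergent_on K x" if "compact K" "K \<subseteq> \<Omega>" for K
  proof -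
    have "\<exists>M. \<forall>z\<in>K. \<forall>m\<ge>M. \<forall>n\<ge>M. dist (x m z) (x n z) < e" if "e > 0" for e :: real
    proof -
      obtain M where M: "\<forall>m\<ge>M. \<forall>n\<ge>m. \<forall>z\<in>K. norm (x n z - x m z) < e"
        using Cauchy \<open>compact K\<close> \<open>K \<subseteq> \<Omega>\<close> \<open>e > 0\<close> by meson
      have "dist (x m z) (x n z) < e" if "z \<in> K" "m \<ge> M" "n \<ge> M" for z m n
        using M that by (cases "m \<le> n") (auto simp: dist_norm norm_minus_commute)
      then show ?thesis by blast
    qed
    then have "uniformly_Cauchy_on K x"
      by (auto simp: uniformly_Cauchy_on_def)
    then show ?thesis
      by (simp add: Cauchy_uniformly_convergent)
  qed
  define s where "s = (\<lambda>z. if z \<in> \<Omega> then lim (\<lambda>n. x n z) else 0)"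
  have lim: "uniform_limit K x s sequentially" if "compact K" "K \<subseteq> \<Omega>" for K
  proof -
    have "uniform_limit K x (\<lambda>z. lim (\<lambda>n. x n z)) sequentially"
      using unif [OF that] by (simp add: uniformly_convergent_uniform_limit_iff)
    then show ?thesis
      by (rule uniform_limit_cong [THEN iffD1, rotated 2]) (use that in \<open>auto simp: s_def\<close>)
  qed
  have "s holomorphic_on \<Omega>"
  proof (rule holomorphic_uniform_sequence [OF \<Omega>])
    show "x n holomorphic_on \<Omega>" for n
      using x by (simp add: hol_space_def)
    show "\<exists>d>0. cball z d \<subseteq> \<Omega> \<and> uniform_limit (cball z d) x s sequentially" if "z \<in> \<Omega>" for z
      using lim \<Omega> that open_contains_cball [of \<Omega>] by (meson compact_cball)
  qed
  then have "s \<in> hol_space \<Omega>"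
    by (simp add: hol_space_def s_def)
  moreover have "\<forall>\<^sub>F i in sequentially. \<forall>z\<in>K. norm (x i z - s z) < e"
    if "compact K" "K \<subseteq> \<Omega>" "e > 0" for K e
    using uniform_limitD [OF lim [OF that(1,2)] that(3)] by (simp add: dist_norm)
  ultimately have "limitin (hol_topology \<Omega>) x s sequentially"
    using x by (auto simp: limitin_hol_topology)
  then show ?thesis by (rule that)
qed

section \<open>The criterion implies mixing and chaos\<close>

lemma limitin_hol_topologyD:
  assumes "limitin (hol_topology \<Omega>) x s F" "compact K" "K \<subseteq> \<Omega>" "e > 0"
  shows "\<forall>\<^sub>F i in F. \<forall>z\<in>K. norm (x i z - s z) < e"
  using assms unfolding limitin_hol_topology by blast

text \<open>
  The Cauchy property of the net of finite partial sums, in the form in which unconditional convergence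
  enters the construction of orbits: all finite sums over sufficiently late indices are small.
\<close>

lemma unconditionally_convergent_tail:
  fixes x :: "nat \<Rightarrow> complex \<Rightarrow> complex"
  assumes "unconditionally_convergent (hol_topology \<Omega>) x {1..}" "compact K" "K \<subseteq> \<Omega>" "e > 0"
  shows "\<exists>N. \<forall>F. finite F \<and> F \<subseteq> {N..} \<longrightarrow> (\<forall>z\<in>K. norm (\<Sum>n\<in>F. x n z) \<le> e)"
proof -
  obtain s where "limitin (hol_topology \<Omega>) (sum x) s (finite_subsets_at_top {1..})"
    using assms(1) by (auto simp: unconditionally_convergent_def)
  then have "\<forall>\<^sub>F A in finite_subsets_at_top {1..}. \<forall>z\<in>K. norm (sum x A z - s z) < e/2"
    using assms by (auto dest!: limitin_hol_topologyD [where e = "e/2"])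
  then obtain Y where Y: "finite Y" "Y \<subseteq> {1..}"
      "\<And>A. finite A \<Longrightarrow> Y \<subseteq> A \<Longrightarrow> A \<subseteq> {1..} \<Longrightarrow> \<forall>z\<in>K. norm (sum x A z - s z) < e/2"
    unfolding eventually_finite_subsets_at_top by meson
  define N where "N = Suc (Max (insert 0 Y))"
  have "norm (\<Sum>n\<in>F. x n z) \<le> e" if F: "finite F" "F \<subseteq> {N..}" and z: "z \<in> K" for F z
  proof -
    have "y < N" if "y \<in> Y" for y
      using Y that by (simp add: N_def less_Suc_eq_le)
    then have disj: "F \<inter> Y = {}"
      using F by fastforce
    have "F \<union> Y \<subseteq> {1..}"
      using F Y by (auto simp: N_def)
    then have "norm (sum x (F \<union> Y) z - s z) < e/2" "norm (sum x Y z - s z) < e/2"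
      using Y(3) [of "F \<union> Y"] Y(3) [of Y] Y F z by auto
    moreover have "sum x (F \<union> Y) z = sum x F z + sum x Y z"
      using disj F Y by (simp add: sum.union_disjoint)
    ultimately have "norm (sum x F z) < e"
      by (smt (verit, best) add_diff_eq diff_add_cancel field_sum_of_halves norm_triangle_ineq4)
    then show ?thesis
      by (simp add: sum_fun_apply)
  qed
  then show ?thesis by blast
qed

locale hol_operator =
  fixes \<Omega> :: "complex set" and T :: "(complex \<Rightarrow> complex) \<Rightarrow> (complex \<Rightarrow> complex)"
  assumes open_domain: "open \<Omega>"
    and operator: "operator_on (hol_topology \<Omega>) hol_scale T"
begin

lemma T_closed: "f \<in> hol_space \<Omega> \<Longrightarrow> T f \<in> hol_space \<Omega>"
  using operator by (auto simp: operator_on_def continuous_map_def)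

lemma T_add: "f \<in> hol_space \<Omega> \<Longrightarrow> g \<in> hol_space \<Omega> \<Longrightarrow> T (f + g) = T f + T g"
  using operator by (auto simp: operator_on_def)

lemma T_zero: "T 0 = 0"
  using operator hol_space_zero [of \<Omega>]
  by (auto simp: operator_on_def hol_scale_def zero_fun_def dest!: spec [of _ "0::complex"])

lemma Tn_closed: "f \<in> hol_space \<Omega> \<Longrightarrow> (T ^^ n) f \<in> hol_space \<Omega>"
  by (induction n) (auto intro: T_closed)

lemma Tn_add:
  "f \<in> hol_space \<Omega> \<Longrightarrow> g \<in> hol_space \<Omega> \<Longrightarrow> (T ^^ n) (f + g) = (T ^^ n) f + (T ^^ n) g"
  by (induction n) (auto simp: T_add Tn_closed)

lemma Tn_zero: "(T ^^ n) 0 = 0"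
  by (induction n) (simp_all only: funpow.simps o_apply id_apply T_zero)

lemma Tn_sum:
  "(\<And>i. i \<in> A \<Longrightarrow> f i \<in> hol_space \<Omega>) \<Longrightarrow> (T ^^ n) (sum f A) = (\<Sum>i\<in>A. (T ^^ n) (f i))"
  by (induction A rule: infinite_finite_induct) (auto simp: Tn_zero Tn_add hol_space_sum)

lemma Tn_limit:
  assumes "limitin (hol_topology \<Omega>) x s F"
  shows "limitin (hol_topology \<Omega>) (\<lambda>i. (T ^^ n) (x i)) ((T ^^ n) s) F"
proof (induction n)
  case 0
  then show ?case using assms by simp
next
  case (Suc n)
  have "continuous_map (hol_topology \<Omega>) (hol_topology \<Omega>) T"
    using operator by (simp add: operator_on_def)
  from continuous_map_limit [OF this Suc] show ?case
    by (simp add: o_def)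
qed

end

text \<open>
  The witnesses \<open>X0\<close> and \<open>S\<close> of the criterion are parameters, so that the constructions can refer to them.
\<close>

locale fhc_criterion = hol_operator +
  fixes X0 :: "(complex \<Rightarrow> complex) set" and S :: "(complex \<Rightarrow> complex) \<Rightarrow> (complex \<Rightarrow> complex)"
  assumes dense: "dense_in_space (hol_topology \<Omega>) X0"
    and S_closed: "f \<in> X0 \<Longrightarrow> S f \<in> X0"
    and T_series: "f \<in> X0 \<Longrightarrow> unconditionally_convergent (hol_topology \<Omega>) (\<lambda>n. (T ^^ n) f) {1..}"
    and S_series: "f \<in> X0 \<Longrightarrow> unconditionally_convergent (hol_topology \<Omega>) (\<lambda>n. (S ^^ n) f) {1..}"
    and T_S: "f \<in> X0 \<Longrightarrow> T (S f) = f"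
begin

lemma X0_subset: "f \<in> X0 \<Longrightarrow> f \<in> hol_space \<Omega>"
  using dense by (auto simp: dense_in_hol_space_iff)

lemma X0_approx:
  assumes "g \<in> hol_space \<Omega>" "compact K" "K \<subseteq> \<Omega>" "e > 0"
  obtains f where "f \<in> X0" "\<forall>z\<in>K. norm (f z - g z) < e"
proof -
  have "\<forall>g\<in>hol_space \<Omega>. \<forall>K e. compact K \<and> K \<subseteq> \<Omega> \<and> e > 0 \<longrightarrow> (\<exists>d\<in>X0. \<forall>z\<in>K. norm (d z - g z) < e)"
    using dense unfolding dense_in_hol_space_iff by (rule conjunct2)
  then have "\<exists>d\<in>X0. \<forall>z\<in>K. norm (d z - g z) < e"
    using assms by simp
  then show ?thesis
    using that by (elim bexE)
qed

lemma Sn_closed: "f \<in> X0 \<Longrightarrow> (S ^^ n) f \<in> X0"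
  by (induction n) (auto intro: S_closed)

text \<open>
  The map \<open>S\<close> is only a right inverse of \<open>T\<close> on \<open>X0\<close>, and need not be linear. These two rules are all
  that is known about mixed compositions.
\<close>

lemma Tn_Sn_ge: "f \<in> X0 \<Longrightarrow> m \<le> n \<Longrightarrow> (T ^^ n) ((S ^^ m) f) = (T ^^ (n - m)) f"
proof (induction m arbitrary: n)
  case (Suc m)
  then obtain n' where n: "n = Suc n'" by (cases n) auto
  have "(T ^^ n) ((S ^^ Suc m) f) = (T ^^ n') (T (S ((S ^^ m) f)))"
    unfolding n funpow_Suc_right [of n' T] by simp
  then show ?case
    using Suc n by (simp add: T_S Sn_closed)
qed auto

lemma Tn_Sn_le:
  assumes "f \<in> X0" "n \<le> m"
  shows "(T ^^ n) ((S ^^ m) f) = (S ^^ (m - n)) f"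
proof -
  have "(S ^^ m) f = (S ^^ n) ((S ^^ (m - n)) f)"
    using assms by (metis comp_apply funpow_add le_add_diff_inverse)
  then show ?thesis
    using assms Tn_Sn_ge [of "(S ^^ (m - n)) f" n n] by (simp add: Sn_closed)
qed

lemma series_tail:
  assumes "f \<in> X0" "compact K" "K \<subseteq> \<Omega>" "e > 0"
  shows "\<exists>N. \<forall>F. finite F \<and> F \<subseteq> {N..} \<longrightarrow>
           (\<forall>z\<in>K. norm (\<Sum>n\<in>F. (T ^^ n) f z) \<le> e) \<and> (\<forall>z\<in>K. norm (\<Sum>n\<in>F. (S ^^ n) f z) \<le> e)"
proof -
  obtain N1 where N1: "\<forall>F. finite F \<and> F \<subseteq> {N1..} \<longrightarrow> (\<forall>z\<in>K. norm (\<Sum>n\<in>F. (T ^^ n) f z) \<le> e)"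
    using unconditionally_convergent_tail [OF T_series assms(2-4)] assms(1) by meson
  obtain N2 where N2: "\<forall>F. finite F \<and> F \<subseteq> {N2..} \<longrightarrow> (\<forall>z\<in>K. norm (\<Sum>n\<in>F. (S ^^ n) f z) \<le> e)"
    using unconditionally_convergent_tail [OF S_series assms(2-4)] assms(1) by meson
  show ?thesis
  proof (intro exI [of _ "max N1 N2"] allI impI)
    fix F assume "finite F \<and> F \<subseteq> {max N1 N2..}"
    then have "finite F" "F \<subseteq> {N1..}" "F \<subseteq> {N2..}" by auto
    then show "(\<forall>z\<in>K. norm (\<Sum>n\<in>F. (T ^^ n) f z) \<le> e) \<and> (\<forall>z\<in>K. norm (\<Sum>n\<in>F. (S ^^ n) f z) \<le> e)"
      using N1 N2 by meson
  qed
qed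

text \<open>
  For \<open>u\<close> and \<open>v\<close> in \<open>X0\<close> the vector \<open>u + (S ^^ k) v\<close> tends to \<open>u\<close>, and its image
  \<open>(T ^^ k) u + v\<close> tends to \<open>v\<close>, since terms of convergent series tend to \<open>0\<close>.
\<close>

theorem fhc_imp_mixing: "mixing (hol_topology \<Omega>) T"
  unfolding mixing_def
proof (intro allI impI)
  fix U V assume UV: "openin (hol_topology \<Omega>) U \<and> openin (hol_topology \<Omega>) V \<and> U \<noteq> {} \<and> V \<noteq> {}"
  then obtain g h where gh: "g \<in> U" "h \<in> V" by auto
  have gh': "g \<in> hol_space \<Omega>" "h \<in> hol_space \<Omega>"
    using UV gh openin_subset [of "hol_topology \<Omega>"] by auto
  obtain K e where K: "compact K" "K \<subseteq> \<Omega>" "e > 0"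
      "\<forall>f\<in>hol_space \<Omega>. (\<forall>z\<in>K. norm (f z - g z) < e) \<longrightarrow> f \<in> U"
    using UV gh openin_hol_topologyD by metis
  obtain L d where L: "compact L" "L \<subseteq> \<Omega>" "d > 0"
      "\<forall>f\<in>hol_space \<Omega>. (\<forall>z\<in>L. norm (f z - h z) < d) \<longrightarrow> f \<in> V"
    using UV gh openin_hol_topologyD by metis
  obtain u where u: "u \<in> X0" "\<forall>z\<in>K. norm (u z - g z) < e/2"
    using X0_approx [OF gh'(1) K(1,2), of "e/2"] K(3) by auto
  obtain v where v: "v \<in> X0" "\<forall>z\<in>L. norm (v z - h z) < d/2"
    using X0_approx [OF gh'(2) L(1,2), of "d/2"] L(3) by auto
  obtain N1 where N1: "\<forall>F. finite F \<and> F \<subseteq> {N1..} \<longrightarrow> (\<forall>z\<in>K. norm (\<Sum>n\<in>F. (S ^^ n) v z) \<le> e/2)"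
    using series_tail [OF v(1) K(1,2), of "e/2"] K(3) by (metis half_gt_zero)
  obtain N2 where N2: "\<forall>F. finite F \<and> F \<subseteq> {N2..} \<longrightarrow> (\<forall>z\<in>L. norm (\<Sum>n\<in>F. (T ^^ n) u z) \<le> d/2)"
    using series_tail [OF u(1) L(1,2), of "d/2"] L(3) by (metis half_gt_zero)
  have "(T ^^ k) ` U \<inter> V \<noteq> {}" if k: "k \<ge> max N1 N2" for k
  proof -
    let ?f = "u + (S ^^ k) v"
    have mem: "u \<in> hol_space \<Omega>" "v \<in> hol_space \<Omega>" "(S ^^ k) v \<in> hol_space \<Omega>"
      using u v by (auto intro: X0_subset Sn_closed)
    have S: "norm ((S ^^ k) v z) \<le> e/2" if "z \<in> K" for z
      using N1 [rule_format, of "{k}"] that k by simp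
    have "norm (?f z - g z) < e" if "z \<in> K" for z
      using S [OF that] u that norm_triangle_ineq [of "u z - g z" "(S ^^ k) v z"]
      by (fastforce simp: algebra_simps)
    then have "?f \<in> U"
      using K(4) hol_space_add [OF mem(1,3)] by blast
    have T: "norm ((T ^^ k) u z) \<le> d/2" if "z \<in> L" for z
      using N2 [rule_format, of "{k}"] that k by simp
    have Tf: "(T ^^ k) ?f = (T ^^ k) u + v"
      using mem Tn_Sn_ge [OF v(1), of k k] by (simp add: Tn_add)
    have "norm ((T ^^ k) ?f z - h z) < d" if "z \<in> L" for z
      using T [OF that] v that norm_triangle_ineq [of "v z - h z" "(T ^^ k) u z"]
      unfolding Tf by (fastforce simp: algebra_simps)
    moreover have "(T ^^ k) ?f \<in> hol_space \<Omega>"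
      using mem by (auto intro!: Tn_closed hol_space_add)
    ultimately have "(T ^^ k) ?f \<in> V"
      using L(4) by auto
    with \<open>?f \<in> U\<close> show ?thesis by blast
  qed
  then show "\<exists>n. \<forall>k\<ge>n. (T ^^ k) ` U \<inter> V \<noteq> {}" by blast
qed

text \<open>
  This transfers the telescoping of finite two-sided sums to their limit.
\<close>

lemma almost_fixed_sequence_limit_fixed:
  assumes f: "f \<in> hol_space \<Omega>" "limitin (hol_topology \<Omega>) p f sequentially"
    and d: "\<And>z. z \<in> \<Omega> \<Longrightarrow> (\<lambda>M. (T ^^ r) (p M) z - p M z) \<longlonglongrightarrow> 0"
  shows "(T ^^ r) f = f"
proof
  have pw: "(\<lambda>M. q M z) \<longlonglongrightarrow> g z" if "limitin (hol_topology \<Omega>) q g sequentially" "z \<in> \<Omega>" for q g z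
  proof (rule tendstoI)
    fix e :: real assume "e > 0"
    have "compact {z}" "{z} \<subseteq> \<Omega>"
      using that(2) by auto
    from limitin_hol_topologyD [OF that(1) this \<open>e > 0\<close>]
    show "\<forall>\<^sub>F i in sequentially. dist (q i z) (g z) < e"
      by (simp add: dist_norm)
  qed
  fix z
  show "(T ^^ r) f z = f z"
  proof (cases "z \<in> \<Omega>")
    case True
    have "(\<lambda>M. (T ^^ r) (p M) z - p M z) \<longlonglongrightarrow> (T ^^ r) f z - f z"
      using pw [OF Tn_limit [OF f(2)] True] pw [OF f(2) True] by (intro tendsto_diff)
    with d [OF True] show ?thesis
      using LIMSEQ_unique by fastforce
  next
    case False
    then show ?thesis
      using f Tn_closed [of f r] by (simp add: hol_space_def)
  qed
qed

text \<open>
  The periodic point near \<open>g\<close> is the sum of \<open>g\<close>, of all \<open>(T ^^ (r * j)) g\<close> and of all \<open>(S ^^ (r * j)) g\<close> with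
  \<open>j \<ge> 1\<close>. Applying \<open>T ^^ r\<close> shifts this two-sided series by one place, and for large \<open>r\<close> only
  indices beyond the tail bound occur.
\<close>

theorem periodic_points_dense:
  "dense_in_space (hol_topology \<Omega>) {f \<in> hol_space \<Omega>. \<exists>r\<ge>1. (T ^^ r) f = f}"
  unfolding dense_in_hol_space_iff
proof (intro conjI ballI allI impI)
  fix g0 K and e :: real assume g0: "g0 \<in> hol_space \<Omega>" and K: "compact K \<and> K \<subseteq> \<Omega> \<and> e > 0"
  obtain g where g: "g \<in> X0" "\<forall>z\<in>K. norm (g z - g0 z) < e/2"
    using X0_approx [OF g0, of K "e/2"] K by auto
  obtain N where N: "\<forall>F. finite F \<and> F \<subseteq> {N..} \<longrightarrow> (\<forall>z\<in>K. norm (\<Sum>n\<in>F. (T ^^ n) g z) \<le> e/8) \<and>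
                       (\<forall>z\<in>K. norm (\<Sum>n\<in>F. (S ^^ n) g z) \<le> e/8)"
    using series_tail [OF g(1), of K "e/8"] K by (meson divide_pos_pos zero_less_numeral)
  define r where "r = Suc N"
  define p where "p = (\<lambda>M. g + (\<Sum>j=1..M. (T ^^ (r*j)) g) + (\<Sum>j=1..M. (S ^^ (r*j)) g))"
  have gH: "g \<in> hol_space \<Omega>" and TH: "(T ^^ n) g \<in> hol_space \<Omega>" and SH: "(S ^^ n) g \<in> hol_space \<Omega>" for n
    using g by (auto intro: X0_subset Sn_closed Tn_closed)
  have pH: "p M \<in> hol_space \<Omega>" for M
    unfolding p_def by (intro hol_space_add hol_space_sum gH TH SH)
  have reindex: "(\<Sum>j\<in>A. (R ^^ (r*j)) g z) = (\<Sum>n\<in>(\<lambda>j. r*j) ` A. (R ^^ n) g z)" for A z R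
  proof -
    have "inj_on (\<lambda>j. r * j) A"
      by (rule inj_onI) (simp add: r_def del: mult_Suc)
    then show ?thesis
      by (simp add: sum.reindex)
  qed
  have small: "norm (\<Sum>j\<in>A. (T ^^ (r*j)) g z) \<le> d \<and> norm (\<Sum>j\<in>A. (S ^^ (r*j)) g z) \<le> d"
    if "\<forall>F. finite F \<and> F \<subseteq> {M..} \<longrightarrow> (\<forall>z\<in>L. norm (\<Sum>n\<in>F. (T ^^ n) g z) \<le> d) \<and>
                       (\<forall>z\<in>L. norm (\<Sum>n\<in>F. (S ^^ n) g z) \<le> d)"
       "finite A" "\<And>j. j \<in> A \<Longrightarrow> r * j \<ge> M" "z \<in> L" for A M L d z
  proof -
    have "finite ((\<lambda>j. r*j) ` A) \<and> (\<lambda>j. r*j) ` A \<subseteq> {M..}"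
      using that(2,3) by blast
    then show ?thesis
      unfolding reindex using that(1,4) by blast
  qed
  have Cauchy: "\<exists>M. \<forall>m\<ge>M. \<forall>n\<ge>m. \<forall>z\<in>L. norm (p n z - p m z) < d"
    if L: "compact L" "L \<subseteq> \<Omega>" "d > 0" for L d
  proof -
    obtain M where M: "\<forall>F. finite F \<and> F \<subseteq> {M..} \<longrightarrow> (\<forall>z\<in>L. norm (\<Sum>n\<in>F. (T ^^ n) g z) \<le> d/3) \<and>
                       (\<forall>z\<in>L. norm (\<Sum>n\<in>F. (S ^^ n) g z) \<le> d/3)"
      using series_tail [OF g(1) L(1,2), of "d/3"] L(3) by (meson divide_pos_pos zero_less_numeral)
    have "norm (p n z - p m z) < d" if mn: "m \<ge> M" "n \<ge> m" and z: "z \<in> L" for m n z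
    proof -
      have split: "sum f {1..n} = sum f {1..m} + sum f {m<..n}" for f :: "nat \<Rightarrow> complex"
      proof -
        have "{1..n} = {1..m} \<union> {m<..n}" using mn by auto
        moreover have "{1..m} \<inter> {m<..n} = {}" by auto
        ultimately show ?thesis by (metis finite_atLeastAtMost finite_greaterThanAtMost sum.union_disjoint)
      qed
      have eq: "p n z - p m z = (\<Sum>j\<in>{m<..n}. (T ^^ (r*j)) g z) + (\<Sum>j\<in>{m<..n}. (S ^^ (r*j)) g z)"
        unfolding p_def plus_fun_apply sum_fun_apply split by simp
      have "r * j \<ge> M" if "j \<in> {m<..n}" for j
        using that mn by (simp add: r_def)
      then have "norm (\<Sum>j\<in>{m<..n}. (T ^^ (r*j)) g z) \<le> d/3 \<and> norm (\<Sum>j\<in>{m<..n}. (S ^^ (r*j)) g z) \<le> d/3"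
        using z by (intro small [OF M]) auto
      then show ?thesis
        using \<open>d > 0\<close> norm_triangle_ineq [of "\<Sum>j\<in>{m<..n}. (T ^^ (r*j)) g z" "\<Sum>j\<in>{m<..n}. (S ^^ (r*j)) g z"]
        unfolding eq by linarith
    qed
    then show ?thesis by blast
  qed
  obtain f where f: "limitin (hol_topology \<Omega>) p f sequentially"
    using hol_space_complete [OF open_domain pH Cauchy] by blast
  then have fH: "f \<in> hol_space \<Omega>"
    by (simp add: limitin_hol_topology)
  have "(T ^^ r) f = f"
  proof (rule almost_fixed_sequence_limit_fixed [OF fH f])
    fix z assume z: "z \<in> \<Omega>"
    \<comment> \<open>the two series telescope under \<open>T ^^ r\<close>, up to one boundary term at each end\<close>
    have eq: "(T ^^ r) (p M) z - p M z = (T ^^ (r * Suc M)) g z - (S ^^ (r * M)) g z" if "M \<ge> 1" for M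
    proof -
      have "(T ^^ r) (p M) = (T ^^ r) g + (\<Sum>j=1..M. (T ^^ r) ((T ^^ (r*j)) g)) + (\<Sum>j=1..M. (T ^^ r) ((S ^^ (r*j)) g))"
        unfolding p_def by (simp add: Tn_add Tn_sum hol_space_add hol_space_sum gH TH SH)
      also have "(\<Sum>j=1..M. (T ^^ r) ((T ^^ (r*j)) g)) = (\<Sum>j=1..M. (T ^^ (r * Suc j)) g)"
        by (intro sum.cong refl) (metis comp_apply funpow_add mult_Suc_right)
      also have "(\<Sum>j=1..M. (T ^^ r) ((S ^^ (r*j)) g)) = (\<Sum>j=1..M. (S ^^ (r * (j - 1))) g)"
        using g by (intro sum.cong refl) (simp add: Tn_Sn_le diff_mult_distrib2)
      finally have 1: "(T ^^ r) (p M) = (T ^^ r) g + (\<Sum>j=1..M. (T ^^ (r * Suc j)) g) + (\<Sum>j=1..M. (S ^^ (r * (j - 1))) g)" .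
      have 2: "u 1 + (\<Sum>j=1..M. u (Suc j)) = (\<Sum>j=1..M. u j) + u (Suc M)" for u :: "nat \<Rightarrow> complex"
        by (induction M) (auto simp: algebra_simps)
      have 3: "(\<Sum>j=1..M. u (j - 1)) + u M = u 0 + (\<Sum>j=1..M. u j)" for u :: "nat \<Rightarrow> complex"
        by (induction M) (auto simp: algebra_simps)
      have "(T ^^ r) (p M) z = (T ^^ (r * 1)) g z + (\<Sum>j=1..M. (T ^^ (r * Suc j)) g z) + (\<Sum>j=1..M. (S ^^ (r * (j - 1))) g z)"
        unfolding 1 plus_fun_apply sum_fun_apply by simp
      moreover have "p M z = (S ^^ (r * 0)) g z + (\<Sum>j=1..M. (T ^^ (r * j)) g z) + (\<Sum>j=1..M. (S ^^ (r * j)) g z)"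
        unfolding p_def plus_fun_apply sum_fun_apply by simp
      moreover have "x - y = tM - sM"
        if "x = t1 + tS + sP" "y = s0 + tA + sA" "t1 + tS = tA + tM" "sP + sM = s0 + sA"
        for x y t1 tS sP s0 tA sA tM sM :: complex
        using that by algebra
      ultimately show ?thesis
        using 2 [of "\<lambda>j. (T ^^ (r * j)) g z"] 3 [of "\<lambda>j. (S ^^ (r * j)) g z"] by blast
    qed
    show "(\<lambda>M. (T ^^ r) (p M) z - p M z) \<longlonglongrightarrow> 0"
    proof (rule tendstoI)
      fix d :: real assume d: "d > 0"
      obtain M0 where M0: "\<forall>F. finite F \<and> F \<subseteq> {M0..} \<longrightarrow> (\<forall>z\<in>{z}. norm (\<Sum>n\<in>F. (T ^^ n) g z) \<le> d/3) \<and>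
                       (\<forall>z\<in>{z}. norm (\<Sum>n\<in>F. (S ^^ n) g z) \<le> d/3)"
        using series_tail [OF g(1), of "{z}" "d/3"] z d by auto
      have "dist ((T ^^ r) (p M) z - p M z) 0 < d" if "M \<ge> Suc M0" for M
      proof -
        have "r * Suc M \<ge> M0" "r * M \<ge> M0"
          using that by (auto simp: r_def)
        then have "norm ((T ^^ (r * Suc M)) g z) \<le> d/3" "norm ((S ^^ (r * M)) g z) \<le> d/3"
          using M0 [rule_format, of "{r * Suc M}"] M0 [rule_format, of "{r * M}"] by auto
        then show ?thesis
          using eq [of M] that d norm_triangle_ineq4 [of "(T ^^ (r * Suc M)) g z" "(S ^^ (r * M)) g z"]
          by simp
      qed
      then show "\<forall>\<^sub>F M in sequentially. dist ((T ^^ r) (p M) z - p M z) 0 < d"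
        using eventually_sequentially by blast
    qed
  qed
  moreover have "\<forall>z\<in>K. norm (f z - g0 z) < e"
  proof
    fix z assume z: "z \<in> K"
    have "\<forall>\<^sub>F M in sequentially. \<forall>z\<in>K. norm (p M z - f z) < e/8"
      using limitin_hol_topologyD [OF f, of K "e/8"] K by auto
    then obtain M where M: "norm (p M z - f z) < e/8"
      using z by (auto simp: eventually_sequentially)
    have "norm (\<Sum>j\<in>{1..M}. (T ^^ (r*j)) g z) \<le> e/8 \<and> norm (\<Sum>j\<in>{1..M}. (S ^^ (r*j)) g z) \<le> e/8"
    proof (rule small [OF N])
      fix j assume "j \<in> {1..M}"
      then show "N \<le> r * j" by (cases j) (auto simp: r_def)
    qed (use z in auto)
    moreover have "p M z - g z = (\<Sum>j\<in>{1..M}. (T ^^ (r*j)) g z) + (\<Sum>j\<in>{1..M}. (S ^^ (r*j)) g z)"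
      by (simp add: p_def sum_fun_apply)
    ultimately have "norm (p M z - g z) \<le> e/8 + e/8"
      using norm_triangle_mono by metis
    then have "norm (p M z - g z) \<le> e/4"
      by simp
    moreover have "norm (g z - g0 z) < e/2"
      using g z by auto
    ultimately have "norm ((p M z - g z) - (p M z - f z) + (g z - g0 z)) < e"
      using M K norm_triangle_ineq [of "(p M z - g z) - (p M z - f z)" "g z - g0 z"]
        norm_triangle_ineq4 [of "p M z - g z" "p M z - f z"] by linarith
    then show "norm (f z - g0 z) < e"
      by simp
  qed
  ultimately show "\<exists>d\<in>{f \<in> hol_space \<Omega>. \<exists>r\<ge>1. (T ^^ r) f = f}. \<forall>z\<in>K. norm (d z - g0 z) < e"
    using fH by (intro bexI [of _ f]) (auto simp: r_def intro!: exI [of _ "Suc N"])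
qed auto

theorem fhc_imp_chaotic: "chaotic (hol_topology \<Omega>) T"
  using fhc_imp_mixing periodic_points_dense
  unfolding chaotic_def mixing_def topologically_transitive_def topspace_hol_topology
  by (meson order_refl)

end

section \<open>Separated sets of positive lower density\<close>

abbreviation val2 :: "nat \<Rightarrow> nat" where
  "val2 k \<equiv> multiplicity 2 k"

definition val2_sum :: "nat \<Rightarrow> nat" where
  "val2_sum k = (\<Sum>i=1..k. val2 i)"

lemma val2_sum_Suc: "val2_sum (Suc k) = val2_sum k + val2 (Suc k)"
  by (simp add: val2_sum_def)

lemma val2_sum_mono: "j \<le> k \<Longrightarrow> val2_sum j \<le> val2_sum k"
  unfolding val2_sum_def by (intro sum_mono2) auto

lemma val2_odd: "val2 (2 * q + 1) = 0"
  by (rule not_dvd_imp_multiplicity_0) simp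

lemma val2_double: "q > 0 \<Longrightarrow> val2 (2 * q) = Suc (val2 q)"
  by (rule multiplicity_times_same) auto

lemma val2_power_odd: "val2 (2 ^ p * (2 * i + 1)) = p"
  by (induction p) (use val2_odd val2_double in \<open>auto simp: mult.assoc simp del: mult_Suc_right\<close>)

text \<open>
  Among \<open>1, \<dots>, 2 * q\<close> only the even numbers contribute, each one more than its half.
\<close>

lemma val2_sum_double: "val2_sum (2 * q) = q + val2_sum q"
proof (induction q)
  case 0
  then show ?case by (simp add: val2_sum_def)
next
  case (Suc q)
  have "val2_sum (2 * Suc q) = val2_sum (2 * q) + val2 (2 * q + 1) + val2 (2 * Suc q)"
    by (simp add: val2_sum_Suc)
  then show ?case
    using Suc val2_odd [of q] val2_double [of "Suc q"] by (simp add: val2_sum_Suc)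
qed

text \<open>
  The average valuation is at most \<open>1\<close>. This is what makes the spacing below affordable: numbers of
  valuation \<open>p\<close> can be surrounded by gaps of length \<open>p\<close> without losing positive density.
\<close>

lemma val2_sum_le: "val2_sum k \<le> k"
proof (induction k rule: less_induct)
  case (less k)
  show ?case
  proof (cases "k = 0")
    case True
    then show ?thesis by (simp add: val2_sum_def)
  next
    case False
    define q where "q = k div 2"
    have IH: "val2_sum q \<le> q"
      using less False by (simp add: q_def)
    consider "k = 2 * q" | "k = 2 * q + 1"
      unfolding q_def by linarith
    then show ?thesis
    proof cases
      case 1
      then show ?thesis using IH val2_sum_double [of q] by simp
    next
      case 2
      then have "val2_sum k = val2_sum (2 * q) + val2 (2 * q + 1)"
        by (simp add: val2_sum_Suc)
      then show ?thesis
        using 2 IH val2_sum_double [of q] val2_odd [of q] by simp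
    qed
  qed
qed

text \<open>
  The point number \<open>k\<close> in a sequence of points in which \<open>k\<close> keeps a distance of \<open>val2 k\<close> on either side.
  The points of valuation \<open>p\<close> form one class. Two points are at least as far apart as the sum of their
  valuations, and each class with \<open>p \<ge> 1\<close> has positive lower density.
\<close>

definition spread :: "nat \<Rightarrow> nat" where
  "spread k = val2_sum k + val2_sum (k - 1)"

lemma spread_le: "spread k \<le> 2 * k"
  using val2_sum_le [of k] val2_sum_le [of "k - 1"] by (simp add: spread_def)

lemma val2_le_spread: "k \<ge> 1 \<Longrightarrow> val2 k \<le> spread k"
  by (cases k) (auto simp: spread_def val2_sum_Suc)

lemma spread_separated:
  assumes "1 \<le> j" "j < k"
  shows "spread j + val2 j + val2 k \<le> spread k"
proof -
  obtain j' k' where *: "j = Suc j'" "k = Suc k'"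
    using assms by (metis Suc_le_D less_imp_Suc_add One_nat_def)
  have "val2_sum j \<le> val2_sum k'"
    using assms * by (intro val2_sum_mono) auto
  then show ?thesis
    using * by (simp add: spread_def val2_sum_Suc)
qed

text \<open>
  The class contains the images of the numbers \<open>2 ^ p * (2 * i + 1)\<close>, and \<open>spread k \<le> 2 * k\<close>.
\<close>

lemma spread_class_density:
  assumes "p \<ge> 1"
  shows "liminf (\<lambda>N. ereal (real (card {n. n \<le> N \<and> n \<in> spread ` {k. 1 \<le> k \<and> val2 k = p}}) / real (N + 1))) > 0"
proof -
  have "1 / 2 ^ (p + 3) \<le> real (card {n. n \<le> N \<and> n \<in> spread ` {k. 1 \<le> k \<and> val2 k = p}}) / real (N + 1)"
    (is "_ \<le> real (card ?A) / _") if N: "N \<ge> 2 ^ (p + 2)" for N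
  proof -
    define q where "q = N div 2 ^ (p + 2)"
    have "q \<ge> 1"
      using N unfolding q_def by (metis One_nat_def Suc_leI div_greater_zero_iff zero_less_numeral zero_less_power)
    have qN: "2 ^ (p + 2) * q \<le> N" "N < 2 ^ (p + 2) * (q + 1)"
      unfolding q_def using div_mult_mod_eq [of N "2 ^ (p+2)"] mod_less_divisor [of "2 ^ (p+2)" N]
      by (auto simp: algebra_simps simp del: mod_less_divisor)
    define \<kappa> where "\<kappa> = (\<lambda>i::nat. (2::nat) ^ p * (2 * i + 1))"
    have \<kappa>: "\<kappa> i \<ge> 1" "val2 (\<kappa> i) = p" for i
      unfolding \<kappa>_def using val2_power_odd [of p i] by (auto simp: Suc_le_eq simp del: mult_Suc_right distrib_left_numeral)
    have "inj_on (\<lambda>i. spread (\<kappa> i)) {..<q}"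
    proof (rule linorder_inj_onI)
      fix i j :: nat assume "i < j"
      then have "\<kappa> i < \<kappa> j" by (simp add: \<kappa>_def)
      then show "spread (\<kappa> i) \<noteq> spread (\<kappa> j)"
        using spread_separated [of "\<kappa> i" "\<kappa> j"] \<kappa> [of i] \<kappa> [of j] assms by linarith
    qed auto
    then have "card ((\<lambda>i. spread (\<kappa> i)) ` {..<q}) = q"
      by (simp add: card_image)
    moreover have "(\<lambda>i. spread (\<kappa> i)) ` {..<q} \<subseteq> ?A"
    proof
      fix n assume "n \<in> (\<lambda>i. spread (\<kappa> i)) ` {..<q}"
      then obtain i where i: "i < q" "n = spread (\<kappa> i)" by auto
      have "n \<le> 2 * \<kappa> i"
        using spread_le i by simp
      also have "\<dots> \<le> 2 ^ (p + 2) * (i + 1)"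
        by (simp add: \<kappa>_def algebra_simps)
      also have "\<dots> \<le> 2 ^ (p + 2) * q"
        using i by (intro mult_left_mono) auto
      also have "\<dots> \<le> N" by (rule qN)
      finally show "n \<in> ?A"
        using i \<kappa> by auto
    qed
    moreover have "finite ?A" by simp
    ultimately have "q \<le> card ?A"
      by (metis card_mono)
    have "N + 1 \<le> 2 ^ (p + 2) * (q + 1)"
      using qN(2) by simp
    also have "\<dots> \<le> 2 ^ (p + 2) * (2 * q)"
      using \<open>q \<ge> 1\<close> by (intro mult_left_mono) auto
    also have "\<dots> = 2 ^ (p + 3) * q"
      by (simp add: power_add)
    also have "\<dots> \<le> 2 ^ (p + 3) * card ?A"
      using \<open>q \<le> card ?A\<close> by simp
    finally have "N + 1 \<le> 2 ^ (p + 3) * card ?A" .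
    then have "real (N + 1) \<le> real (2 ^ (p + 3) * card ?A)"
      by (simp only: of_nat_le_iff)
    then have "real (N + 1) \<le> 2 ^ (p + 3) * real (card ?A)"
      by (simp only: of_nat_mult of_nat_power of_nat_numeral)
    then show ?thesis
      by (simp add: pos_divide_le_eq pos_le_divide_eq mult.commute)
  qed
  then have "\<forall>\<^sub>F N in sequentially. ereal (1 / 2 ^ (p + 3)) \<le>
      ereal (real (card {n. n \<le> N \<and> n \<in> spread ` {k. 1 \<le> k \<and> val2 k = p}}) / real (N + 1))"
    unfolding eventually_sequentially ereal_less_eq by blast
  then have "ereal (1 / 2 ^ (p + 3)) \<le>
      liminf (\<lambda>N. ereal (real (card {n. n \<le> N \<and> n \<in> spread ` {k. 1 \<le> k \<and> val2 k = p}}) / real (N + 1)))"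
    by (rule Liminf_bounded)
  moreover have "ereal 0 < ereal (1 / 2 ^ (p + 3))"
    by simp
  ultimately show ?thesis
    unfolding zero_ereal_def by (rule less_le_trans [rotated])
qed

lemma spread_unbounded: "k div 2 \<le> spread k"
proof -
  have "k div 2 \<le> val2_sum (2 * (k div 2))"
    by (simp add: val2_sum_double)
  also have "\<dots> \<le> val2_sum k"
    by (intro val2_sum_mono) simp
  finally show ?thesis
    by (simp add: spread_def)
qed

lemma eventually_dyadic_less:
  assumes "e > (0::real)"
  shows "\<exists>l0. \<forall>l\<ge>l0. c / 2 ^ l < e"
proof -
  have "(\<lambda>l. c * (1 / 2) ^ l) \<longlonglongrightarrow> c * 0"
    by (intro tendsto_intros LIMSEQ_power_zero) simp
  then have "(\<lambda>l. c / 2 ^ l) \<longlonglongrightarrow> 0"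
    by (simp add: power_one_over divide_simps)
  then show ?thesis
    using assms by (auto dest!: order_tendstoD(2) [of _ _ _ e] simp: eventually_sequentially)
qed

section \<open>The criterion implies frequent hypercyclicity\<close>

context fhc_criterion
begin

text \<open>
  The sequence comes back to every open set at arbitrarily large indices. It is obtained by approximating
  the \<open>i\<close>-th element of \<open>D\<close> up to \<open>1 / Suc j\<close> on the \<open>j\<close>-th set of the exhaustion, for all pairs \<open>(i, j)\<close>.
\<close>

lemma dense_sequence:
  fixes K :: "nat \<Rightarrow> complex set"
  assumes D: "countable D" "dense_in_space (hol_topology \<Omega>) D"
    and K: "\<And>n. compact (K n)" "\<And>n. K n \<subseteq> \<Omega>"
      "\<forall>L. compact L \<and> L \<subseteq> \<Omega> \<longrightarrow> (\<exists>N. \<forall>n\<ge>N. L \<subseteq> K n)"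
  shows "\<exists>y :: nat \<Rightarrow> complex \<Rightarrow> complex. (\<forall>l. y l \<in> X0) \<and>
    (\<forall>g\<in>hol_space \<Omega>. \<forall>L e l0. compact L \<and> L \<subseteq> \<Omega> \<and> e > 0 \<longrightarrow> (\<exists>l\<ge>l0. \<forall>z\<in>L. norm (y l z - g z) < e))"
proof -
  have dense_D: "\<exists>f\<in>D. \<forall>z\<in>L. norm (f z - g z) < e"
    if "g \<in> hol_space \<Omega>" "compact L" "L \<subseteq> \<Omega>" "e > 0" for g L e
  proof -
    have "\<forall>g\<in>hol_space \<Omega>. \<forall>K e. compact K \<and> K \<subseteq> \<Omega> \<and> e > 0 \<longrightarrow> (\<exists>d\<in>D. \<forall>z\<in>K. norm (d z - g z) < e)"
      using D(2) unfolding dense_in_hol_space_iff by (rule conjunct2)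
    then show ?thesis
      using that by simp
  qed
  have D_sub: "D \<subseteq> hol_space \<Omega>"
    using D(2) unfolding dense_in_hol_space_iff by (rule conjunct1)
  have "D \<noteq> {}"
    using dense_D [of 0 "{}" 1] hol_space_zero by auto
  define d where "d = from_nat_into D"
  have d: "range d = D"
    using D(1) \<open>D \<noteq> {}\<close> by (simp add: d_def)
  have "\<exists>f. f \<in> X0 \<and> (\<forall>z\<in>K j. norm (f z - d i z) < 1 / Suc j)" for i j
  proof -
    have "d i \<in> hol_space \<Omega>" using d D_sub by auto
    from X0_approx [OF this K(1) K(2), of "1 / Suc j" j] show ?thesis
      by (metis of_nat_0_less_iff zero_less_Suc zero_less_divide_1_iff)
  qed
  then have "\<forall>i j. \<exists>f. f \<in> X0 \<and> (\<forall>z\<in>K j. norm (f z - d i z) < 1 / Suc j)"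
    by blast
  then obtain w where "\<forall>i j. w i j \<in> X0 \<and> (\<forall>z\<in>K j. norm (w i j z - d i z) < 1 / Suc j)"
    unfolding choice_iff by blast
  then have w: "\<And>i j. w i j \<in> X0" "\<And>i j. \<forall>z\<in>K j. norm (w i j z - d i z) < 1 / Suc j"
    by blast+
  define y where "y = (\<lambda>l. w (fst (prod_decode l)) (snd (prod_decode l)))"
  have "\<exists>l\<ge>l0. \<forall>z\<in>L. norm (y l z - g z) < e"
    if g: "g \<in> hol_space \<Omega>" "compact L" "L \<subseteq> \<Omega>" "e > 0" for g L and e :: real and l0
  proof -
    obtain i where i: "\<forall>z\<in>L. norm (d i z - g z) < e/2"
      using dense_D [of g L "e/2"] d g by auto
    obtain N where N: "\<forall>n\<ge>N. L \<subseteq> K n"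
      using K(3) g by blast
    obtain j0 where j0: "1 / Suc j0 < e/2"
      using g(4) nat_approx_posE [of "e/2"] by auto
    define j where "j = Max {N, j0, l0}"
    have j: "j \<ge> N" "j \<ge> j0" "j \<ge> l0" by (auto simp: j_def)
    have "1 / Suc j \<le> 1 / Suc j0"
      using j by (simp add: frac_le)
    have "norm (w i j z - g z) < e" if "z \<in> L" for z
    proof -
      have "norm (w i j z - d i z) < e/2"
        using w(2) [of j i] N j that \<open>1 / Suc j \<le> 1 / Suc j0\<close> j0 by fastforce
      moreover have "norm (d i z - g z) < e/2"
        using i that by blast
      ultimately show ?thesis
        using norm_triangle_lt [of "w i j z - d i z" "d i z - g z" e] by simp
    qed
    moreover have "prod_encode (i, j) \<ge> l0"
      using le_prod_encode_2 [of j i] j by linarith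
    ultimately show "\<exists>l\<ge>l0. \<forall>z\<in>L. norm (y l z - g z) < e"
      by (intro exI [of _ "prod_encode (i, j)"]) (simp add: y_def)
  qed
  moreover have "y l \<in> X0" for l
    by (simp add: y_def w)
  ultimately show ?thesis
    by (intro exI [of _ y]) simp
qed

text \<open>
  The vector is \<open>v = (\<Sum>k. (S ^^ spread k) (y (lam k)))\<close>, summed over the \<open>k\<close> whose valuation is one of
  the numbers \<open>N l\<close>, where \<open>lam k\<close> is this \<open>l\<close>. If \<open>lam k = l\<close>, then applying \<open>T ^^ spread k\<close> turns the term
  of \<open>k\<close> into \<open>y l\<close>, and all other terms into \<open>T ^^ d\<close> or \<open>S ^^ d\<close> of some \<open>y j\<close> with
  \<open>d \<ge> N l\<close> and \<open>d \<ge> N j\<close>. The numbers \<open>N\<close> are chosen so large that these sum up to at most a multiple of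
  \<open>1 / 2 ^ l\<close>.
\<close>

theorem fhc_imp_frequently_hypercyclic:
  assumes D: "countable D" "dense_in_space (hol_topology \<Omega>) D"
  shows "frequently_hypercyclic (hol_topology \<Omega>) T"
proof -
  obtain K where K: "\<And>n. compact (K n)" "\<And>n. K n \<subseteq> \<Omega>" "\<And>n. K n \<subseteq> interior (K (Suc n))"
      "\<Union>(range K) = \<Omega>" "\<And>L. compact L \<Longrightarrow> L \<subseteq> \<Omega> \<Longrightarrow> \<exists>N. \<forall>n\<ge>N. L \<subseteq> K n"
  proof (rule open_Union_compact_subsets [OF open_domain])
    fix C
    assume "\<And>n. compact (C n)" "\<And>n. C n \<subseteq> \<Omega>" "\<And>n. C n \<subseteq> interior (C (Suc n))"
      "\<Union>(range C) = \<Omega>" "\<And>L. compact L \<Longrightarrow> L \<subseteq> \<Omega> \<Longrightarrow> \<exists>N. \<forall>n\<ge>N. L \<subseteq> C n"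
    then show thesis by (rule that)
  qed
  have exhaust: "\<forall>L. compact L \<and> L \<subseteq> \<Omega> \<longrightarrow> (\<exists>N. \<forall>n\<ge>N. L \<subseteq> K n)"
    using K(5) by simp
  have "K n \<subseteq> K (Suc n)" for n
    using K(3) interior_subset by (rule subset_trans)
  then have K_mono: "K m \<subseteq> K n" if "m \<le> n" for m n
    using that by (rule lift_Suc_mono_le)
  obtain y :: "nat \<Rightarrow> complex \<Rightarrow> complex" where y_all: "(\<forall>l. y l \<in> X0) \<and>
    (\<forall>g\<in>hol_space \<Omega>. \<forall>L e l0. compact L \<and> L \<subseteq> \<Omega> \<and> e > 0 \<longrightarrow> (\<exists>l\<ge>l0. \<forall>z\<in>L. norm (y l z - g z) < e))"
    using dense_sequence [OF D K(1,2) exhaust] by (elim exE)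
  have yX0: "y l \<in> X0" for l
    using y_all by simp
  have y: "\<exists>l\<ge>l0. \<forall>z\<in>L. norm (y l z - g z) < e"
    if "g \<in> hol_space \<Omega>" "compact L" "L \<subseteq> \<Omega>" "e > 0" for g L e l0
    using conjunct2 [OF y_all] that by simp
  have yH: "y l \<in> hol_space \<Omega>" for l
    using yX0 X0_subset by blast
  have "\<exists>N. \<forall>F. finite F \<and> F \<subseteq> {N..} \<longrightarrow> (\<forall>z\<in>K l. norm (\<Sum>n\<in>F. (T ^^ n) (y i) z) \<le> 1 / 2 ^ (l + i)) \<and>
                       (\<forall>z\<in>K l. norm (\<Sum>n\<in>F. (S ^^ n) (y i) z) \<le> 1 / 2 ^ (l + i))" for l i
    by (rule series_tail [OF yX0 K(1,2)]) simp
  then have "\<forall>l i. \<exists>N. \<forall>F. finite F \<and> F \<subseteq> {N..} \<longrightarrow> (\<forall>z\<in>K l. norm (\<Sum>n\<in>F. (T ^^ n) (y i) z) \<le> 1 / 2 ^ (l + i)) \<and>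
                       (\<forall>z\<in>K l. norm (\<Sum>n\<in>F. (S ^^ n) (y i) z) \<le> 1 / 2 ^ (l + i))"
    by blast
  then obtain N1 where N1: "\<forall>l i F. finite F \<and> F \<subseteq> {N1 l i..} \<longrightarrow> (\<forall>z\<in>K l. norm (\<Sum>n\<in>F. (T ^^ n) (y i) z) \<le> 1 / 2 ^ (l + i)) \<and>
                       (\<forall>z\<in>K l. norm (\<Sum>n\<in>F. (S ^^ n) (y i) z) \<le> 1 / 2 ^ (l + i))"
    unfolding choice_iff by blast
  \<comment> \<open>a strictly increasing sequence above all the bounds \<open>N1 l i\<close> with \<open>i \<le> l\<close>\<close>
  define N where "N = (\<lambda>l. \<Sum>k\<le>l. Suc (\<Sum>i\<le>k. N1 k i))"
  have N_Suc: "N l < N (Suc l)" for l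
    by (simp add: N_def)
  then have "strict_mono N"
    by (simp add: strict_mono_Suc_iff)
  then have "inj N"
    by (rule strict_mono_imp_inj_on)
  have N_pos: "N l \<ge> 1" for l
    by (induction l) (auto simp: N_def)
  have N1_le: "N1 l i \<le> N l" if "i \<le> l" for l i
  proof -
    have "N1 l i \<le> (\<Sum>i\<le>l. N1 l i)"
      using that by (intro member_le_sum) auto
    also have "\<dots> \<le> Suc (\<Sum>i\<le>l. N1 l i)" by simp
    also have "\<dots> \<le> N l"
      unfolding N_def by (rule member_le_sum [of l "{..l}" "\<lambda>k. Suc (\<Sum>i\<le>k. N1 k i)"]) auto
    finally show ?thesis .
  qed
  have tail: "norm (\<Sum>n\<in>F. (R ^^ n) (y i) z) \<le> 1 / 2 ^ (l + i)"
    if "R = T \<or> R = S" "i \<le> l" "finite F" "\<And>n. n \<in> F \<Longrightarrow> n \<ge> N l" "z \<in> K l" for R i l F z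
  proof -
    have "F \<subseteq> {N1 l i..}"
      using that N1_le [OF that(2)] by force
    with N1 [rule_format, OF conjI, OF \<open>finite F\<close> this] that show ?thesis by blast
  qed
  \<comment> \<open>the bound \<open>1 / 2 ^ (l + j)\<close> holds for the part with \<open>lam k = j\<close>: by the choice of \<open>N l\<close> if \<open>j \<le> l\<close>, of \<open>N j\<close> otherwise\<close>
  have block: "norm (\<Sum>k\<in>F. (R ^^ d k) (y (lam k)) z) \<le> 2 / 2 ^ l"
    if R: "R = T \<or> R = S" and F: "finite F" "inj_on d F"
      and d: "\<And>k. k \<in> F \<Longrightarrow> N l \<le> d k \<and> N (lam k) \<le> d k" and z: "z \<in> K l"
    for R F l z and d lam :: "nat \<Rightarrow> nat"
  proof -
    have inner: "norm (\<Sum>k | k \<in> F \<and> lam k = j. (R ^^ d k) (y (lam k)) z) \<le> 1 / 2 ^ (l + j)" for j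
    proof -
      let ?F = "{k. k \<in> F \<and> lam k = j}"
      have "inj_on d ?F"
        using F(2) by (rule inj_on_subset) auto
      then have eq: "(\<Sum>k\<in>?F. (R ^^ d k) (y (lam k)) z) = (\<Sum>n\<in>d ` ?F. (R ^^ n) (y j) z)"
        by (simp add: sum.reindex)
      show ?thesis
      proof (cases "j \<le> l")
        case True
        then show ?thesis
          unfolding eq using F d z by (intro tail R) auto
      next
        case False
        then have "norm (\<Sum>n\<in>d ` ?F. (R ^^ n) (y j) z) \<le> 1 / 2 ^ (j + j)"
          using F d z K_mono [of l j] by (intro tail R) auto
        also have "\<dots> \<le> 1 / 2 ^ (l + j)"
          using False by (intro divide_left_mono power_increasing) auto
        finally show ?thesis unfolding eq .
      qed
    qed
    have "(\<Sum>k\<in>F. (R ^^ d k) (y (lam k)) z) = (\<Sum>j\<in>lam ` F. \<Sum>k | k \<in> F \<and> lam k = j. (R ^^ d k) (y (lam k)) z)"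
      using F(1) by (rule sum.image_gen)
    also have "norm \<dots> \<le> (\<Sum>j\<in>lam ` F. 1 / 2 ^ (l + j))"
      by (intro sum_norm_le inner)
    also have "\<dots> = (\<Sum>j\<in>lam ` F. (1/2) ^ j) / 2 ^ l"
      by (simp add: sum_divide_distrib power_add power_one_over mult.commute)
    also have "\<dots> \<le> (\<Sum>j. (1/2::real) ^ j) / 2 ^ l"
      using F(1) by (intro divide_right_mono sum_le_suminf summable_geometric) auto
    also have "\<dots> = 2 / 2 ^ l"
      by (subst suminf_geometric) auto
    finally show ?thesis .
  qed
  define J where "J = {k. 1 \<le> k \<and> val2 k \<in> range N}"
  define lam where "lam = (\<lambda>k. inv N (val2 k))"
  have N_lam: "N (lam k) = val2 k" if "k \<in> J" for k
    using that by (auto simp: J_def lam_def f_inv_into_f)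
  have gap: "spread j + N (lam j) + N (lam k) \<le> spread k" if "j \<in> J" "k \<in> J" "j < k" for j k
    using spread_separated [of j k] that N_lam by (auto simp: J_def)
  have gap': "spread j < spread k" if "j \<in> J" "k \<in> J" "j < k" for j k
    using gap [OF that] N_pos [of "lam k"] by linarith
  have inj: "inj_on spread J"
    using gap' by (intro linorder_inj_onI) (metis less_irrefl, auto)
  define x where "x = (\<lambda>M. \<Sum>k | k \<in> J \<and> k < M. (S ^^ spread k) (y (lam k)))"
  have termH: "(S ^^ n) (y l) \<in> hol_space \<Omega>" for n l
    using yX0 Sn_closed X0_subset by blast
  have xH: "x M \<in> hol_space \<Omega>" for M
    unfolding x_def by (intro hol_space_sum termH)
  have "\<exists>M. \<forall>m\<ge>M. \<forall>n\<ge>m. \<forall>z\<in>L. norm (x n z - x m z) < e"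
    if L: "compact L" "L \<subseteq> \<Omega>" and e: "e > 0" for L e
  proof -
    obtain l1 where l1: "\<forall>n\<ge>l1. L \<subseteq> K n"
      using K(5) L by blast
    obtain l2 where l2: "\<forall>l\<ge>l2. 2 / 2 ^ l < e"
      using eventually_dyadic_less e by blast
    define l where "l = max l1 l2"
    have l: "L \<subseteq> K l" "2 / 2 ^ l < e"
      using l1 l2 by (auto simp: l_def)
    have "norm (x n z - x m z) < e" if mn: "2 * N l \<le> m" "m \<le> n" and z: "z \<in> L" for m n z
    proof -
      let ?F = "{k. k \<in> J \<and> m \<le> k \<and> k < n}"
      have "{k. k \<in> J \<and> k < n} = {k. k \<in> J \<and> k < m} \<union> ?F" "{k. k \<in> J \<and> k < m} \<inter> ?F = {}"
        using mn by auto
      then have "x n = x m + (\<Sum>k\<in>?F. (S ^^ spread k) (y (lam k)))"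
        unfolding x_def by (simp add: sum.union_disjoint)
      then have "x n z - x m z = (\<Sum>k\<in>?F. (S ^^ spread k) (y (lam k)) z)"
        by (simp only: plus_fun_apply sum_fun_apply) simp
      also have "norm \<dots> \<le> 2 / 2 ^ l"
      proof (rule block)
        show "inj_on spread ?F"
          using inj by (rule inj_on_subset) auto
        fix k assume k: "k \<in> ?F"
        then have "2 * N l \<le> k"
          using mn by auto
        then have "N l \<le> k div 2"
          by linarith
        then show "N l \<le> spread k \<and> N (lam k) \<le> spread k"
          using k spread_unbounded [of k] val2_le_spread [of k] N_lam [of k] by (auto simp: J_def)
      qed (use l z in auto)
      finally show ?thesis
        using l by simp
    qed
    then show ?thesis by blast
  qed
  then obtain v where v: "limitin (hol_topology \<Omega>) x v sequentially"
    by (rule hol_space_complete [OF open_domain xH])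
  then have vH: "v \<in> hol_space \<Omega>"
    unfolding limitin_hol_topology by (rule conjunct1)
  have visit: "norm ((T ^^ spread k) v z - y l z) < 5 / 2 ^ l"
    if k: "k \<in> J" "lam k = l" and z: "z \<in> K l" for k l z
  proof -
    let ?n = "spread k"
    have "\<forall>\<^sub>F M in sequentially. \<forall>z\<in>K l. norm ((T ^^ ?n) (x M) z - (T ^^ ?n) v z) < 1 / 2 ^ l"
      by (rule limitin_hol_topologyD [OF Tn_limit [OF v] K(1,2)]) simp
    then obtain M0 where M0: "\<forall>M\<ge>M0. \<forall>z\<in>K l. norm ((T ^^ ?n) (x M) z - (T ^^ ?n) v z) < 1 / 2 ^ l"
      unfolding eventually_sequentially by blast
    define M where "M = max M0 (Suc k)"
    have M: "M > k" "norm ((T ^^ ?n) (x M) z - (T ^^ ?n) v z) < 1 / 2 ^ l"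
      using M0 z by (auto simp: M_def)
    \<comment> \<open>indices before \<open>k\<close> have become positive powers of \<open>T\<close>, later ones are still powers of \<open>S\<close>\<close>
    let ?A = "{j. j \<in> J \<and> j < k}" and ?B = "{j. j \<in> J \<and> k < j \<and> j < M}"
    have split: "{j. j \<in> J \<and> j < M} = ?A \<union> ({k} \<union> ?B)" "?A \<inter> ({k} \<union> ?B) = {}" "{k} \<inter> ?B = {}"
      using M k by auto
    have "(T ^^ ?n) (x M) = (\<Sum>j | j \<in> J \<and> j < M. (T ^^ ?n) ((S ^^ spread j) (y (lam j))))"
      unfolding x_def by (intro Tn_sum termH)
    also have "\<dots> = (\<Sum>j\<in>?A. (T ^^ ?n) ((S ^^ spread j) (y (lam j)))) +
        ((T ^^ ?n) ((S ^^ ?n) (y l)) + (\<Sum>j\<in>?B. (T ^^ ?n) ((S ^^ spread j) (y (lam j)))))"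
      unfolding split(1) using split(2,3) k by (simp add: sum.union_disjoint)
    also have "(\<Sum>j\<in>?A. (T ^^ ?n) ((S ^^ spread j) (y (lam j)))) = (\<Sum>j\<in>?A. (T ^^ (?n - spread j)) (y (lam j)))"
      using gap' k by (intro sum.cong refl Tn_Sn_ge yX0) (auto intro: less_imp_le)
    also have "(\<Sum>j\<in>?B. (T ^^ ?n) ((S ^^ spread j) (y (lam j)))) = (\<Sum>j\<in>?B. (S ^^ (spread j - ?n)) (y (lam j)))"
      using gap' k by (intro sum.cong refl Tn_Sn_le yX0) (auto intro: less_imp_le)
    also have "(T ^^ ?n) ((S ^^ ?n) (y l)) = y l"
      using Tn_Sn_ge [OF yX0, of ?n ?n] by simp
    finally have eq: "(T ^^ ?n) (x M) z - y l z = (\<Sum>j\<in>?A. (T ^^ (?n - spread j)) (y (lam j)) z) + (\<Sum>j\<in>?B. (S ^^ (spread j - ?n)) (y (lam j)) z)"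
      by (simp only: plus_fun_apply sum_fun_apply) simp
    have "norm (\<Sum>j\<in>?A. (T ^^ (?n - spread j)) (y (lam j)) z) \<le> 2 / 2 ^ l"
    proof (rule block [where d = "\<lambda>j. ?n - spread j"])
      show "inj_on (\<lambda>j. ?n - spread j) ?A"
      proof (rule inj_onI)
        fix i j assume ij: "i \<in> ?A" "j \<in> ?A" "?n - spread i = ?n - spread j"
        then have "spread i = spread j"
          using gap' [of i k] gap' [of j k] k by auto
        then show "i = j"
          using ij inj by (auto dest: inj_onD)
      qed
      fix j assume "j \<in> ?A"
      then show "N l \<le> ?n - spread j \<and> N (lam j) \<le> ?n - spread j"
        using gap [of j k] k by auto
    qed (use z in auto)
    moreover have "norm (\<Sum>j\<in>?B. (S ^^ (spread j - ?n)) (y (lam j)) z) \<le> 2 / 2 ^ l"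
    proof (rule block [where d = "\<lambda>j. spread j - ?n"])
      show "inj_on (\<lambda>j. spread j - ?n) ?B"
      proof (rule inj_onI)
        fix i j assume ij: "i \<in> ?B" "j \<in> ?B" "spread i - ?n = spread j - ?n"
        then have "spread i = spread j"
          using gap' [of k i] gap' [of k j] k by auto
        then show "i = j"
          using ij inj by (auto dest: inj_onD)
      qed
      fix j assume "j \<in> ?B"
      then show "N l \<le> spread j - ?n \<and> N (lam j) \<le> spread j - ?n"
        using gap [of k j] k by auto
    qed (use z in auto)
    ultimately have "norm ((T ^^ ?n) (x M) z - y l z) \<le> 2 / 2 ^ l + 2 / 2 ^ l"
      unfolding eq by (rule norm_triangle_mono)
    then have "norm ((T ^^ ?n) (x M) z - y l z - ((T ^^ ?n) (x M) z - (T ^^ ?n) v z)) < 2 / 2 ^ l + 2 / 2 ^ l + 1 / 2 ^ l"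
      using M(2) norm_triangle_ineq4 [of "(T ^^ ?n) (x M) z - y l z" "(T ^^ ?n) (x M) z - (T ^^ ?n) v z"]
      by linarith
    then show ?thesis
      by simp
  qed
  show ?thesis
    unfolding frequently_hypercyclic_def
  proof (intro bexI [of _ v] allI impI)
    show "v \<in> topspace (hol_topology \<Omega>)"
      using vH by simp
    fix U assume U: "openin (hol_topology \<Omega>) U \<and> U \<noteq> {}"
    then obtain g where g: "g \<in> U" by auto
    then have gH: "g \<in> hol_space \<Omega>"
      using U openin_subset [of "hol_topology \<Omega>" U] by auto
    obtain L e where L: "compact L" "L \<subseteq> \<Omega>" "e > 0"
        "\<forall>f\<in>hol_space \<Omega>. (\<forall>z\<in>L. norm (f z - g z) < e) \<longrightarrow> f \<in> U"
      using U g openin_hol_topologyD by metis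
    obtain l1 where l1: "\<forall>n\<ge>l1. L \<subseteq> K n"
      using K(5) L by blast
    obtain l2 where l2: "\<forall>l\<ge>l2. 5 / 2 ^ l < e/2"
      using eventually_dyadic_less [of "e/2" 5] L(3) by auto
    obtain l where l: "l \<ge> max l1 l2" "\<forall>z\<in>L. norm (y l z - g z) < e/2"
      using y [OF gH L(1,2), of "e/2" "max l1 l2"] L(3) by auto
    have hit: "(T ^^ n) v \<in> U" if n: "n \<in> spread ` {k. 1 \<le> k \<and> val2 k = N l}" for n
    proof -
      obtain k where k: "n = spread k" "1 \<le> k" "val2 k = N l"
        using n by auto
      then have kJ: "k \<in> J" "lam k = l"
        using \<open>inj N\<close> by (auto simp: J_def lam_def)
      have "norm ((T ^^ n) v z - g z) < e" if "z \<in> L" for z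
      proof -
        have "norm ((T ^^ n) v z - y l z) < e/2"
          using visit [OF kJ, of z] l l1 l2 that k(1) by fastforce
        moreover have "norm (y l z - g z) < e/2"
          using l that by blast
        ultimately show ?thesis
          using norm_triangle_lt [of "(T ^^ n) v z - y l z" "y l z - g z" e] by simp
      qed
      then show ?thesis
        using L(4) Tn_closed [OF vH] by blast
    qed
    have "0 < liminf (\<lambda>M. ereal (real (card {n. n \<le> M \<and> n \<in> spread ` {k. 1 \<le> k \<and> val2 k = N l}}) / real (M + 1)))"
      by (rule spread_class_density [OF N_pos])
    also have "\<dots> \<le> liminf (\<lambda>M. ereal (real (card {n. n \<le> M \<and> (T ^^ n) v \<in> U}) / real (M + 1)))"
    proof (intro Liminf_mono always_eventually allI)
      fix M
      have "card {n. n \<le> M \<and> n \<in> spread ` {k. 1 \<le> k \<and> val2 k = N l}} \<le> card {n. n \<le> M \<and> (T ^^ n) v \<in> U}"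
        using hit by (intro card_mono) auto
      then show "ereal (real (card {n. n \<le> M \<and> n \<in> spread ` {k. 1 \<le> k \<and> val2 k = N l}}) / real (M + 1))
           \<le> ereal (real (card {n. n \<le> M \<and> (T ^^ n) v \<in> U}) / real (M + 1))"
        unfolding ereal_less_eq by (intro divide_right_mono) auto
    qed
    finally show "0 < liminf (\<lambda>M. ereal (real (card {n. n \<le> M \<and> (T ^^ n) v \<in> U}) / real (M + 1)))" .
  qed
qed

end

text \<open>
  A frequently hypercyclic vector visits every non-empty open set, so already its unscaled orbit is
  dense.
\<close>

lemma frequently_hypercyclic_imp_supercyclic:
  assumes "hol_operator \<Omega> T" "frequently_hypercyclic (hol_topology \<Omega>) T"
  shows "supercyclic (hol_topology \<Omega>) hol_scale T"
proof -
  interpret hol_operator \<Omega> T by (fact assms(1))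
  obtain f where f: "f \<in> hol_space \<Omega>" and freq: "\<And>U. openin (hol_topology \<Omega>) U \<Longrightarrow> U \<noteq> {} \<Longrightarrow>
        liminf (\<lambda>N. ereal (real (card {n. n \<le> N \<and> (T ^^ n) f \<in> U}) / real (N + 1))) > 0"
    using assms(2) unfolding frequently_hypercyclic_def by auto
  have visit: "\<exists>n. (T ^^ n) f \<in> U" if "openin (hol_topology \<Omega>) U" "U \<noteq> {}" for U
  proof (rule ccontr)
    assume "\<nexists>n. (T ^^ n) f \<in> U"
    then show False
      using freq [OF that] by (simp add: zero_ereal_def [symmetric] Liminf_const)
  qed
  have orbit: "{hol_scale c ((T ^^ n) f) | c n. True} \<subseteq> hol_space \<Omega>"
    using f by (auto intro: hol_space_scale Tn_closed)
  have "hol_topology \<Omega> closure_of {hol_scale c ((T ^^ n) f) | c n. True} = hol_space \<Omega>"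
  proof (intro equalityI subsetI)
    fix g assume g: "g \<in> hol_space \<Omega>"
    show "g \<in> hol_topology \<Omega> closure_of {hol_scale c ((T ^^ n) f) | c n. True}"
      unfolding in_closure_of
    proof (intro conjI allI impI)
      fix U assume "g \<in> U \<and> openin (hol_topology \<Omega>) U"
      then obtain n where "(T ^^ n) f \<in> U"
        using visit by blast
      moreover have "(T ^^ n) f = hol_scale 1 ((T ^^ n) f)"
        by (simp add: hol_scale_def)
      ultimately show "\<exists>h. h \<in> {hol_scale c ((T ^^ n) f) | c n. True} \<and> h \<in> U"
        by blast
    qed (use g in simp)
  qed (use closure_of_subset_topspace [of "hol_topology \<Omega>"] in auto)
  then show ?thesis
    unfolding supercyclic_def dense_in_space_def topspace_hol_topology using f orbit by blast
qed

section \<open>Laurent decomposition and coboundaries\<close>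

text \<open>
  The radial homotopy between the two circles avoids the origin.
\<close>

lemma contour_integral_concentric_circles:
  assumes g: "g holomorphic_on -{0}" and r: "0 < r" "0 < s"
  shows "contour_integral (circlepath 0 r) g = contour_integral (circlepath 0 s) g"
proof (rule Cauchy_theorem_homotopic_loops [OF _ _ g])
  show "homotopic_loops (-{0}) (circlepath 0 r) (circlepath 0 s)"
  proof (rule homotopic_loops_linear)
    fix t :: real
    show "closed_segment (circlepath 0 r t) (circlepath 0 s t) \<subseteq> -{0}"
    proof
      fix x assume "x \<in> closed_segment (circlepath 0 r t) (circlepath 0 s t)"
      then obtain u where u: "0 \<le> u" "u \<le> 1"
        "x = (1 - u) *\<^sub>R circlepath 0 r t + u *\<^sub>R circlepath 0 s t"
        by (auto simp: closed_segment_def)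
      then have "x = of_real ((1 - u) * r + u * s) * exp (2 * of_real pi * \<i> * of_real t)"
        by (simp add: circlepath scaleR_conv_of_real algebra_simps)
      moreover have "(1 - u) * r + u * s > 0"
        using u r by (cases "u = 0") (auto intro: add_nonneg_pos mult_pos_pos)
      ultimately show "x \<in> -{0}"
        by (metis ComplI exp_not_eq_zero mult_eq_0_iff of_real_eq_0_iff order_less_irrefl singletonD)
    qed
  qed auto
qed auto

lemma continuous_on_cauchy_kernel:
  assumes F: "F holomorphic_on -{0::complex}" and r: "0 < r" "norm z \<noteq> r"
  shows "continuous_on (path_image (circlepath 0 r)) (\<lambda>\<zeta>. F \<zeta> / (\<zeta> - z))"
proof -
  have "continuous_on (path_image (circlepath 0 r)) F"
    by (rule continuous_on_subset [OF holomorphic_on_imp_continuous_on [OF F]]) (use r in auto)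
  then show ?thesis
    using r by (intro continuous_intros) auto
qed

text \<open>
  Integrate the difference quotient of \<open>F\<close> at \<open>z\<close>, which has a removable singularity, over both circles.
  The integral of \<open>1 / (\<zeta> - z)\<close> is \<open>2 * pi * \<i>\<close> over the outer circle and \<open>0\<close> over the inner one.
\<close>

lemma Cauchy_integral_formula_annulus:
  assumes F: "F holomorphic_on -{0::complex}" and r: "0 < s" "s < norm z" "norm z < r"
  shows "2 * of_real pi * \<i> * F z =
           contour_integral (circlepath 0 r) (\<lambda>\<zeta>. F \<zeta> / (\<zeta> - z)) -
           contour_integral (circlepath 0 s) (\<lambda>\<zeta>. F \<zeta> / (\<zeta> - z))"
proof -
  define g where "g = (\<lambda>\<zeta>. if \<zeta> = z then deriv F z else (F \<zeta> - F z) / (\<zeta> - z))"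
  have "g holomorphic_on -{0}"
    unfolding g_def by (rule pole_lemma_open [OF F]) auto
  then have eq: "contour_integral (circlepath 0 r) g = contour_integral (circlepath 0 s) g"
    using r by (intro contour_integral_concentric_circles) auto
  have int: "contour_integral (circlepath 0 \<rho>) g =
      contour_integral (circlepath 0 \<rho>) (\<lambda>\<zeta>. F \<zeta> / (\<zeta> - z)) - F z * contour_integral (circlepath 0 \<rho>) (\<lambda>\<zeta>. 1 / (\<zeta> - z))"
    if \<rho>: "0 < \<rho>" "norm z \<noteq> \<rho>" for \<rho>
  proof -
    have 1: "(\<lambda>\<zeta>. F \<zeta> / (\<zeta> - z)) contour_integrable_on circlepath 0 \<rho>"
      using continuous_on_cauchy_kernel [OF F \<rho>] by (rule contour_integrable_continuous_circlepath)
    have 2: "(\<lambda>\<zeta>. 1 / (\<zeta> - z)) contour_integrable_on circlepath 0 \<rho>"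
      by (intro contour_integrable_continuous_circlepath continuous_intros) (use \<rho> in auto)
    have "contour_integral (circlepath 0 \<rho>) g = contour_integral (circlepath 0 \<rho>) (\<lambda>\<zeta>. F \<zeta> / (\<zeta> - z) - F z * (1 / (\<zeta> - z)))"
      by (rule contour_integral_eq) (use \<rho> in \<open>auto simp: g_def diff_divide_distrib\<close>)
    also have "\<dots> = contour_integral (circlepath 0 \<rho>) (\<lambda>\<zeta>. F \<zeta> / (\<zeta> - z)) - contour_integral (circlepath 0 \<rho>) (\<lambda>\<zeta>. F z * (1 / (\<zeta> - z)))"
      by (intro contour_integral_diff 1 contour_integrable_lmul 2)
    also have "contour_integral (circlepath 0 \<rho>) (\<lambda>\<zeta>. F z * (1 / (\<zeta> - z))) = F z * contour_integral (circlepath 0 \<rho>) (\<lambda>\<zeta>. 1 / (\<zeta> - z))"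
      by (rule contour_integral_lmul [OF 2])
    finally show ?thesis .
  qed
  have inner: "contour_integral (circlepath 0 s) (\<lambda>\<zeta>. 1 / (\<zeta> - z)) = 0"
  proof (rule contour_integral_unique, rule Cauchy_theorem_convex_simple)
    show "(\<lambda>\<zeta>. 1 / (\<zeta> - z)) holomorphic_on ball 0 (norm z)"
      by (intro holomorphic_intros) auto
  qed (use r in auto)
  have outer: "contour_integral (circlepath 0 r) (\<lambda>\<zeta>. 1 / (\<zeta> - z)) = 2 * of_real pi * \<i>"
    using Cauchy_integral_circlepath [of 0 r "\<lambda>_. 1" z] r by (auto intro!: contour_integral_unique)
  show ?thesis
    using eq int [of r] int [of s] inner outer r by (simp add: algebra_simps)
qed

text \<open>
  The outer Cauchy integral is independent of the radius, as long as it exceeds \<open>\<bar>z\<bar>\<close>, and gives the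
  entire function \<open>P\<close>. The difference \<open>F - P\<close> is minus the Cauchy integral over the unit circle outside of
  it, hence tends to \<open>0\<close> at infinity, and becomes entire in the variable \<open>1 / z\<close>.
\<close>

lemma Laurent_decomposition:
  assumes F: "F holomorphic_on -{0::complex}"
  obtains P Q where "P holomorphic_on UNIV" "Q holomorphic_on UNIV" "Q 0 = 0"
    "\<And>z. z \<noteq> 0 \<Longrightarrow> F z = P z + Q (1 / z)"
proof -
  define A where "A = (\<lambda>r z. contour_integral (circlepath 0 r) (\<lambda>\<zeta>. F \<zeta> / (\<zeta> - z)))"
  define P where "P = (\<lambda>z. A (norm z + 1) z / (2 * of_real pi * \<i>))"
  have int: "((\<lambda>\<zeta>. F \<zeta> / (\<zeta> - z)) has_contour_integral A r z) (circlepath 0 r)" if "0 < r" "norm z \<noteq> r" for r z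
    unfolding A_def using continuous_on_cauchy_kernel [OF F that]
    by (intro has_contour_integral_integral contour_integrable_continuous_circlepath)
  have indep: "A r z = A r' z" if "norm z < r" "norm z < r'" for r r' z
  proof (cases "z = 0")
    case True
    have "(\<lambda>\<zeta>. F \<zeta> / (\<zeta> - z)) holomorphic_on -{0}"
      using F True by (intro holomorphic_intros) auto
    then show ?thesis
      unfolding A_def using True that by (intro contour_integral_concentric_circles) auto
  next
    case False
    then show ?thesis
      using Cauchy_integral_formula_annulus [OF F, of "norm z / 2" z r]
        Cauchy_integral_formula_annulus [OF F, of "norm z / 2" z r'] that
      by (simp add: A_def)
  qed
  have P_hol: "P holomorphic_on UNIV"
  proof -
    have "P field_differentiable at w" for w
    proof -
      define r where "r = norm w + 1"
      have "r > 0"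
        unfolding r_def by (simp add: add_nonneg_pos)
      have "A r field_differentiable at w"
        unfolding field_differentiable_def
      proof (rule exI, rule Cauchy_next_derivative_circlepath [where k = 1 and f = F])
        show "continuous_on (path_image (circlepath 0 r)) F"
          by (rule continuous_on_subset [OF holomorphic_on_imp_continuous_on [OF F]]) (use \<open>r > 0\<close> in auto)
        show "((\<lambda>u. F u / (u - w) ^ 1) has_contour_integral A r w) (circlepath 0 r)" if "w \<in> ball 0 r" for w
          using int [of r w] that unfolding r_def by (simp add: add_nonneg_pos)
      qed (auto simp: r_def)
      then have "(\<lambda>z. A r z / (2 * of_real pi * \<i>)) field_differentiable at w"
        by (intro field_differentiable_divide field_differentiable_const) auto
      then obtain D where "((\<lambda>z. A r z / (2 * of_real pi * \<i>)) has_field_derivative D) (at w)"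
        unfolding field_differentiable_def by blast
      then have "(P has_field_derivative D) (at w)"
      proof (rule has_field_derivative_transform_within [where d = 1])
        show "A r z / (2 * of_real pi * \<i>) = P z" if "dist z w < 1" for z
        proof -
          have "norm z < r"
            using that norm_triangle_sub [of z w] by (simp add: r_def dist_norm)
          then show ?thesis
            using indep [of z r "norm z + 1"] by (simp add: P_def)
        qed
      qed auto
      then show ?thesis
        unfolding field_differentiable_def by blast
    qed
    then show ?thesis
      by (simp add: holomorphic_on_def)
  qed
  have tail: "F z - P z = - A 1 z / (2 * of_real pi * \<i>)" if "norm z > 1" for z
  proof -
    have "F z = (A (norm z + 1) z - A 1 z) / (2 * of_real pi * \<i>)"
      using Cauchy_integral_formula_annulus [OF F, of 1 z "norm z + 1"] that
      by (simp add: A_def nonzero_eq_divide_eq mult.commute)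
    then show ?thesis
      by (simp add: P_def diff_divide_distrib)
  qed
  define Q where "Q = (\<lambda>u. if u = 0 then 0 else F (1 / u) - P (1 / u))"
  obtain M where M: "M > 0" "\<And>\<zeta>. norm \<zeta> = 1 \<Longrightarrow> norm (F \<zeta>) \<le> M"
  proof -
    have "continuous_on (sphere 0 1) F"
      by (rule continuous_on_subset [OF holomorphic_on_imp_continuous_on [OF F]]) auto
    then have "bounded (F ` sphere 0 1)"
      by (intro compact_imp_bounded compact_continuous_image) auto
    then show ?thesis
      using that by (auto simp: bounded_pos)
  qed
  have A_bound: "norm (A 1 z) \<le> M / (norm z - 1) * (2 * pi * 1)" if "norm z > 1" for z
  proof (rule has_contour_integral_bound_circlepath [OF int])
    fix x :: complex assume x: "norm (x - 0) = 1"
    have "norm (x - z) \<ge> norm z - 1"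
      using x norm_triangle_ineq2 [of z x] by (simp add: norm_minus_commute)
    then show "norm (F x / (x - z)) \<le> M / (norm z - 1)"
      using M x that unfolding norm_divide by (intro frac_le) auto
  qed (use that M in auto)
  have "Q \<midarrow>0\<rightarrow> 0"
  proof (rule Lim_null_comparison)
    have "\<forall>\<^sub>F u in at 0. 0 < norm u \<and> norm u < (1::real)" for u :: complex
      by (auto simp: eventually_at intro!: exI [of _ 1])
    then show "\<forall>\<^sub>F u in at 0. norm (Q u) \<le> M * norm u / (1 - norm u)"
    proof eventually_elim
      fix u :: complex assume u: "0 < norm u \<and> norm u < 1"
      then have z: "norm (1 / u) > 1"
        by (simp add: norm_divide)
      then have "norm (Q u) = norm (A 1 (1 / u)) / (2 * pi)"
        using u tail [OF z] by (simp add: Q_def norm_divide norm_mult)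
      also have "\<dots> \<le> (M / (norm (1 / u) - 1) * (2 * pi * 1)) / (2 * pi)"
        using A_bound [OF z] by (intro divide_right_mono) auto
      also have "\<dots> = M * norm u / (1 - norm u)"
        using u by (simp add: norm_divide field_simps)
      finally show "norm (Q u) \<le> M * norm u / (1 - norm u)" .
    qed
    have "((\<lambda>u::complex. M * norm u / (1 - norm u)) \<longlongrightarrow> M * norm (0::complex) / (1 - norm (0::complex))) (at 0)"
      by (intro tendsto_intros) auto
    then show "((\<lambda>u::complex. M * norm u / (1 - norm u)) \<longlongrightarrow> 0) (at 0)"
      by simp
  qed
  moreover have Q_hol: "Q holomorphic_on UNIV - {0}"
  proof -
    have inv: "(\<lambda>u::complex. 1 / u) holomorphic_on UNIV - {0}"
      by (intro holomorphic_intros) auto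
    have "(\<lambda>u. F (1 / u)) holomorphic_on UNIV - {0}" "(\<lambda>u. P (1 / u)) holomorphic_on UNIV - {0}"
      using holomorphic_on_compose_gen [OF inv F] holomorphic_on_compose_gen [OF inv P_hol]
      by (force simp: o_def)+
    then have "(\<lambda>u. F (1 / u) - P (1 / u)) holomorphic_on UNIV - {0}"
      by (rule holomorphic_on_diff)
    then show ?thesis
      by (rule holomorphic_transform) (auto simp: Q_def)
  qed
  moreover have Q0: "Q 0 = 0"
    unfolding Q_def by simp
  ultimately have "Q holomorphic_on UNIV"
    by (intro no_isolated_singularity' [where K = "{0}" and S = UNIV and f = Q]) simp_all
  moreover have "F z = P z + Q (1 / z)" if "z \<noteq> 0" for z
    using that by (simp add: Q_def)
  ultimately show ?thesis
    using Q0 by (intro that [OF P_hol])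
qed

lemma entire_power_series:
  assumes "P holomorphic_on UNIV"
  obtains p :: "nat \<Rightarrow> complex" where "\<And>z. (\<lambda>n. p n * z ^ n) sums P z"
proof (rule that)
  show "(\<lambda>n. (deriv ^^ n) P 0 / fact n * z ^ n) sums P z" for z
    using holomorphic_power_series [of P 0 "norm z + 1" z] assms holomorphic_on_subset
    by fastforce
qed

text \<open>
  Divide the \<open>n\<close>-th Taylor coefficient by \<open>1 - a ^ n\<close>, which stays away from \<open>0\<close> for \<open>n \<ge> 1\<close>. The equation
  at \<open>0\<close> forces \<open>P 0 = 0\<close>.
\<close>

lemma entire_coboundary:
  assumes P: "P holomorphic_on UNIV" "P 0 = 0" and a: "norm (a::complex) < 1"
  obtains h where "h holomorphic_on UNIV" "\<And>z. h z - h (a * z) = P z"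
proof -
  obtain p where p: "\<And>z. (\<lambda>n. p n * z ^ n) sums P z"
    using entire_power_series [OF P(1)] by blast
  have p0: "p 0 = 0"
    using sums_unique2 [OF p [of 0] powser_sums_zero [of p]] P(2) by simp
  define q where "q = (\<lambda>n. p n / (1 - a ^ n))"
  have an: "norm (a ^ n) \<le> norm a" if "n > 0" for n
  proof -
    have "norm a ^ n \<le> norm a ^ 1"
      using that a by (intro power_decreasing) auto
    then show ?thesis by (simp add: norm_power)
  qed
  have q_bound: "norm (q n) \<le> norm (p n) / (1 - norm a)" for n
  proof (cases "n = 0")
    case False
    then have "1 - norm a \<le> norm (1 - a ^ n)"
      using an [of n] norm_triangle_ineq2 [of 1 "a ^ n"] by simp
    then show ?thesis
      unfolding q_def norm_divide using a by (intro divide_left_mono mult_pos_pos) auto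
  qed (simp add: q_def p0)
  have summ: "summable (\<lambda>n. q n * z ^ n)" for z
  proof (rule summable_comparison_test)
    have "norm z < norm (of_real (norm z + 1) :: complex)"
      unfolding norm_of_real by simp
    then have "summable (\<lambda>n. norm (p n * z ^ n))"
      by (rule powser_insidea [OF sums_summable [OF p]])
    then show "summable (\<lambda>n. norm (p n * z ^ n) / (1 - norm a))"
      by (rule summable_divide)
    have "norm (q n * z ^ n) \<le> norm (p n * z ^ n) / (1 - norm a)" for n
      using mult_right_mono [OF q_bound [of n], of "norm z ^ n"] by (simp add: norm_mult norm_power)
    then show "\<exists>N. \<forall>n\<ge>N. norm (q n * z ^ n) \<le> norm (p n * z ^ n) / (1 - norm a)"
      by blast
  qed
  define h where "h = (\<lambda>z. \<Sum>n. q n * z ^ n)"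
  have h: "(\<lambda>n. q n * z ^ n) sums h z" for z
    unfolding h_def using summ by (rule summable_sums)
  show ?thesis
  proof (rule that)
    have "h holomorphic_on ball 0 r" for r
      by (rule power_series_holomorphic [where a = q]) (use h in simp)
    then have "h field_differentiable at z" for z
      by (meson centre_in_ball holomorphic_on_imp_differentiable_at mem_ball_0 open_ball less_add_one)
    then show "h holomorphic_on UNIV"
      by (simp add: holomorphic_on_def)
    fix z
    have "(\<lambda>n. q n * z ^ n - q n * (a * z) ^ n) sums (h z - h (a * z))"
      by (intro sums_diff h)
    moreover have "q n * z ^ n - q n * (a * z) ^ n = p n * z ^ n" for n
    proof (cases "n = 0")
      case False
      then have "1 - a ^ n \<noteq> 0"
        using an [of n] a by (metis norm_one not_less right_minus_eq neq0_conv)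
      then have "q n * (1 - a ^ n) = p n"
        by (simp add: q_def)
      then show ?thesis
        unfolding power_mult_distrib by (metis (no_types, opaque_lifting) mult.assoc mult.commute mult_1 right_diff_distrib)
    qed (simp add: p0 q_def)
    ultimately show "h z - h (a * z) = P z"
      using sums_unique2 [OF _ p [of z]] by simp
  qed
qed

lemma holomorphic_punctured_plane_inverse:
  assumes "P holomorphic_on UNIV"
  shows "(\<lambda>z. P (1 / z)) holomorphic_on -{0::complex}"
proof -
  have "(\<lambda>z::complex. 1 / z) holomorphic_on -{0}"
    by (intro holomorphic_intros) auto
  from holomorphic_on_compose_gen [OF this assms] show ?thesis
    by (simp add: o_def)
qed

text \<open>
  Solve the equation separately for both parts of the Laurent decomposition; \<open>c\<close> is the constant term.
  In the variable \<open>1 / z\<close> multiplication by \<open>a\<close> becomes division by \<open>a\<close>, so for the principal part \<open>Q\<close> the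
  equation solved is \<open>h2 u - h2 (a * u) = Q (a * u)\<close>, and the solution enters with a minus sign.
\<close>

lemma punctured_plane_coboundary:
  assumes W: "W holomorphic_on -{0}" and a: "0 < norm (a::complex)" "norm a < 1"
  obtains h c where "h holomorphic_on -{0}" "\<And>z. z \<noteq> 0 \<Longrightarrow> h z - h (a * z) = W z - c"
proof -
  obtain P Q where PQ: "P holomorphic_on UNIV" "Q holomorphic_on UNIV" "Q 0 = 0"
      "\<And>z. z \<noteq> 0 \<Longrightarrow> W z = P z + Q (1 / z)"
    using Laurent_decomposition [OF W] by blast
  have P': "(\<lambda>z. P z - P 0) holomorphic_on UNIV" "P 0 - P 0 = 0"
    using PQ(1) by (auto intro!: holomorphic_intros)
  obtain h1 where h1: "h1 holomorphic_on UNIV" "\<And>z. h1 z - h1 (a * z) = P z - P 0"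
    using entire_coboundary [OF P' a(2)] by blast
  have "(\<lambda>z. Q (a * z)) holomorphic_on UNIV"
    using holomorphic_on_compose_gen [OF _ PQ(2), of "\<lambda>z. a * z" UNIV]
    by (auto simp: o_def intro!: holomorphic_intros)
  moreover have "Q (a * 0) = 0"
    using PQ by simp
  ultimately obtain h2 where h2: "h2 holomorphic_on UNIV" "\<And>z. h2 z - h2 (a * z) = Q (a * z)"
    using entire_coboundary [OF _ _ a(2), of "\<lambda>z. Q (a * z)"] by blast
  show ?thesis
  proof (rule that)
    show "(\<lambda>z. h1 z - h2 (1 / z)) holomorphic_on -{0}"
      using h1(1) holomorphic_punctured_plane_inverse [OF h2(1)] holomorphic_on_subset
      by (intro holomorphic_on_diff) blast+
    fix z :: complex assume z: "z \<noteq> 0"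
    have "h2 (1 / (a * z)) - h2 (1 / z) = Q (1 / z)"
      using h2(2) [of "1 / (a * z)"] a z by simp
    then show "(h1 z - h2 (1 / z)) - (h1 (a * z) - h2 (1 / (a * z))) = W z - P 0"
      using h1(2) [of z] PQ(4) [OF z] by (simp add: algebra_simps)
  qed
qed

section \<open>Density of weighted Laurent polynomials\<close>

abbreviation (input) punctured_plane :: "complex set" where
  "punctured_plane \<equiv> UNIV - {0}"

lemma compact_punctured_plane_bounds:
  assumes "compact K" "K \<subseteq> punctured_plane"
  obtains R where "R \<ge> 1" "\<And>z. z \<in> K \<Longrightarrow> norm z \<le> R \<and> norm (1 / z) \<le> R"
proof -
  have "continuous_on K (\<lambda>z. 1 / z)"
    using assms(2) by (intro continuous_intros) auto
  then have "bounded ((\<lambda>z. 1 / z) ` K)"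
    using assms(1) by (intro compact_imp_bounded compact_continuous_image)
  then obtain R1 where R1: "\<And>z. z \<in> K \<Longrightarrow> norm (1 / z) \<le> R1"
    by (auto simp: bounded_iff)
  obtain R2 where R2: "\<And>z. z \<in> K \<Longrightarrow> norm z \<le> R2"
    using compact_imp_bounded [OF assms(1)] by (auto simp: bounded_iff)
  show ?thesis
    by (rule that [of "max 1 (max R1 R2)"]) (use R1 R2 in \<open>auto simp: le_max_iff_disj\<close>)
qed

text \<open>
  Membership in the closure of \<open>D\<close>, spelled out for uniform convergence on compact sets. Working with it
  allows one density argument for both the dense set of the criterion and a countable dense set, although
  the latter contains monomials with rational coefficients only.
\<close>

definition adherent :: "complex set \<Rightarrow> (complex \<Rightarrow> complex) set \<Rightarrow> (complex \<Rightarrow> complex) \<Rightarrow> bool" where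
  "adherent \<Omega> D f \<longleftrightarrow>
     (\<forall>K e. compact K \<and> K \<subseteq> \<Omega> \<and> e > 0 \<longrightarrow> (\<exists>d\<in>D. \<forall>z\<in>K. norm (d z - f z) < e))"

lemma dense_iff_adherent:
  "dense_in_space (hol_topology \<Omega>) D \<longleftrightarrow> D \<subseteq> hol_space \<Omega> \<and> (\<forall>f\<in>hol_space \<Omega>. adherent \<Omega> D f)"
  unfolding dense_in_hol_space_iff adherent_def ..

lemma adherent_mem: "f \<in> D \<Longrightarrow> adherent \<Omega> D f"
  unfolding adherent_def by (intro allI impI bexI [of _ f]) auto

lemma adherent_add:
  assumes D: "\<And>f g. f \<in> D \<Longrightarrow> g \<in> D \<Longrightarrow> f + g \<in> D" and "adherent \<Omega> D f" "adherent \<Omega> D g"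
  shows "adherent \<Omega> D (f + g)"
  unfolding adherent_def
proof (intro allI impI)
  fix K and e :: real assume K: "compact K \<and> K \<subseteq> \<Omega> \<and> e > 0"
  then have K': "compact K \<and> K \<subseteq> \<Omega> \<and> e/2 > 0" by simp
  obtain d where d: "d \<in> D" "\<forall>z\<in>K. norm (d z - f z) < e/2"
    using assms(2) K' unfolding adherent_def by blast
  obtain d' where d': "d' \<in> D" "\<forall>z\<in>K. norm (d' z - g z) < e/2"
    using assms(3) K' unfolding adherent_def by blast
  have "norm ((d + d') z - (f + g) z) < e" if "z \<in> K" for z
  proof -
    have "norm (d z - f z) < e/2" "norm (d' z - g z) < e/2"
      using d d' that by auto
    then show ?thesis
      using norm_triangle_lt [of "d z - f z" "d' z - g z" e] by (simp add: algebra_simps)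
  qed
  then show "\<exists>d\<in>D. \<forall>z\<in>K. norm (d z - (f + g) z) < e"
    using D d d' by blast
qed

lemma adherent_sum:
  assumes "\<And>f g. f \<in> D \<Longrightarrow> g \<in> D \<Longrightarrow> f + g \<in> D" "adherent \<Omega> D 0" "\<And>i. i \<in> A \<Longrightarrow> adherent \<Omega> D (f i)"
  shows "adherent \<Omega> D (sum f A)"
  using assms(3)
proof (induction A rule: infinite_finite_induct)
  case (insert i A)
  then have "adherent \<Omega> D (f i + sum f A)"
    by (intro adherent_add assms(1)) auto
  then show ?case
    by (simp only: sum.insert [OF insert.hyps])
next
  case (infinite A)
  show ?case
    unfolding sum.infinite [OF infinite.hyps] by (fact assms(2))
next
  case empty
  show ?case
    unfolding sum.empty by (fact assms(2))
qed

lemma adherent_limit: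
  assumes "\<And>K e. compact K \<Longrightarrow> K \<subseteq> \<Omega> \<Longrightarrow> e > 0 \<Longrightarrow> \<exists>g. adherent \<Omega> D g \<and> (\<forall>z\<in>K. norm (g z - f z) < e)"
  shows "adherent \<Omega> D f"
  unfolding adherent_def
proof (intro allI impI)
  fix K and e :: real assume K: "compact K \<and> K \<subseteq> \<Omega> \<and> e > 0"
  then have K': "compact K \<and> K \<subseteq> \<Omega> \<and> e/2 > 0" by simp
  obtain g where g: "adherent \<Omega> D g" "\<forall>z\<in>K. norm (g z - f z) < e/2"
    using assms [of K "e/2"] K' by blast
  obtain d where d: "d \<in> D" "\<forall>z\<in>K. norm (d z - g z) < e/2"
    using g(1) K' unfolding adherent_def by blast
  have "norm (d z - f z) < e" if "z \<in> K" for z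
  proof -
    have "norm (d z - g z) < e/2" "norm (g z - f z) < e/2"
      using d g that by auto
    then show ?thesis
      using norm_triangle_lt [of "d z - g z" "g z - f z" e] by simp
  qed
  then show "\<exists>d\<in>D. \<forall>z\<in>K. norm (d z - f z) < e"
    using d by blast
qed

lemma entire_uniform_partial_sums:
  assumes p: "\<And>z. (\<lambda>n. p n * z ^ n) sums P (z::complex)"
  shows "uniform_limit (cball 0 R) (\<lambda>N z. \<Sum>n<N. p n * z ^ n) P sequentially"
proof -
  have "conv_radius p = \<infinity>"
    by (rule conv_radius_inftyI'' [OF sums_summable [OF p]])
  then have "uniform_limit (cball 0 R) (\<lambda>N z. \<Sum>n<N. p n * (z - 0) ^ n) (\<lambda>z. \<Sum>n. p n * (z - 0) ^ n) sequentially"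
    by (intro powser_uniform_limit) simp
  moreover have "(\<lambda>z. \<Sum>n. p n * (z - 0) ^ n) = P"
    using p by (auto simp: sums_iff fun_eq_iff)
  ultimately show ?thesis
    by simp
qed

definition weighted_monomial :: "(complex \<Rightarrow> complex) \<Rightarrow> int \<Rightarrow> complex \<Rightarrow> complex" where
  "weighted_monomial G k = (\<lambda>z. if z = 0 then 0 else z powi k * G z)"

lemma weighted_monomial_in_hol_space:
  assumes "G holomorphic_on punctured_plane"
  shows "weighted_monomial G k \<in> hol_space punctured_plane"
proof -
  have "(\<lambda>z. z powi k * G z) holomorphic_on punctured_plane"
    using assms by (intro holomorphic_intros) auto
  then have "weighted_monomial G k holomorphic_on punctured_plane"
    by (rule holomorphic_transform) (auto simp: weighted_monomial_def)
  then show ?thesis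
    by (simp add: hol_space_def weighted_monomial_def)
qed

text \<open>
  Expand \<open>f / G\<close> into its two power series.
\<close>

lemma Laurent_polynomials_dense:
  assumes G: "G holomorphic_on punctured_plane" "\<And>z. z \<noteq> 0 \<Longrightarrow> G z \<noteq> 0"
    and D: "\<And>f g. f \<in> D \<Longrightarrow> g \<in> D \<Longrightarrow> f + g \<in> D"
    and mono: "\<And>c k. adherent punctured_plane D (hol_scale c (weighted_monomial G k))"
    and f: "f \<in> hol_space punctured_plane"
  shows "adherent punctured_plane D f"
proof -
  have "(\<lambda>z. f z / G z) holomorphic_on punctured_plane"
    using f G by (intro holomorphic_on_divide) (auto simp: hol_space_def)
  then have "(\<lambda>z. f z / G z) holomorphic_on -{0}"
    by (simp add: Compl_eq_Diff_UNIV)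
  then obtain P Q where PQ: "P holomorphic_on UNIV" "Q holomorphic_on UNIV" "Q 0 = 0"
      "\<And>z. z \<noteq> 0 \<Longrightarrow> f z / G z = P z + Q (1 / z)"
    by (rule Laurent_decomposition) blast
  obtain p where p: "\<And>z. (\<lambda>n. p n * z ^ n) sums P z"
    using entire_power_series [OF PQ(1)] by blast
  obtain q where q: "\<And>z. (\<lambda>n. q n * z ^ n) sums Q z"
    using entire_power_series [OF PQ(2)] by blast
  define s where "s = (\<lambda>N::nat. (\<Sum>n<N. hol_scale (p n) (weighted_monomial G (int n))) +
                        (\<Sum>n<N. hol_scale (q n) (weighted_monomial G (- int n))))"
  have zero: "adherent punctured_plane D 0"
    using mono [of 0 0] by (simp add: hol_scale_def zero_fun_def)
  have s: "adherent punctured_plane D (s N)" for N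
    unfolding s_def by (intro adherent_add D adherent_sum mono zero)
  show ?thesis
  proof (rule adherent_limit)
    fix K and e :: real assume K: "compact K" "K \<subseteq> punctured_plane" "e > 0"
    obtain R where R: "R \<ge> 1" "\<And>z. z \<in> K \<Longrightarrow> norm z \<le> R \<and> norm (1 / z) \<le> R"
      using compact_punctured_plane_bounds [OF K(1,2)] by blast
    have "continuous_on K G"
      by (rule continuous_on_subset [OF holomorphic_on_imp_continuous_on [OF G(1)] K(2)])
    then have "bounded (G ` K)"
      using K by (intro compact_imp_bounded compact_continuous_image)
    then obtain B where B: "B > 0" "\<And>z. z \<in> K \<Longrightarrow> norm (G z) \<le> B"
      by (auto simp: bounded_pos)
    \<comment> \<open>both power series are to be approximated up to \<open>d\<close>, after which the factor \<open>G\<close> is bounded by \<open>B\<close>\<close>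
    define d where "d = e / (2 * B)"
    have d: "d > 0"
      using K B by (simp add: d_def)
    have "\<forall>\<^sub>F N in sequentially. (\<forall>z\<in>cball 0 R. dist (\<Sum>n<N. p n * z ^ n) (P z) < d) \<and>
                        (\<forall>z\<in>cball 0 R. dist (\<Sum>n<N. q n * z ^ n) (Q z) < d)"
      by (intro eventually_conj uniform_limitD d entire_uniform_partial_sums p q)
    then obtain N where "(\<forall>z\<in>cball 0 R. dist (\<Sum>n<N. p n * z ^ n) (P z) < d) \<and>
                        (\<forall>z\<in>cball 0 R. dist (\<Sum>n<N. q n * z ^ n) (Q z) < d)"
      unfolding eventually_sequentially by blast
    then have N: "norm z \<le> R \<Longrightarrow> dist (\<Sum>n<N. p n * z ^ n) (P z) < d"
        "norm z \<le> R \<Longrightarrow> dist (\<Sum>n<N. q n * z ^ n) (Q z) < d" for z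
      by auto
    have "norm (s N z - f z) < e" if z: "z \<in> K" for z
    proof -
      have nz: "z \<noteq> 0" using K z by auto
      let ?x = "(\<Sum>n<N. p n * z ^ n) - P z" and ?y = "(\<Sum>n<N. q n * (1 / z) ^ n) - Q (1 / z)"
      have "f z = (P z + Q (1 / z)) * G z"
        using PQ(4) [OF nz] G(2) [OF nz] by (simp add: field_simps)
      moreover have "s N z = ((\<Sum>n<N. p n * z ^ n) + (\<Sum>n<N. q n * (1 / z) ^ n)) * G z"
        using nz by (simp add: s_def sum_fun_apply hol_scale_def weighted_monomial_def sum_distrib_right
            distrib_right power_int_minus power_one_over inverse_eq_divide mult.assoc)
      ultimately have "norm (s N z - f z) = norm (?x + ?y) * norm (G z)"
        by (simp add: norm_mult [symmetric] algebra_simps)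
      also have "\<dots> \<le> norm (?x + ?y) * B"
        using B(2) [OF z] by (intro mult_left_mono) auto
      also have "\<dots> < (2 * d) * B"
      proof -
        have "norm ?x < d" "norm ?y < d"
          using N(1) [of z] N(2) [of "1 / z"] R(2) [OF z] by (auto simp: dist_norm)
        then have "norm (?x + ?y) < 2 * d"
          by (intro norm_triangle_lt) simp
        then show ?thesis
          using B by simp
      qed
      also have "\<dots> = e"
        using B by (simp add: d_def)
      finally show ?thesis .
    qed
    then show "\<exists>g. adherent punctured_plane D g \<and> (\<forall>z\<in>K. norm (g z - f z) < e)"
      using s by blast
  qed
qed

text \<open>
  Laurent polynomials with complex rational coefficients, encoded by lists of coefficients and
  exponents.
\<close>

lemma separable_hol_space_punctured_plane:
  "\<exists>D. countable D \<and> dense_in_space (hol_topology punctured_plane) D"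
proof -
  define m where "m = weighted_monomial (\<lambda>_. 1)"
  define c where "c = (\<lambda>(x, y). Complex (of_rat x) (of_rat y))"
  define F where "F = (\<lambda>xs. sum_list (map (\<lambda>(u, k). hol_scale (c u) (m k)) xs))"
  define D where "D = range F"
  have m: "m k \<in> hol_space punctured_plane" for k
    unfolding m_def by (intro weighted_monomial_in_hol_space) auto
  have "countable D"
    unfolding D_def by (intro countable_image countableI_type)
  have F_mem: "F xs \<in> hol_space punctured_plane" for xs
  proof (induction xs)
    case Nil
    then show ?case using hol_space_zero unfolding F_def list.map sum_list.Nil .
  next
    case (Cons x xs)
    have "F (x # xs) = hol_scale (c (fst x)) (m (snd x)) + F xs"
      by (simp add: F_def case_prod_unfold)
    then show ?case
      using Cons m by (simp only:) (intro hol_space_add hol_space_scale)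
  qed
  have add: "f + g \<in> D" if fg: "f \<in> D" "g \<in> D" for f g
  proof -
    obtain xs ys where "f = F xs" "g = F ys"
      using fg by (auto simp: D_def)
    then have "f + g = F (xs @ ys)"
      by (simp only: F_def map_append sum_list_append)
    then show ?thesis
      by (simp add: D_def)
  qed
  have approx: "adherent punctured_plane D (hol_scale w (weighted_monomial (\<lambda>_. 1) k))" for w k
    unfolding adherent_def
  proof (intro allI impI)
    fix K and e :: real assume K: "compact K \<and> K \<subseteq> punctured_plane \<and> e > 0"
    have "continuous_on K (m k)"
      using m [of k] K by (auto simp: hol_space_def intro: continuous_on_subset holomorphic_on_imp_continuous_on)
    then have "bounded (m k ` K)"
      using K by (intro compact_imp_bounded compact_continuous_image) auto
    then obtain B where B: "B > 0" "\<And>z. z \<in> K \<Longrightarrow> norm (m k z) \<le> B"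
      by (auto simp: bounded_pos)
    define d where "d = e / (2 * B)"
    have d: "d > 0"
      using K B by (simp add: d_def)
    obtain x where x: "Re w < of_rat x" "of_rat x < Re w + d"
      using of_rat_dense [of "Re w" "Re w + d"] d by auto
    obtain y where y: "Im w < of_rat y" "of_rat y < Im w + d"
      using of_rat_dense [of "Im w" "Im w + d"] d by auto
    have "norm (c (x, y) - w) \<le> \<bar>Re (c (x, y) - w)\<bar> + \<bar>Im (c (x, y) - w)\<bar>"
      by (rule cmod_le)
    also have "\<dots> < 2 * d"
      using x y by (simp add: c_def)
    finally have cw: "norm (c (x, y) - w) < 2 * d" .
    have "norm (F [((x, y), k)] z - hol_scale w (weighted_monomial (\<lambda>_. 1) k) z) < e" if z: "z \<in> K" for z
    proof -
      have "norm (F [((x, y), k)] z - hol_scale w (weighted_monomial (\<lambda>_. 1) k) z) = norm (c (x, y) - w) * norm (m k z)"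
        by (simp add: F_def hol_scale_def m_def norm_mult [symmetric] algebra_simps)
      also have "\<dots> \<le> norm (c (x, y) - w) * B"
        using B(2) [OF z] by (intro mult_left_mono) auto
      also have "\<dots> < 2 * d * B"
        using cw B(1) by simp
      also have "\<dots> = e"
        using B by (simp add: d_def)
      finally show ?thesis .
    qed
    then show "\<exists>f\<in>D. \<forall>z\<in>K. norm (f z - hol_scale w (weighted_monomial (\<lambda>_. 1) k) z) < e"
      unfolding D_def by blast
  qed
  have "adherent punctured_plane D f" if "f \<in> hol_space punctured_plane" for f
    by (rule Laurent_polynomials_dense [where G = "\<lambda>_. 1", OF _ _ add approx that]) auto
  moreover have "D \<subseteq> hol_space punctured_plane"
    using F_mem by (auto simp: D_def)
  ultimately show ?thesis
    using \<open>countable D\<close> unfolding dense_iff_adherent by blast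
qed

section \<open>Weighted shifts satisfy the criterion\<close>

text \<open>
  Absolute convergence, uniformly on every compact set. Unlike unconditional convergence it is checked by a
  numerical majorant, and the set of vectors for which it holds for both series is invariant under \<open>S\<close>.
\<close>

definition abs_series :: "complex set \<Rightarrow> (nat \<Rightarrow> complex \<Rightarrow> complex) \<Rightarrow> bool" where
  "abs_series \<Omega> x \<longleftrightarrow> (\<forall>K. compact K \<and> K \<subseteq> \<Omega> \<longrightarrow>
     (\<exists>M. summable M \<and> (\<forall>n. 0 \<le> M n) \<and> (\<forall>n. \<forall>z\<in>K. norm (x n z) \<le> M n)))"

lemma abs_seriesD:
  assumes "abs_series \<Omega> x" "compact K" "K \<subseteq> \<Omega>"
  shows "\<exists>M. summable M \<and> (\<forall>n. 0 \<le> M n) \<and> (\<forall>n. \<forall>z\<in>K. norm (x n z) \<le> M n)"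
  using assms unfolding abs_series_def by simp

lemma abs_series_imp_unconditionally_convergent:
  assumes \<Omega>: "open \<Omega>" and x: "\<And>n. x n \<in> hol_space \<Omega>" and abs: "abs_series \<Omega> x"
  shows "unconditionally_convergent (hol_topology \<Omega>) x {1..}"
proof -
  define p where "p = (\<lambda>N. sum x {1..<N})"
  have pH: "p N \<in> hol_space \<Omega>" for N
    unfolding p_def by (intro hol_space_sum x)
  have tail: "\<exists>N. \<forall>F. finite F \<and> F \<subseteq> {N..} \<longrightarrow> (\<forall>z\<in>K. norm (sum x F z) < e)"
    if K: "compact K" "K \<subseteq> \<Omega>" and e: "e > 0" for K e
  proof -
    obtain M where M: "summable M" "\<And>n. 0 \<le> M n" "\<And>n z. z \<in> K \<Longrightarrow> norm (x n z) \<le> M n"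
      using abs_seriesD [OF abs K] by blast
    obtain N where N: "\<And>m n. m \<ge> N \<Longrightarrow> norm (sum M {m..<n}) < e"
      using M(1) e unfolding summable_Cauchy by blast
    have "norm (sum x F z) < e" if F: "finite F" "F \<subseteq> {N..}" and z: "z \<in> K" for F z
    proof -
      have "F \<subseteq> {N..<Suc (Max (insert N F))}"
        using F by (auto simp: less_Suc_eq_le)
      then have "sum M F \<le> sum M {N..<Suc (Max (insert N F))}"
        using M(2) by (intro sum_mono2) auto
      also have "\<dots> \<le> norm (sum M {N..<Suc (Max (insert N F))})"
        by simp
      also have "\<dots> < e"
        using N by blast
      finally have "sum M F < e" .
      moreover have "norm (sum x F z) \<le> sum M F"
        unfolding sum_fun_apply using M(3) [OF z] by (intro sum_norm_le)
      ultimately show ?thesis by linarith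
    qed
    then show ?thesis by blast
  qed
  have diff: "p n z - p m z = sum x ({1..<n} - {1..<m}) z" if "m \<le> n" for m n z
  proof -
    have "{1..<n} = {1..<m} \<union> ({1..<n} - {1..<m})"
      using that by auto
    then have "sum x {1..<n} = sum x {1..<m} + sum x ({1..<n} - {1..<m})"
      by (metis Diff_disjoint finite_Diff finite_atLeastLessThan sum.union_disjoint)
    then show ?thesis
      unfolding p_def by simp
  qed
  have Cauchy: "\<exists>M. \<forall>m\<ge>M. \<forall>n\<ge>m. \<forall>z\<in>K. norm (p n z - p m z) < e"
    if K: "compact K" "K \<subseteq> \<Omega>" and e: "e > 0" for K e
  proof -
    obtain N where N: "\<forall>F. finite F \<and> F \<subseteq> {N..} \<longrightarrow> (\<forall>z\<in>K. norm (sum x F z) < e)"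
      using tail [OF K e] by blast
    have "norm (p n z - p m z) < e" if "m \<ge> N" "n \<ge> m" "z \<in> K" for m n z
    proof -
      have "{1..<n} - {1..<m} \<subseteq> {N..}"
        using that by auto
      then show ?thesis
        unfolding diff [OF that(2)] using N that(3) by blast
    qed
    then show ?thesis by blast
  qed
  obtain s where s: "limitin (hol_topology \<Omega>) p s sequentially"
    by (rule hol_space_complete [OF \<Omega> pH Cauchy])
  have "limitin (hol_topology \<Omega>) (sum x) s (finite_subsets_at_top {1..})"
    unfolding limitin_hol_topology
  proof (intro conjI allI impI)
    show "s \<in> hol_space \<Omega>"
      using s unfolding limitin_hol_topology by (rule conjunct1)
    show "\<forall>\<^sub>F A in finite_subsets_at_top {1..}. sum x A \<in> hol_space \<Omega>"
      by (intro always_eventually allI hol_space_sum x)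
    fix K and e :: real assume K: "compact K \<and> K \<subseteq> \<Omega> \<and> e > 0"
    then have K': "compact K" "K \<subseteq> \<Omega>" "e/2 > 0" by auto
    obtain N1 where N1: "\<forall>F. finite F \<and> F \<subseteq> {N1..} \<longrightarrow> (\<forall>z\<in>K. norm (sum x F z) < e/2)"
      using tail [OF K'] by blast
    obtain N2 where N2: "\<forall>n\<ge>N2. \<forall>z\<in>K. norm (p n z - s z) < e/2"
      using limitin_hol_topologyD [OF s K'] unfolding eventually_sequentially by blast
    define N where "N = max N1 N2"
    have "norm (sum x A z - s z) < e" if A: "finite A" "{1..<N} \<subseteq> A" "A \<subseteq> {1..}" and z: "z \<in> K" for A z
    proof -
      have "A - {1..<N} \<subseteq> {N1..}"
        using A by (auto simp: N_def)
      then have 1: "norm (sum x (A - {1..<N}) z) < e/2"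
        using N1 A z by blast
      have 2: "norm (p N z - s z) < e/2"
        using N2 z by (simp add: N_def)
      have "sum x A = sum x (A - {1..<N}) + p N"
        unfolding p_def by (rule sum.subset_diff [OF A(2,1)])
      then have "sum x A z - s z = sum x (A - {1..<N}) z + (p N z - s z)"
        by simp
      also have "norm \<dots> < e"
        using 1 2 by (intro norm_triangle_lt) simp
      finally show ?thesis .
    qed
    then show "\<forall>\<^sub>F A in finite_subsets_at_top {1..}. \<forall>z\<in>K. norm (sum x A z - s z) < e"
      unfolding eventually_finite_subsets_at_top by (intro exI [of _ "{1..<N}"]) auto
  qed
  then show ?thesis
    unfolding unconditionally_convergent_def by blast
qed

lemma abs_series_add:
  assumes "abs_series \<Omega> x" "abs_series \<Omega> y"
  shows "abs_series \<Omega> (\<lambda>n. x n + y n)"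
  unfolding abs_series_def
proof (intro allI impI)
  fix K assume K: "compact K \<and> K \<subseteq> \<Omega>"
  obtain M where M: "summable M" "\<And>n. 0 \<le> M n" "\<And>n z. z \<in> K \<Longrightarrow> norm (x n z) \<le> M n"
    using abs_seriesD [OF assms(1), of K] K by blast
  obtain L where L: "summable L" "\<And>n. 0 \<le> L n" "\<And>n z. z \<in> K \<Longrightarrow> norm (y n z) \<le> L n"
    using abs_seriesD [OF assms(2), of K] K by blast
  show "\<exists>M. summable M \<and> (\<forall>n. 0 \<le> M n) \<and> (\<forall>n. \<forall>z\<in>K. norm ((x n + y n) z) \<le> M n)"
    using M L by (intro exI [of _ "\<lambda>n. M n + L n"]) (auto intro: summable_add norm_triangle_mono)
qed

lemma abs_series_Suc:
  assumes "abs_series \<Omega> x"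
  shows "abs_series \<Omega> (\<lambda>n. x (Suc n))"
  unfolding abs_series_def
proof (intro allI impI)
  fix K assume K: "compact K \<and> K \<subseteq> \<Omega>"
  obtain M where M: "summable M" "\<And>n. 0 \<le> M n" "\<And>n z. z \<in> K \<Longrightarrow> norm (x n z) \<le> M n"
    using abs_seriesD [OF assms, of K] K by blast
  show "\<exists>M. summable M \<and> (\<forall>n. 0 \<le> M n) \<and> (\<forall>n. \<forall>z\<in>K. norm (x (Suc n) z) \<le> M n)"
    using M by (intro exI [of _ "\<lambda>n. M (Suc n)"]) (auto simp: summable_Suc_iff)
qed

text \<open>
  Prepending a term; used to pass from the orbit of \<open>f\<close> to that of \<open>S f\<close>.
\<close>

lemma abs_series_Cons:
  assumes "abs_series \<Omega> x" "y 0 \<in> hol_space \<Omega>" "\<And>n. y (Suc n) = x n"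
  shows "abs_series \<Omega> y"
  unfolding abs_series_def
proof (intro allI impI)
  fix K assume K: "compact K \<and> K \<subseteq> \<Omega>"
  obtain M where M: "summable M" "\<And>n. 0 \<le> M n" "\<And>n z. z \<in> K \<Longrightarrow> norm (x n z) \<le> M n"
    using abs_seriesD [OF assms(1), of K] K by blast
  have "continuous_on K (y 0)"
    using assms(2) K by (auto simp: hol_space_def intro: continuous_on_subset holomorphic_on_imp_continuous_on)
  then have "bounded (y 0 ` K)"
    using K by (intro compact_imp_bounded compact_continuous_image) auto
  then obtain B where B: "B > 0" "\<And>z. z \<in> K \<Longrightarrow> norm (y 0 z) \<le> B"
    by (auto simp: bounded_pos)
  define L where "L = (\<lambda>n. case n of 0 \<Rightarrow> B | Suc n \<Rightarrow> M n)"
  have "summable (\<lambda>n. L (Suc n))"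
    using M by (simp add: L_def)
  then have "summable L"
    by (simp add: summable_Suc_iff)
  moreover have "0 \<le> L n \<and> (\<forall>z\<in>K. norm (y n z) \<le> L n)" for n
    using M B assms(3) by (cases n) (auto simp: L_def)
  ultimately show "\<exists>M. summable M \<and> (\<forall>n. 0 \<le> M n) \<and> (\<forall>n. \<forall>z\<in>K. norm (y n z) \<le> M n)"
    by blast
qed

text \<open>
  The ratio \<open>D * q ^ n * L\<close> of consecutive terms tends to \<open>0\<close>.
\<close>

lemma summable_superexponential:
  fixes D q L :: real
  assumes "0 \<le> D" "0 \<le> q" "q < 1" "0 \<le> L"
  shows "summable (\<lambda>n. (\<Prod>j<n. D * q ^ j) * L ^ n)"
proof -
  have "(\<lambda>n. D * q ^ n * L) \<longlonglongrightarrow> D * 0 * L"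
    using assms by (intro tendsto_intros LIMSEQ_power_zero) auto
  then have "\<forall>\<^sub>F n in sequentially. D * q ^ n * L < 1/2"
    by (intro order_tendstoD(2)) auto
  then obtain N where N: "\<And>n. n \<ge> N \<Longrightarrow> D * q ^ n * L < 1/2"
    by (auto simp: eventually_sequentially)
  show ?thesis
  proof (rule summable_ratio_test [of "1/2" N])
    fix n assume "N \<le> n"
    let ?b = "(\<Prod>j<n. D * q ^ j) * L ^ n"
    have b: "?b \<ge> 0"
      using assms by (intro mult_nonneg_nonneg prod_nonneg) auto
    have eq: "(\<Prod>j<Suc n. D * q ^ j) * L ^ Suc n = (D * q ^ n * L) * ?b"
      by simp
    have "norm ((\<Prod>j<Suc n. D * q ^ j) * L ^ Suc n) = (D * q ^ n * L) * ?b"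
      unfolding eq real_norm_def using assms by (intro abs_of_nonneg mult_nonneg_nonneg [OF _ b]) auto
    also have "\<dots> \<le> 1/2 * ?b"
      using N [OF \<open>N \<le> n\<close>] b by (intro mult_right_mono) auto
    also have "\<dots> = 1/2 * norm ?b"
      using b by (simp only: real_norm_def abs_of_nonneg)
    finally show "norm ((\<Prod>j<Suc n. D * q ^ j) * L ^ Suc n) \<le> 1/2 * norm ?b" .
  qed simp
qed

text \<open>
  Iterating the shift multiplies the weights, and up to a factor \<open>D ^ n\<close> their product is at most
  \<open>q ^ (n * (n - 1) div 2)\<close>. This beats any geometric growth of the vectors \<open>v n\<close>.
\<close>

lemma weighted_shift_abs_series:
  fixes v :: "nat \<Rightarrow> complex \<Rightarrow> complex" and c :: "nat \<Rightarrow> complex"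
  assumes shift: "\<And>b n. R (hol_scale b (v n)) = hol_scale (b * c n) (v (Suc n))"
    and c: "\<And>n. norm (c n) \<le> D * q ^ n" and q: "0 \<le> D" "0 \<le> q" "q < 1"
    and v: "\<And>K. compact K \<Longrightarrow> K \<subseteq> \<Omega> \<Longrightarrow> \<exists>B L. 0 \<le> B \<and> 0 \<le> L \<and> (\<forall>n. \<forall>z\<in>K. norm (v n z) \<le> B * L ^ n)"
  shows "abs_series \<Omega> (\<lambda>n. (R ^^ n) (hol_scale b (v 0)))"
  unfolding abs_series_def
proof (intro allI impI)
  fix K assume K: "compact K \<and> K \<subseteq> \<Omega>"
  obtain B L where BL: "0 \<le> B" "0 \<le> L" "\<And>n z. z \<in> K \<Longrightarrow> norm (v n z) \<le> B * L ^ n"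
    using v [of K] K by blast
  have orbit: "(R ^^ n) (hol_scale b (v 0)) = hol_scale (b * (\<Prod>j<n. c j)) (v n)" for n
    by (induction n) (simp_all add: shift mult.assoc)
  define M where "M = (\<lambda>n. norm b * B * ((\<Prod>j<n. D * q ^ j) * L ^ n))"
  have "summable M"
    unfolding M_def by (intro summable_mult summable_superexponential q BL)
  moreover have "0 \<le> M n" for n
    unfolding M_def using BL q by (intro mult_nonneg_nonneg prod_nonneg) auto
  moreover have "norm ((R ^^ n) (hol_scale b (v 0)) z) \<le> M n" if "z \<in> K" for n z
  proof -
    have "norm ((R ^^ n) (hol_scale b (v 0)) z) = norm b * (\<Prod>j<n. norm (c j)) * norm (v n z)"
      unfolding orbit by (simp add: hol_scale_def norm_mult prod_norm)
    also have "\<dots> \<le> norm b * (\<Prod>j<n. D * q ^ j) * (B * L ^ n)"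
      using BL q c that by (intro mult_mono mult_left_mono prod_mono mult_nonneg_nonneg prod_nonneg) auto
    also have "\<dots> = M n"
      by (simp add: M_def)
    finally show ?thesis .
  qed
  ultimately show "\<exists>M. summable M \<and> (\<forall>n. 0 \<le> M n) \<and> (\<forall>n. \<forall>z\<in>K. norm ((R ^^ n) (hol_scale b (v 0)) z) \<le> M n)"
    by blast
qed

lemma weighted_comp_scale: "weighted_comp \<Omega> \<omega> \<psi> (hol_scale c f) = hol_scale c (weighted_comp \<Omega> \<omega> \<psi> f)"
  by (auto simp: weighted_comp_def hol_scale_def)

lemma hol_scale_scale: "hol_scale a (hol_scale b f) = hol_scale (a * b) f"
  by (simp add: hol_scale_def mult.assoc)

text \<open>
  Forwards the weights are \<open>C * a powi (k + n * m)\<close>, backwards they are the reciprocals of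
  \<open>C * a powi (k - Suc n * m)\<close>. Because \<open>m \<ge> 1\<close> and \<open>\<bar>a\<bar> < 1\<close>, both decay geometrically in \<open>n\<close>, so both series
  converge on the vectors \<open>e k\<close>. The dense set consists of all vectors with absolutely convergent
  series, rather than the span of the \<open>e k\<close>; then its invariance under \<open>S\<close> is a shift of indices.
\<close>

lemma fhc_criterion_weighted_shift:
  fixes \<omega> :: "complex \<Rightarrow> complex" and e :: "int \<Rightarrow> complex \<Rightarrow> complex"
  assumes \<omega>: "\<omega> holomorphic_on punctured_plane" "\<And>z. z \<noteq> 0 \<Longrightarrow> \<omega> z \<noteq> 0" and b: "b \<noteq> 0"
  defines "T \<equiv> weighted_comp punctured_plane \<omega> (\<lambda>z. b * z)"
  assumes e: "\<And>k. e k \<in> hol_space punctured_plane"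
    and shift: "\<And>k. T (e k) = hol_scale (C * a powi k) (e (k + int m))"
    and C: "C \<noteq> 0" and a: "0 < norm a" "norm a < 1" and m: "m \<ge> 1"
    and growth: "\<And>K. compact K \<Longrightarrow> K \<subseteq> punctured_plane \<Longrightarrow>
       \<exists>B L. 0 \<le> B \<and> 1 \<le> L \<and> (\<forall>k. \<forall>z\<in>K. norm (e k z) \<le> B * L ^ nat \<bar>k\<bar>)"
    and span: "\<And>D f. (\<And>f g. f \<in> D \<Longrightarrow> g \<in> D \<Longrightarrow> f + g \<in> D) \<Longrightarrow>
       (\<And>c k. hol_scale c (e k) \<in> D) \<Longrightarrow> f \<in> hol_space punctured_plane \<Longrightarrow> adherent punctured_plane D f"
  shows "frequent_hypercyclicity_criterion (hol_topology punctured_plane) T"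
proof -
  define S where "S = weighted_comp punctured_plane (\<lambda>z. 1 / \<omega> (z / b)) (\<lambda>z. z / b)"
  have inv: "(\<lambda>z. z / b) holomorphic_on punctured_plane"
    using b by (intro holomorphic_intros) auto
  have img: "(\<lambda>z. z / b) ` punctured_plane \<subseteq> punctured_plane"
    using b by auto
  from holomorphic_on_compose_gen [OF inv \<omega>(1) this]
  have "(\<lambda>z. \<omega> (z / b)) holomorphic_on punctured_plane"
    by (simp add: o_def)
  then have inv_\<omega>: "(\<lambda>z. 1 / \<omega> (z / b)) holomorphic_on punctured_plane"
    using \<omega> b by (intro holomorphic_intros) auto
  have op: "operator_on (hol_topology punctured_plane) hol_scale T"
    unfolding T_def
  proof (rule operator_on_weighted_comp [OF \<omega>(1)])
    show "(\<lambda>z. b * z) holomorphic_on punctured_plane"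
      by (intro holomorphic_intros)
    show "(\<lambda>z. b * z) ` punctured_plane \<subseteq> punctured_plane"
      using b by auto
  qed
  have opS: "operator_on (hol_topology punctured_plane) hol_scale S"
    unfolding S_def by (rule operator_on_weighted_comp [OF inv_\<omega> inv img])
  interpret T: hol_operator punctured_plane T
    by unfold_locales (use op in auto)
  interpret S: hol_operator punctured_plane S
    by unfold_locales (use opS in auto)
  have T_scale: "T (hol_scale c f) = hol_scale c (T f)" for c f
    unfolding T_def by (rule weighted_comp_scale)
  have S_scale: "S (hol_scale c f) = hol_scale c (S f)" for c f
    unfolding S_def by (rule weighted_comp_scale)
  have TS: "T (S f) = f" and ST: "S (T f) = f" if "f \<in> hol_space punctured_plane" for f
    using that \<omega>(2) b by (auto simp: T_def S_def weighted_comp_def hol_space_def fun_eq_iff)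
  have a0: "a \<noteq> 0" using a by auto
  have S_shift: "S (e k) = hol_scale (1 / (C * a powi (k - int m))) (e (k - int m))" for k
  proof -
    have "e (k - int m) = S (T (e (k - int m)))"
      using ST e by simp
    also have "\<dots> = hol_scale (C * a powi (k - int m)) (S (e k))"
      by (simp add: shift S_scale)
    finally have "hol_scale (1 / (C * a powi (k - int m))) (e (k - int m)) =
        hol_scale (1 / (C * a powi (k - int m)) * (C * a powi (k - int m))) (S (e k))"
      by (simp add: hol_scale_scale)
    also have "1 / (C * a powi (k - int m)) * (C * a powi (k - int m)) = 1"
      using C a0 by simp
    finally show ?thesis
      by (simp add: hol_scale_def)
  qed
  \<comment> \<open>the quotient of consecutive weights in modulus\<close>
  define q where "q = norm a ^ m"
  have q: "0 \<le> q" "q < 1"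
    using a m by (auto simp: q_def power_less_one_iff)
  have q_power: "norm a powi int (n * m) = q ^ n" for n
    by (simp only: power_int_of_nat q_def power_mult [symmetric] mult.commute [of n m])
  have growth': "\<exists>B L. 0 \<le> B \<and> 0 \<le> L \<and> (\<forall>n. \<forall>z\<in>K. norm (e (k + s * int (n * m)) z) \<le> B * L ^ n)"
    if K: "compact K" "K \<subseteq> punctured_plane" and s: "\<bar>s\<bar> = 1" for K k s
  proof -
    obtain B L where BL: "0 \<le> B" "1 \<le> L" "\<And>k z. z \<in> K \<Longrightarrow> norm (e k z) \<le> B * L ^ nat \<bar>k\<bar>"
      using growth [OF K] by blast
    have "norm (e (k + s * int (n * m)) z) \<le> B * L ^ nat \<bar>k\<bar> * (L ^ m) ^ n" if "z \<in> K" for n z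
    proof -
      have "\<bar>k + s * int (n * m)\<bar> \<le> \<bar>k\<bar> + int (n * m)"
        using abs_triangle_ineq [of k "s * int (n * m)"] s by (simp add: abs_mult)
      then have "nat \<bar>k + s * int (n * m)\<bar> \<le> nat \<bar>k\<bar> + m * n"
        by (simp add: nat_le_iff mult.commute)
      then have "B * L ^ nat \<bar>k + s * int (n * m)\<bar> \<le> B * L ^ (nat \<bar>k\<bar> + m * n)"
        using BL by (intro mult_left_mono power_increasing) auto
      then show ?thesis
        using BL(3) [OF that, of "k + s * int (n * m)"] by (simp add: power_add power_mult)
    qed
    then show ?thesis
      using BL by (intro exI [of _ "B * L ^ nat \<bar>k\<bar>"] exI [of _ "L ^ m"]) auto
  qed
  have T_abs: "abs_series punctured_plane (\<lambda>n. (T ^^ n) (hol_scale c (e k)))" for c k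
  proof -
    define v where "v = (\<lambda>n. e (k + int (n * m)))"
    have "abs_series punctured_plane (\<lambda>n. (T ^^ n) (hol_scale c (v 0)))"
    proof (rule weighted_shift_abs_series [where c = "\<lambda>n. C * a powi (k + int (n * m))" and q = q
          and D = "norm C * norm a powi k"])
      show "T (hol_scale b (v n)) = hol_scale (b * (C * a powi (k + int (n * m)))) (v (Suc n))" for b n
        by (simp add: v_def T_scale shift hol_scale_scale algebra_simps)
      show "norm (C * a powi (k + int (n * m))) \<le> norm C * norm a powi k * q ^ n" for n
      proof -
        have "norm (a powi (k + int (n * m))) = norm a powi k * norm a powi int (n * m)"
          unfolding norm_power_int by (rule power_int_add) (use a0 in simp)
        then show ?thesis
          unfolding norm_mult q_power by simp
      qed
      show "\<exists>B L. 0 \<le> B \<and> 0 \<le> L \<and> (\<forall>n. \<forall>z\<in>K. norm (v n z) \<le> B * L ^ n)"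
        if "compact K" "K \<subseteq> punctured_plane" for K
        using growth' [OF that, of 1 k] by (simp add: v_def)
    qed (use q a in auto)
    then show ?thesis by (simp add: v_def)
  qed
  have S_abs: "abs_series punctured_plane (\<lambda>n. (S ^^ n) (hol_scale c (e k)))" for c k
  proof -
    define v where "v = (\<lambda>n. e (k - int (n * m)))"
    have "abs_series punctured_plane (\<lambda>n. (S ^^ n) (hol_scale c (v 0)))"
    proof (rule weighted_shift_abs_series [where c = "\<lambda>n. 1 / (C * a powi (k - int (n * m) - int m))" and q = q
          and D = "norm a powi (int m - k) / norm C"])
      show "S (hol_scale b (v n)) = hol_scale (b * (1 / (C * a powi (k - int (n * m) - int m)))) (v (Suc n))" for b n
        by (simp add: v_def S_scale S_shift hol_scale_scale algebra_simps)
      show "norm (1 / (C * a powi (k - int (n * m) - int m))) \<le> norm a powi (int m - k) / norm C * q ^ n" for n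
      proof -
        have "1 / norm a powi (k - int (n * m) - int m) = norm a powi (int m - k + int (n * m))"
          by (simp add: power_int_minus_divide [symmetric] algebra_simps)
        also have "\<dots> = norm a powi (int m - k) * norm a powi int (n * m)"
          by (rule power_int_add) (use a0 in simp)
        also have "\<dots> = norm a powi (int m - k) * q ^ n"
          unfolding q_power ..
        finally have eq: "1 / norm a powi (k - int (n * m) - int m) = norm a powi (int m - k) * q ^ n" .
        have "norm (1 / (C * a powi (k - int (n * m) - int m))) = (1 / norm a powi (k - int (n * m) - int m)) / norm C"
          by (simp add: norm_divide norm_mult norm_power_int)
        then show ?thesis
          unfolding eq by simp
      qed
      show "\<exists>B L. 0 \<le> B \<and> 0 \<le> L \<and> (\<forall>n. \<forall>z\<in>K. norm (v n z) \<le> B * L ^ n)"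
        if "compact K" "K \<subseteq> punctured_plane" for K
        using growth' [OF that, of "-1" k] by (simp add: v_def)
    qed (use q a in auto)
    then show ?thesis by (simp add: v_def)
  qed
  define X0 where "X0 = {f \<in> hol_space punctured_plane. abs_series punctured_plane (\<lambda>n. (T ^^ n) f) \<and>
                          abs_series punctured_plane (\<lambda>n. (S ^^ n) f)}"
  have "dense_in_space (hol_topology punctured_plane) X0"
    unfolding dense_iff_adherent
  proof (intro conjI ballI)
    show "X0 \<subseteq> hol_space punctured_plane" by (auto simp: X0_def)
    fix f assume "f \<in> hol_space punctured_plane"
    then show "adherent punctured_plane X0 f"
    proof (rule span [rotated 2])
      show "f + g \<in> X0" if "f \<in> X0" "g \<in> X0" for f g
        using that abs_series_add by (auto simp: X0_def T.Tn_add S.Tn_add hol_space_add)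
      show "hol_scale c (e k) \<in> X0" for c k
        using e T_abs S_abs by (auto simp: X0_def hol_space_scale)
    qed
  qed
  moreover have "S f \<in> X0" if "f \<in> X0" for f
  proof -
    have f: "f \<in> hol_space punctured_plane" "abs_series punctured_plane (\<lambda>n. (T ^^ n) f)"
        "abs_series punctured_plane (\<lambda>n. (S ^^ n) f)"
      using that by (auto simp: X0_def)
    have "abs_series punctured_plane (\<lambda>n. (S ^^ n) (S f))"
      using abs_series_Suc [OF f(3)] by (simp only: funpow_Suc_right o_apply)
    moreover have "abs_series punctured_plane (\<lambda>n. (T ^^ n) (S f))"
    proof (rule abs_series_Cons [OF f(2)])
      show "(T ^^ Suc n) (S f) = (T ^^ n) f" for n
        by (simp only: funpow_Suc_right o_apply TS [OF f(1)])
    qed (use S.T_closed f in simp)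
    ultimately show ?thesis
      using S.T_closed f by (simp add: X0_def)
  qed
  moreover have "unconditionally_convergent (hol_topology punctured_plane) (\<lambda>n. (T ^^ n) f) {1..}"
      "unconditionally_convergent (hol_topology punctured_plane) (\<lambda>n. (S ^^ n) f) {1..}" "T (S f) = f"
    if "f \<in> X0" for f
  proof -
    have f: "f \<in> hol_space punctured_plane" "abs_series punctured_plane (\<lambda>n. (T ^^ n) f)"
        "abs_series punctured_plane (\<lambda>n. (S ^^ n) f)"
      using that by (auto simp: X0_def)
    show "unconditionally_convergent (hol_topology punctured_plane) (\<lambda>n. (T ^^ n) f) {1..}"
        "unconditionally_convergent (hol_topology punctured_plane) (\<lambda>n. (S ^^ n) f) {1..}" "T (S f) = f"
      by (intro abs_series_imp_unconditionally_convergent T.open_domain T.Tn_closed S.Tn_closed TS f)+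
  qed
  ultimately show ?thesis
    unfolding frequent_hypercyclicity_criterion_def
    by (intro exI [of _ X0] exI [of _ S]) blast
qed

lemma weighted_monomial_growth:
  assumes h: "G holomorphic_on punctured_plane" and K: "compact K" "K \<subseteq> punctured_plane"
  shows "\<exists>B L. 0 \<le> B \<and> 1 \<le> L \<and> (\<forall>k. \<forall>z\<in>K. norm (weighted_monomial G k z) \<le> B * L ^ nat \<bar>k\<bar>)"
proof -
  obtain R where R: "R \<ge> 1" "\<And>z. z \<in> K \<Longrightarrow> norm z \<le> R \<and> norm (1 / z) \<le> R"
    using compact_punctured_plane_bounds [OF K] by blast
  have "continuous_on K G"
    by (rule continuous_on_subset [OF holomorphic_on_imp_continuous_on [OF h] K(2)])
  then have "bounded (G ` K)"
    using K by (intro compact_imp_bounded compact_continuous_image)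
  then obtain B where B: "B > 0" "\<And>z. z \<in> K \<Longrightarrow> norm (G z) \<le> B"
    by (auto simp: bounded_pos)
  have "norm (weighted_monomial G k z) \<le> B * R ^ nat \<bar>k\<bar>" if z: "z \<in> K" for k z
  proof -
    have nz: "z \<noteq> 0" using K z by auto
    have "norm (z powi k) \<le> R ^ nat \<bar>k\<bar>"
    proof (cases "k \<ge> 0")
      case True
      then show ?thesis
        using R(2) [OF z] by (simp add: power_int_def norm_power power_mono)
    next
      case False
      then have "norm (z powi k) = norm (1 / z) ^ nat \<bar>k\<bar>"
        by (simp add: power_int_def norm_power inverse_eq_divide norm_divide)
      then show ?thesis
        using R(2) [OF z] by (simp add: power_mono)
    qed
    then have "norm (z powi k) * norm (G z) \<le> R ^ nat \<bar>k\<bar> * B"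
      using B(2) [OF z] R(1) by (intro mult_mono) auto
    then show ?thesis
      using nz by (simp add: weighted_monomial_def norm_mult mult.commute)
  qed
  then show ?thesis
    using B R by (intro exI [of _ B] exI [of _ R]) auto
qed

lemma weighted_comp_cong:
  "(\<And>z. z \<in> \<Omega> \<Longrightarrow> \<omega> z = \<omega>' z \<and> \<psi> z = \<psi>' z) \<Longrightarrow> weighted_comp \<Omega> \<omega> \<psi> = weighted_comp \<Omega> \<omega>' \<psi>'"
  by (auto simp: weighted_comp_def fun_eq_iff)

lemma holomorphic_nonzero_powi_exp:
  assumes "W holomorphic_on punctured_plane"
  shows "(\<lambda>z. z powi k * exp (W z)) holomorphic_on punctured_plane"
  using assms by (intro holomorphic_on_mult holomorphic_on_power_int holomorphic_on_ident holomorphic_on_exp') auto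

text \<open>
  The factor \<open>exp (h z)\<close> turns the weight \<open>exp (W z)\<close> into the constant \<open>exp c\<close>.
\<close>

lemma fhc_criterion_contraction:
  assumes W: "W holomorphic_on punctured_plane" and a: "0 < norm (a::complex)" "norm a < 1" and m: "m \<ge> 1"
  shows "frequent_hypercyclicity_criterion (hol_topology punctured_plane)
           (weighted_comp punctured_plane (\<lambda>z. z powi int m * exp (W z)) (\<lambda>z. a * z))"
proof -
  have a0: "a \<noteq> 0" using a by auto
  obtain h c where h: "h holomorphic_on punctured_plane" "\<And>z. z \<noteq> 0 \<Longrightarrow> h z - h (a * z) = W z - c"
    using punctured_plane_coboundary [of W a] W a unfolding Compl_eq_Diff_UNIV by blast
  have G: "(\<lambda>z. exp (h z)) holomorphic_on punctured_plane"
    using h(1) by (intro holomorphic_on_exp')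
  define e where "e = weighted_monomial (\<lambda>z. exp (h z))"
  show ?thesis
  proof (rule fhc_criterion_weighted_shift [where e = e and C = "exp c" and a = a and m = m])
    show "(\<lambda>z. z powi int m * exp (W z)) holomorphic_on punctured_plane"
      by (rule holomorphic_nonzero_powi_exp [OF W])
    show "e k \<in> hol_space punctured_plane" for k
      unfolding e_def by (rule weighted_monomial_in_hol_space [OF G])
    show "weighted_comp punctured_plane (\<lambda>z. z powi int m * exp (W z)) (\<lambda>z. a * z) (e k) =
        hol_scale (exp c * a powi k) (e (k + int m))" for k
    proof
      fix z
      show "weighted_comp punctured_plane (\<lambda>z. z powi int m * exp (W z)) (\<lambda>z. a * z) (e k) z =
          hol_scale (exp c * a powi k) (e (k + int m)) z"
      proof (cases "z = 0")
        case False
        have "W z + h (a * z) = c + h z"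
          using h(2) [OF False] by (simp add: algebra_simps)
        then have "exp (W z) * exp (h (a * z)) = exp c * exp (h z)"
          by (simp only: exp_add [symmetric])
        then show ?thesis
          using False a0
          by (simp add: weighted_comp_def e_def weighted_monomial_def hol_scale_def power_int_add power_int_mult_distrib mult_ac)
      qed (simp add: weighted_comp_def e_def weighted_monomial_def hol_scale_def)
    qed
    show "\<exists>B L. 0 \<le> B \<and> 1 \<le> L \<and> (\<forall>k. \<forall>z\<in>K. norm (e k z) \<le> B * L ^ nat \<bar>k\<bar>)"
      if "compact K" "K \<subseteq> punctured_plane" for K
      unfolding e_def by (rule weighted_monomial_growth [OF G that])
    show "adherent punctured_plane D f"
      if "\<And>f g. f \<in> D \<Longrightarrow> g \<in> D \<Longrightarrow> f + g \<in> D" "\<And>c k. hol_scale c (e k) \<in> D" "f \<in> hol_space punctured_plane" for D f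
      by (rule Laurent_polynomials_dense [OF G]) (use that in \<open>auto simp: e_def intro: adherent_mem\<close>)
  qed (use a a0 m in auto)
qed

text \<open>
  The situation of the preceding lemma in the variable \<open>1 / z\<close>: the equation for \<open>h\<close> is solved there, and the
  exponents change sign.
\<close>

lemma fhc_criterion_expansion:
  assumes W: "W holomorphic_on punctured_plane" and a: "0 < norm (a::complex)" "norm a < 1" and m: "m \<ge> 1"
  shows "frequent_hypercyclicity_criterion (hol_topology punctured_plane)
           (weighted_comp punctured_plane (\<lambda>z. z powi (- int m) * exp (W z)) (\<lambda>z. (1 / a) * z))"
proof -
  have a0: "a \<noteq> 0" using a by auto
  have inv: "(\<lambda>z. 1 / z) holomorphic_on punctured_plane" "(\<lambda>z. 1 / z) ` punctured_plane \<subseteq> punctured_plane"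
    by (auto intro!: holomorphic_intros)
  have "(\<lambda>z. W (1 / z)) holomorphic_on punctured_plane"
    using holomorphic_on_compose_gen [OF inv(1) W inv(2)] by (simp add: o_def)
  then obtain g c where g: "g holomorphic_on punctured_plane" "\<And>z. z \<noteq> 0 \<Longrightarrow> g z - g (a * z) = W (1 / z) - c"
    using punctured_plane_coboundary [of "\<lambda>z. W (1 / z)" a] a unfolding Compl_eq_Diff_UNIV by blast
  define h where "h = (\<lambda>z. g (1 / z))"
  have "h holomorphic_on punctured_plane"
    using holomorphic_on_compose_gen [OF inv(1) g(1) inv(2)] by (simp add: o_def h_def)
  then have G: "(\<lambda>z. exp (h z)) holomorphic_on punctured_plane"
    by (intro holomorphic_on_exp')
  have h: "h z - h (z / a) = W z - c" if "z \<noteq> 0" for z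
    using g(2) [of "1 / z"] that by (simp add: h_def)
  define e where "e = (\<lambda>k. weighted_monomial (\<lambda>z. exp (h z)) (- k))"
  show ?thesis
  proof (rule fhc_criterion_weighted_shift [where e = e and C = "exp c" and a = a and m = m])
    show "(\<lambda>z. z powi (- int m) * exp (W z)) holomorphic_on punctured_plane"
      by (rule holomorphic_nonzero_powi_exp [OF W])
    show "e k \<in> hol_space punctured_plane" for k
      unfolding e_def by (rule weighted_monomial_in_hol_space [OF G])
    show "weighted_comp punctured_plane (\<lambda>z. z powi (- int m) * exp (W z)) (\<lambda>z. (1 / a) * z) (e k) =
        hol_scale (exp c * a powi k) (e (k + int m))" for k
    proof
      fix z
      show "weighted_comp punctured_plane (\<lambda>z. z powi (- int m) * exp (W z)) (\<lambda>z. (1 / a) * z) (e k) z =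
          hol_scale (exp c * a powi k) (e (k + int m)) z"
      proof (cases "z = 0")
        case False
        have "W z + h (z / a) = c + h z"
          using h [OF False] by (simp add: algebra_simps)
        then have 1: "exp (W z) * exp (h (z / a)) = exp c * exp (h z)"
          by (simp only: exp_add [symmetric])
        have 2: "(z / a) powi (- k) = a powi k * z powi (- k)"
          using False a0 by (simp add: power_int_minus power_int_divide_distrib field_simps)
        have 3: "z powi (- (k + int m)) = z powi (- k) * z powi (- int m)"
          using False by (simp add: power_int_add [symmetric])
        show ?thesis
          using False a0 1 by (simp add: weighted_comp_def e_def weighted_monomial_def hol_scale_def 2 3 mult_ac del: minus_add_distrib)
      qed (simp add: weighted_comp_def e_def weighted_monomial_def hol_scale_def)
    qed
    show "\<exists>B L. 0 \<le> B \<and> 1 \<le> L \<and> (\<forall>k. \<forall>z\<in>K. norm (e k z) \<le> B * L ^ nat \<bar>k\<bar>)"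
      if K: "compact K" "K \<subseteq> punctured_plane" for K
    proof -
      obtain B L where BL: "0 \<le> B" "1 \<le> L" "\<forall>k. \<forall>z\<in>K. norm (weighted_monomial (\<lambda>z. exp (h z)) k z) \<le> B * L ^ nat \<bar>k\<bar>"
        using weighted_monomial_growth [OF G K] by blast
      have "norm (e k z) \<le> B * L ^ nat \<bar>k\<bar>" if "z \<in> K" for k z
        using BL(3) [rule_format, OF that, of "- k"] by (simp add: e_def)
      then show ?thesis
        using BL by blast
    qed
    show "adherent punctured_plane D f"
      if D: "\<And>f g. f \<in> D \<Longrightarrow> g \<in> D \<Longrightarrow> f + g \<in> D" "\<And>c k. hol_scale c (e k) \<in> D" "f \<in> hol_space punctured_plane" for D f
    proof (rule Laurent_polynomials_dense [OF G])
      show "adherent punctured_plane D (hol_scale c (weighted_monomial (\<lambda>z. exp (h z)) k))" for c k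
        using D(2) [of c "- k"] by (intro adherent_mem) (simp add: e_def)
    qed (use D in auto)
  qed (use a a0 m in auto)
qed

section \<open>Winding numbers along circles\<close>

text \<open>
  The logarithms of \<open>1\<close> form a discrete set.
\<close>

lemma exp_eq_1_const:
  fixes d :: "'a::topological_space \<Rightarrow> complex"
  assumes "connected S" "continuous_on S d" "\<And>s. s \<in> S \<Longrightarrow> exp (d s) = 1"
  obtains k :: int where "\<And>s. s \<in> S \<Longrightarrow> d s = 2 * of_real pi * \<i> * of_int k"
proof (cases "S = {}")
  case False
  have int: "\<exists>k::int. d s = 2 * of_real pi * \<i> * of_int k" if "s \<in> S" for s
    using assms(3) [OF that] unfolding exp_eq_1 by (auto simp: complex_eq_iff)
  have "d constant_on S"
  proof (rule continuous_discrete_range_constant [OF assms(1,2)])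
    fix x assume x: "x \<in> S"
    obtain k :: int where k: "d x = 2 * of_real pi * \<i> * of_int k"
      using int [OF x] by blast
    have "1 \<le> norm (d y - d x)" if y: "y \<in> S" "d y \<noteq> d x" for y
    proof -
      obtain l :: int where l: "d y = 2 * of_real pi * \<i> * of_int l"
        using int [OF y(1)] by blast
      have "d y - d x = 2 * of_real pi * \<i> * of_int (l - k)"
        by (simp add: k l algebra_simps)
      then have "norm (d y - d x) = 2 * pi * of_int \<bar>l - k\<bar>"
        by (simp only: norm_mult norm_of_int) simp
      moreover have "l \<noteq> k"
        using y k l by auto
      then have "(1::real) \<le> of_int \<bar>l - k\<bar>"
        by linarith
      then have "1 * 1 \<le> 2 * pi * of_int \<bar>l - k\<bar>"
        using pi_ge_two by (intro mult_mono) auto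
      ultimately show ?thesis by simp
    qed
    then show "\<exists>e>0. \<forall>y. y \<in> S \<and> d y \<noteq> d x \<longrightarrow> e \<le> norm (d y - d x)"
      by (intro exI [of _ 1]) auto
  qed
  then obtain w where w: "\<And>s. s \<in> S \<Longrightarrow> d s = w"
    by (auto simp: constant_on_def)
  obtain s where s: "s \<in> S"
    using False by blast
  obtain k :: int where "d s = 2 * of_real pi * \<i> * of_int k"
    using int [OF s] by blast
  then show ?thesis
    using that w s by simp
qed (use that in auto)

text \<open>
  The winding number around \<open>0\<close> of \<open>f\<close> along the circle through \<open>c\<close> with centre \<open>0\<close>, given by the increment of a
  continuous logarithm. It is a relation since only functions without zeros on this circle have an index. The
  starting point \<open>c\<close> is a complex number so that the substitution of \<open>a * z\<close> for \<open>z\<close> is covered literally.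
\<close>

definition circle_index :: "(complex \<Rightarrow> complex) \<Rightarrow> complex \<Rightarrow> int \<Rightarrow> bool" where
  "circle_index f c k \<longleftrightarrow> (\<exists>V. continuous_on UNIV V \<and>
     (\<forall>t::real. f (c * cis t) = exp (V t) \<and> V (t + 2 * pi) = V t + 2 * of_real pi * \<i> * of_int k))"

lemma circle_point:
  assumes "norm z = norm c" "c \<noteq> 0"
  obtains t where "z = c * cis t"
proof -
  have "norm (z / c) = 1" "z / c \<noteq> 0"
    using assms by (auto simp: norm_divide)
  then have "cis (Arg (z / c)) = z / c"
    by (simp add: cis_Arg sgn_eq)
  then have "z = c * cis (Arg (z / c))"
    using assms by simp
  then show ?thesis by (rule that)
qed

lemma circle_index_nonzero: "circle_index f c k \<Longrightarrow> c \<noteq> 0 \<Longrightarrow> norm z = norm c \<Longrightarrow> f z \<noteq> 0"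
  by (metis circle_index_def circle_point exp_not_eq_zero)

lemma circle_index_cong:
  assumes "circle_index f c k" "\<And>z. norm z = norm c \<Longrightarrow> f z = g z"
  shows "circle_index g c k"
  using assms unfolding circle_index_def by (simp add: norm_mult)

lemma circle_index_exists:
  assumes "continuous_on (sphere 0 (norm c)) f" "\<And>z. norm z = norm c \<Longrightarrow> f z \<noteq> 0"
  obtains k where "circle_index f c k"
proof -
  have cont: "continuous_on UNIV (\<lambda>t. f (c * cis t))"
    by (intro continuous_on_compose2 [OF assms(1)] continuous_intros) (auto simp: norm_mult)
  obtain V where V: "continuous_on UNIV V" "\<And>t. f (c * cis t) = exp (V t)"
    by (rule continuous_logarithm_on_contractible [OF cont]) (use assms(2) in \<open>auto simp: norm_mult intro: convex_imp_contractible\<close>)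
  have per: "exp (V (t + 2 * pi) - V t) = 1" for t
  proof -
    have "exp (V (t + 2 * pi)) = exp (V t)"
      using V(2) [of "t + 2 * pi"] V(2) [of t] by (simp add: cis_mult [symmetric])
    then show ?thesis
      by (simp add: exp_diff)
  qed
  have cont': "continuous_on UNIV (\<lambda>t. V (t + 2 * pi) - V t)"
    by (intro continuous_intros continuous_on_compose2 [OF V(1)]) (auto intro: V(1))
  obtain k :: int where "\<And>t. t \<in> UNIV \<Longrightarrow> V (t + 2 * pi) - V t = 2 * of_real pi * \<i> * of_int k"
    by (rule exp_eq_1_const [OF connected_UNIV cont']) (use per in auto)
  then have "V (t + 2 * pi) = V t + 2 * of_real pi * \<i> * of_int k" for t
    by (metis UNIV_I add.commute diff_add_cancel)
  then have "circle_index f c k"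
    using V unfolding circle_index_def by blast
  then show ?thesis by (rule that)
qed

lemma circle_index_unique:
  assumes "circle_index f c k" "circle_index f c l"
  shows "k = l"
proof -
  obtain V where V: "continuous_on UNIV V" "\<And>t. f (c * cis t) = exp (V t)"
      "\<And>t. V (t + 2 * pi) = V t + 2 * of_real pi * \<i> * of_int k"
    using assms(1) unfolding circle_index_def by blast
  obtain W where W: "continuous_on UNIV W" "\<And>t. f (c * cis t) = exp (W t)"
      "\<And>t. W (t + 2 * pi) = W t + 2 * of_real pi * \<i> * of_int l"
    using assms(2) unfolding circle_index_def by blast
  have "exp (V t - W t) = 1" for t
    using V(2) [of t] W(2) [of t] by (simp add: exp_diff)
  then obtain n :: int where n: "\<And>t. t \<in> UNIV \<Longrightarrow> V t - W t = 2 * of_real pi * \<i> * of_int n"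
    using exp_eq_1_const [OF connected_UNIV continuous_on_diff [OF V(1) W(1)]] by blast
  have "V (0 + 2 * pi) - W (0 + 2 * pi) = V 0 - W 0"
    using n by simp
  then have "2 * of_real pi * \<i> * (of_int k - of_int l) = (0 :: complex)"
    unfolding V(3) W(3) by (simp add: algebra_simps)
  then show ?thesis by simp
qed

lemma circle_index_mult:
  assumes "circle_index f c k" "circle_index g c l"
  shows "circle_index (\<lambda>z. f z * g z) c (k + l)"
proof -
  obtain V where V: "continuous_on UNIV V" "\<And>t. f (c * cis t) = exp (V t)"
      "\<And>t. V (t + 2 * pi) = V t + 2 * of_real pi * \<i> * of_int k"
    using assms(1) unfolding circle_index_def by blast
  obtain W where W: "continuous_on UNIV W" "\<And>t. g (c * cis t) = exp (W t)"
      "\<And>t. W (t + 2 * pi) = W t + 2 * of_real pi * \<i> * of_int l"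
    using assms(2) unfolding circle_index_def by blast
  have "V (t + 2 * pi) + W (t + 2 * pi) = V t + W t + 2 * of_real pi * \<i> * of_int (k + l)" for t
    unfolding V(3) W(3) by (simp add: algebra_simps)
  moreover have "f (c * cis t) * g (c * cis t) = exp (V t + W t)" for t
    unfolding V(2) W(2) by (simp add: exp_add)
  ultimately show ?thesis
    unfolding circle_index_def
    by (intro exI [of _ "\<lambda>t. V t + W t"] conjI continuous_on_add V(1) W(1) allI)
qed

lemma circle_index_exp:
  assumes "continuous_on (sphere 0 (norm c)) W"
  shows "circle_index (\<lambda>z. exp (W z)) c 0"
proof -
  have "continuous_on UNIV (\<lambda>t. W (c * cis t))"
    by (intro continuous_on_compose2 [OF assms] continuous_intros) (auto simp: norm_mult)
  moreover have "W (c * cis (t + 2 * pi)) = W (c * cis t)" for t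
    by (simp add: cis_mult [symmetric])
  ultimately show ?thesis
    unfolding circle_index_def by (intro exI [of _ "\<lambda>t. W (c * cis t)"]) auto
qed

lemma circle_index_const: "w \<noteq> 0 \<Longrightarrow> circle_index (\<lambda>z. w) c 0"
  using circle_index_exp [of c "\<lambda>_. Ln w"] by simp

lemma circle_index_powi:
  assumes "c \<noteq> 0"
  shows "circle_index (\<lambda>z. z powi m) c m"
proof -
  have "(c * cis t) powi m = exp (of_int m * (Ln c + \<i> * of_real t))" for t
    using assms by (simp add: exp_power_int [symmetric] exp_add cis_conv_exp)
  moreover have "continuous_on UNIV (\<lambda>t::real. of_int m * (Ln c + \<i> * of_real t))"
    by (intro continuous_intros)
  ultimately show ?thesis
    unfolding circle_index_def
    by (intro exI [of _ "\<lambda>t. of_int m * (Ln c + \<i> * of_real t)"]) (auto simp: algebra_simps)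
qed

lemma circle_index_near_1:
  assumes "continuous_on (sphere 0 (norm c)) g" "\<And>z. norm z = norm c \<Longrightarrow> norm (g z - 1) < 1"
  shows "circle_index g c 0"
proof -
  have pos: "Re (g z) > 0" if "norm z = norm c" for z
    using abs_Re_le_cmod [of "g z - 1"] assms(2) [OF that] by simp
  then have nz: "g z \<noteq> 0" if "norm z = norm c" for z
    using that by force
  have "continuous_on (sphere 0 (norm c)) (\<lambda>z. Ln (g z))"
    using pos by (intro continuous_on_Ln' assms(1)) (auto simp: complex_nonpos_Reals_iff not_le)
  then have "circle_index (\<lambda>z. exp (Ln (g z))) c 0"
    by (rule circle_index_exp)
  then show ?thesis
    by (rule circle_index_cong) (use nz in auto)
qed

lemma circle_index_power:
  assumes "circle_index f c k"
  shows "circle_index (\<lambda>z. f z ^ n) c (int n * k)"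
proof (induction n)
  case 0
  then show ?case using circle_index_const [of 1] by simp
next
  case (Suc n)
  then show ?case using circle_index_mult [OF assms Suc] by (simp add: algebra_simps)
qed

lemma circle_index_linear_inside:
  assumes "norm p < norm c"
  shows "circle_index (\<lambda>z. z - p) c 1"
proof -
  have c: "c \<noteq> 0" using assms by auto
  have "circle_index (\<lambda>z. 1 - p / z) c 0"
  proof (rule circle_index_near_1)
    show "continuous_on (sphere 0 (norm c)) (\<lambda>z. 1 - p / z)"
      using c by (intro continuous_intros) auto
    show "norm (1 - p / z - 1) < 1" if "norm z = norm c" for z
      using that assms c by (simp add: norm_divide divide_less_eq)
  qed
  from circle_index_mult [OF circle_index_powi [OF c, of 1] this]
  have "circle_index (\<lambda>z. z powi 1 * (1 - p / z)) c 1" by simp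
  then show ?thesis
    by (rule circle_index_cong) (use c in \<open>auto simp: field_simps\<close>)
qed

lemma circle_index_linear_outside:
  assumes "norm c < norm p"
  shows "circle_index (\<lambda>z. z - p) c 0"
proof -
  have p: "p \<noteq> 0" using assms by auto
  have "circle_index (\<lambda>z. 1 - z / p) c 0"
  proof (rule circle_index_near_1)
    show "continuous_on (sphere 0 (norm c)) (\<lambda>z. 1 - z / p)"
      using p by (intro continuous_intros) auto
    show "norm (1 - z / p - 1) < 1" if "norm z = norm c" for z
      using that assms p by (simp add: norm_divide divide_less_eq)
  qed
  from circle_index_mult [OF circle_index_const [of "-p"] this] p
  have "circle_index (\<lambda>z. (-p) * (1 - z / p)) c 0" by simp
  then show ?thesis
    by (rule circle_index_cong) (use p in \<open>auto simp: field_simps\<close>)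
qed

text \<open>
  On the strip that the exponential function maps onto the annulus, \<open>f \<circ> exp\<close> has a continuous logarithm. Its
  increment over \<open>2 * pi * \<i>\<close> is constant on the strip, hence the same for all radii.
\<close>

lemma circle_index_annulus:
  assumes cont: "continuous_on {z. norm d \<le> norm z \<and> norm z \<le> norm c} f"
    and nz: "\<And>z. norm d \<le> norm z \<Longrightarrow> norm z \<le> norm c \<Longrightarrow> f z \<noteq> 0"
    and d: "d \<noteq> 0" "norm d \<le> norm c"
  obtains k where "circle_index f c k" "circle_index f d k"
proof -
  have c: "c \<noteq> 0" using d by auto
  define S where "S = {u. ln (norm d) \<le> Re u \<and> Re u \<le> ln (norm c)}"
  have S_eq: "S = {u. ln (norm d) \<le> Re u} \<inter> {u. Re u \<le> ln (norm c)}"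
    by (auto simp: S_def)
  have "convex S"
    unfolding S_eq by (intro convex_Int convex_halfspace_Re_ge convex_halfspace_Re_le)
  have mem: "norm d \<le> norm (exp u) \<and> norm (exp u) \<le> norm c" if "u \<in> S" for u
  proof -
    have "exp (ln (norm d)) \<le> exp (Re u)" "exp (Re u) \<le> exp (ln (norm c))"
      using that by (auto simp: S_def)
    then show ?thesis
      using c d by (simp add: norm_exp_eq_Re)
  qed
  have cont': "continuous_on S (\<lambda>u. f (exp u))"
    by (intro continuous_on_compose2 [OF cont] continuous_intros) (use mem in auto)
  obtain V where V: "continuous_on S V" "\<And>u. u \<in> S \<Longrightarrow> f (exp u) = exp (V u)"
    by (rule continuous_logarithm_on_contractible [OF cont' convex_imp_contractible [OF \<open>convex S\<close>]])
      (use mem nz in blast)+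
  have shift: "u + 2 * of_real pi * \<i> \<in> S" if "u \<in> S" for u
    using that by (simp add: S_def)
  have "exp (V (u + 2 * of_real pi * \<i>) - V u) = 1" if "u \<in> S" for u
  proof -
    have "exp (V (u + 2 * of_real pi * \<i>)) = f (exp (u + 2 * of_real pi * \<i>))"
      using V(2) shift that by simp
    also have "\<dots> = exp (V u)"
      using V(2) that by (simp add: exp_add)
    finally show ?thesis
      by (simp add: exp_diff)
  qed
  moreover have "continuous_on S (\<lambda>u. V (u + 2 * of_real pi * \<i>) - V u)"
    by (intro continuous_on_diff V(1) continuous_on_compose2 [OF V(1)] continuous_intros) (use shift in auto)
  ultimately obtain k :: int where k: "\<And>u. u \<in> S \<Longrightarrow> V (u + 2 * of_real pi * \<i>) - V u = 2 * of_real pi * \<i> * of_int k"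
    using exp_eq_1_const [OF convex_connected [OF \<open>convex S\<close>]] by blast
  have "circle_index f b k" if b: "norm d \<le> norm b" "norm b \<le> norm c" for b
  proof -
    have b0: "b \<noteq> 0" using b d by auto
    have S: "Ln b + \<i> * of_real t \<in> S" for t
      using b b0 c d by (simp add: S_def)
    have "continuous_on UNIV (\<lambda>t. V (Ln b + \<i> * of_real t))"
      by (intro continuous_on_compose2 [OF V(1)] continuous_intros) (use S in auto)
    moreover have "f (b * cis t) = exp (V (Ln b + \<i> * of_real t))" for t
      using V(2) [OF S [of t]] b0 by (simp add: exp_add cis_conv_exp)
    moreover have "V (Ln b + \<i> * of_real (t + 2 * pi)) = V (Ln b + \<i> * of_real t) + 2 * of_real pi * \<i> * of_int k" for t
    proof -
      have "Ln b + \<i> * of_real (t + 2 * pi) = Ln b + \<i> * of_real t + 2 * of_real pi * \<i>"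
        by (simp add: algebra_simps)
      then show ?thesis
        using k [OF S [of t]] by (metis add.commute diff_add_cancel)
    qed
    ultimately show ?thesis
      unfolding circle_index_def by blast
  qed
  then show ?thesis
    using that [of k] d by simp
qed

lemma connected_punctured_complex_plane: "connected (UNIV - {0::complex})"
  using connected_punctured_universe [of "0::complex"] by (simp add: Compl_eq_Diff_UNIV)

lemma finite_zeros_punctured_plane:
  assumes f: "f holomorphic_on UNIV - {0}" "f w \<noteq> 0" "w \<noteq> 0" and K: "compact K" "K \<subseteq> UNIV - {0::complex}"
  shows "finite {z \<in> K. f z = 0}"
proof (cases "f constant_on UNIV - {0}")
  case True
  then obtain y where y: "\<And>z. z \<in> UNIV - {0} \<Longrightarrow> f z = y"
    unfolding constant_on_def by blast
  have "f z = f w" if "z \<in> K" for z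
  proof -
    have "z \<in> UNIV - {0}" "w \<in> UNIV - {0}"
      using that K(2) f(3) by auto
    then show ?thesis
      by (simp only: y)
  qed
  then have "{z \<in> K. f z = 0} = {}"
    using f by auto
  then show ?thesis
    by (simp only: finite.emptyI)
next
  case False
  then show ?thesis
    by (intro holomorphic_compact_finite_zeros [OF f(1) _ connected_punctured_complex_plane K]) (auto simp: open_delete)
qed

lemma compact_annulus: "compact {z::complex. r \<le> norm z \<and> norm z \<le> s}"
proof -
  have "{z::complex. r \<le> norm z \<and> norm z \<le> s} = cball 0 s \<inter> {z. r \<le> norm z}"
    by auto
  moreover have "closed {z::complex. r \<le> norm z}"
    by (intro closed_Collect_le continuous_intros)
  ultimately show ?thesis
    by (simp add: compact_Int_closed)
qed

text \<open>
  The quotient extends across \<open>p\<close> by the local factorization there.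
\<close>

lemma holomorphic_factor_out_zero:
  assumes f: "f holomorphic_on UNIV - {0}" "f w \<noteq> 0" "w \<noteq> 0" and p: "p \<noteq> 0" "f p = 0"
  obtains h n where "h holomorphic_on UNIV - {0::complex}" "h p \<noteq> 0" "\<And>z. z \<noteq> 0 \<Longrightarrow> f z = (z - p) ^ n * h z"
proof -
  have "\<not> f constant_on UNIV - {0}"
  proof
    assume "f constant_on UNIV - {0}"
    then obtain y where "\<And>z. z \<in> UNIV - {0} \<Longrightarrow> f z = y"
      unfolding constant_on_def by blast
    then have "f w = f p"
      using f(3) p(1) by simp
    then show False
      using f(2) p(2) by simp
  qed
  then obtain g r n where g: "0 < n" "0 < r" "ball p r \<subseteq> UNIV - {0}" "g holomorphic_on ball p r"
      "\<And>z. z \<in> ball p r \<Longrightarrow> f z = (z - p) ^ n * g z" "\<And>z. z \<in> ball p r \<Longrightarrow> g z \<noteq> 0"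
  proof (rule holomorphic_factor_zero_nonconstant [OF f(1) _ connected_punctured_complex_plane, where \<xi> = p, rotated 3])
    show "open (UNIV - {0::complex})" "p \<in> UNIV - {0}" "f p = 0"
      using p by (auto simp: open_delete)
  next
    fix g r and n :: nat
    assume "0 < n" "0 < r" "ball p r \<subseteq> UNIV - {0}" "g holomorphic_on ball p r"
      "\<And>z. z \<in> ball p r \<Longrightarrow> f z = (z - p) ^ n * g z" "\<And>z. z \<in> ball p r \<Longrightarrow> g z \<noteq> 0"
    then show thesis by (rule that)
  qed
  \<comment> \<open>\<open>g\<close> is the local quotient near \<open>p\<close>\<close>
  define h where "h = (\<lambda>z. if z = p then g p else f z / (z - p) ^ n)"
  have hg: "h z = g z" if "z \<in> ball p r" for z
    using g(5) [OF that] by (simp add: h_def)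
  have "h holomorphic_on ball p r"
    by (rule holomorphic_transform [OF g(4)]) (use hg in auto)
  moreover have "h holomorphic_on (UNIV - {0}) - {p}"
  proof (rule holomorphic_transform)
    show "(\<lambda>z. f z / (z - p) ^ n) holomorphic_on (UNIV - {0}) - {p}"
      using f(1) by (intro holomorphic_intros) (auto intro: holomorphic_on_subset)
  qed (auto simp: h_def)
  ultimately have "h holomorphic_on (ball p r \<union> ((UNIV - {0}) - {p}))"
    by (rule holomorphic_on_Un) (auto simp: open_delete)
  moreover have "ball p r \<union> ((UNIV - {0}) - {p}) = UNIV - {0}"
    using g(2,3) p by auto
  ultimately have "h holomorphic_on UNIV - {0}"
    by simp
  moreover have "h p \<noteq> 0"
    using hg [of p] g(2,6) by simp
  moreover have "f z = (z - p) ^ n * h z" if "z \<noteq> 0" for z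
    using p g(1) by (simp add: h_def)
  ultimately show ?thesis
    by (rule that)
qed

text \<open>
  The difference of the indices is the number of zeros in the annulus. By induction on the number of distinct
  zeros: splitting off a zero \<open>p\<close> of order \<open>n\<close> in the form \<open>(z - p) ^ n\<close> costs \<open>n\<close> on the outer circle and
  nothing on the inner one.
\<close>

theorem circle_index_mono:
  assumes "f holomorphic_on UNIV - {0}" "circle_index f d j" "circle_index f c k"
    and "d \<noteq> 0" "norm d \<le> norm c"
  shows "j \<le> k"
  using assms
proof (induction "card {z. norm d \<le> norm z \<and> norm z \<le> norm c \<and> f z = 0}" arbitrary: f j k rule: less_induct)
  case less
  let ?Z = "\<lambda>f. {z. norm d \<le> norm z \<and> norm z \<le> norm c \<and> f z = 0}"
  have c: "c \<noteq> 0"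
    using less.prems by auto
  have fc: "f c \<noteq> 0"
    using circle_index_nonzero [OF less.prems(3) c] by simp
  have fin: "finite (?Z f)"
  proof -
    have "finite {z \<in> {z. norm d \<le> norm z \<and> norm z \<le> norm c}. f z = 0}"
      using less.prems(4) by (intro finite_zeros_punctured_plane [OF less.prems(1) fc c] compact_annulus) auto
    then show ?thesis
      by simp
  qed
  have cont: "continuous_on A g" if "g holomorphic_on UNIV - {0}" "A \<subseteq> UNIV - {0}" for g :: "complex \<Rightarrow> complex" and A
    using that continuous_on_subset holomorphic_on_imp_continuous_on by blast
  show ?case
  proof (cases "?Z f = {}")
    case True
    obtain l where "circle_index f c l" "circle_index f d l"
    proof (rule circle_index_annulus)
      show "continuous_on {z. norm d \<le> norm z \<and> norm z \<le> norm c} f"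
        using less.prems(4) by (intro cont less.prems(1)) auto
    qed (use True less.prems in auto)
    then show ?thesis
      using circle_index_unique less.prems(2,3) by (metis order_refl)
  next
    case False
    then obtain p where p: "norm d \<le> norm p" "norm p \<le> norm c" "f p = 0"
      by blast
    have p0: "p \<noteq> 0"
      using p less.prems by auto
    have strict: "norm d < norm p" "norm p < norm c"
      using p circle_index_nonzero [OF less.prems(2), of p] circle_index_nonzero [OF less.prems(3), of p] less.prems(4) c
      by (auto simp: less_le)
    obtain h n where h: "h holomorphic_on UNIV - {0}" "h p \<noteq> 0" "\<And>z. z \<noteq> 0 \<Longrightarrow> f z = (z - p) ^ n * h z"
      using holomorphic_factor_out_zero [OF less.prems(1) fc c p0 p(3)] by metis
    have hnz: "h z \<noteq> 0" if "f z \<noteq> 0" "z \<noteq> 0" for z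
      using that h(3) [of z] by auto
    obtain j' where j': "circle_index h d j'"
    proof (rule circle_index_exists)
      show "continuous_on (sphere 0 (norm d)) h"
        using less.prems(4) by (intro cont h) auto
      show "h z \<noteq> 0" if "norm z = norm d" for z
      proof (rule hnz)
        show "f z \<noteq> 0" by (rule circle_index_nonzero [OF less.prems(2,4) that])
        show "z \<noteq> 0" using that less.prems(4) by auto
      qed
    qed
    obtain k' where k': "circle_index h c k'"
    proof (rule circle_index_exists)
      show "continuous_on (sphere 0 (norm c)) h"
        using c by (intro cont h) auto
      show "h z \<noteq> 0" if "norm z = norm c" for z
      proof (rule hnz)
        show "f z \<noteq> 0" by (rule circle_index_nonzero [OF less.prems(3) c that])
        show "z \<noteq> 0" using that c by auto
      qed
    qed
    have "circle_index f d (int n * 0 + j')"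
    proof (rule circle_index_cong)
      show "circle_index (\<lambda>z. (z - p) ^ n * h z) d (int n * 0 + j')"
        by (intro circle_index_mult circle_index_power circle_index_linear_outside strict j')
      show "(z - p) ^ n * h z = f z" if "norm z = norm d" for z
        by (rule h(3) [symmetric]) (use that less.prems(4) in auto)
    qed
    then have j: "j = j'"
      using circle_index_unique [OF less.prems(2)] by simp
    have "circle_index f c (int n * 1 + k')"
    proof (rule circle_index_cong)
      show "circle_index (\<lambda>z. (z - p) ^ n * h z) c (int n * 1 + k')"
        by (intro circle_index_mult circle_index_power circle_index_linear_inside strict k')
      show "(z - p) ^ n * h z = f z" if "norm z = norm c" for z
        by (rule h(3) [symmetric]) (use that c in auto)
    qed
    then have k: "k = int n + k'"
      using circle_index_unique [OF less.prems(3)] by simp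
    have "z \<noteq> 0" if "norm d \<le> norm z" for z :: complex
      using that less.prems(4) by auto
    then have "?Z h \<subseteq> ?Z f - {p}"
      using h(2,3) by auto
    then have "card (?Z h) \<le> card (?Z f - {p})"
      using fin by (intro card_mono) auto
    also have "\<dots> < card (?Z f)"
      using fin p by (intro psubset_card_mono) auto
    finally have "j' \<le> k'"
      using less.hyps [OF _ h(1) j' k' less.prems(4,5)] by blast
    then show ?thesis
      by (simp add: j k)
  qed
qed

text \<open>
  The zero-free entire function \<open>\<omega> \<circ> exp\<close> has a holomorphic logarithm \<open>V\<close>, and \<open>V u\<close> grows by
  \<open>2 * pi * \<i> * m\<close> under \<open>u \<mapsto> u + 2 * pi * \<i>\<close> for some integer \<open>m\<close>. So \<open>V u - m * u\<close> is periodic and descends to the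
  punctured plane.
\<close>

lemma punctured_plane_factorization:
  assumes \<omega>: "\<omega> holomorphic_on UNIV - {0}" "\<And>z. z \<noteq> 0 \<Longrightarrow> \<omega> z \<noteq> (0::complex)"
  obtains m :: int and W where "W holomorphic_on UNIV - {0}" "\<And>z. z \<noteq> 0 \<Longrightarrow> \<omega> z = z powi m * exp (W z)"
proof -
  have lift: "(\<lambda>u. \<omega> (exp u)) holomorphic_on UNIV"
    using holomorphic_on_compose_gen [OF holomorphic_on_exp \<omega>(1)] by (force simp: o_def)
  obtain V where V: "V holomorphic_on UNIV" "\<And>u. u \<in> UNIV \<Longrightarrow> \<omega> (exp u) = exp (V u)"
    by (rule contractible_imp_holomorphic_log [OF lift]) (use \<omega>(2) in \<open>auto intro: convex_imp_contractible\<close>)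
  have contV: "continuous_on UNIV V"
    by (rule holomorphic_on_imp_continuous_on [OF V(1)])
  have "exp (V (u + 2 * of_real pi * \<i>) - V u) = 1" for u
  proof -
    have "exp (V (u + 2 * of_real pi * \<i>)) = exp (V u)"
      using V(2) [of u] V(2) [of "u + 2 * of_real pi * \<i>"] by (simp add: exp_add)
    then show ?thesis
      by (simp add: exp_diff)
  qed
  moreover have "continuous_on UNIV (\<lambda>u. V (u + 2 * of_real pi * \<i>) - V u)"
    by (intro continuous_on_diff contV continuous_on_compose2 [OF contV] continuous_intros) auto
  ultimately obtain m :: int where m: "\<And>u. u \<in> UNIV \<Longrightarrow> V (u + 2 * of_real pi * \<i>) - V u = 2 * of_real pi * \<i> * of_int m"
    using exp_eq_1_const [OF connected_UNIV] by blast
  define P where "P = (\<lambda>u. V u - of_int m * u)"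
  have P1: "P (u + 2 * of_real pi * \<i>) = P u" for u
    using m [of u] by (simp add: P_def algebra_simps)
  have Pn: "P (u + 2 * of_real pi * \<i> * of_nat n) = P u" for u n
  proof (induction n)
    case (Suc n)
    then show ?case
      using P1 [of "u + 2 * of_real pi * \<i> * of_nat n"] by (simp add: algebra_simps)
  qed simp
  have periodic: "P u = P v" if eq: "exp u = exp v" for u v
  proof -
    obtain n :: int where n: "u = v + of_int (2 * n) * of_real pi * \<i>"
      using eq unfolding exp_eq by auto
    show ?thesis
    proof (cases "n \<ge> 0")
      case True
      then show ?thesis
        using Pn [of v "nat n"] n by (simp add: mult_ac)
    next
      case False
      then have "v = u + 2 * of_real pi * \<i> * of_nat (nat (- n))"
        using n by (simp add: mult_ac)
      then show ?thesis
        using Pn [of u "nat (- n)"] by simp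
    qed
  qed
  have P_hol: "P holomorphic_on UNIV"
    unfolding P_def by (intro holomorphic_intros V)
  define W where "W = (\<lambda>z. P (Ln z))"
  have W_eq: "W z = P (Ln (z / b) + Ln b)" if "z \<noteq> 0" "b \<noteq> 0" for z b
    unfolding W_def using that by (intro periodic) (simp add: exp_add)
  have "W field_differentiable at b" if b: "b \<noteq> 0" for b
  proof -
    \<comment> \<open>near \<open>b\<close> replace the principal branch by \<open>Ln (z / b) + Ln b\<close>, which is continuous there\<close>
    have ball: "z \<noteq> 0" "z / b \<notin> \<real>\<^sub>\<le>\<^sub>0" if z: "dist z b < norm b" for z
    proof -
      have "z / b - 1 = (z - b) / b"
        using b by (simp add: diff_divide_distrib)
      then have "norm (z / b - 1) < 1"
        using z b by (simp add: dist_norm norm_divide divide_less_eq)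
      then have "Re (z / b) > 0"
        using abs_Re_le_cmod [of "z / b - 1"] by simp
      then show "z / b \<notin> \<real>\<^sub>\<le>\<^sub>0" "z \<noteq> 0"
        by (auto simp: complex_nonpos_Reals_iff)
    qed
    have L: "(\<lambda>z. Ln (z / b) + Ln b) holomorphic_on ball b (norm b)"
      using b ball by (intro holomorphic_intros) (auto simp: dist_commute)
    have "(\<lambda>z. P (Ln (z / b) + Ln b)) holomorphic_on ball b (norm b)"
      using holomorphic_on_compose_gen [OF L P_hol] by (auto simp: o_def)
    then have "W holomorphic_on ball b (norm b)"
      by (rule holomorphic_transform) (use W_eq [OF _ b] ball in \<open>auto simp: dist_commute\<close>)
    then show ?thesis
      using b by (intro holomorphic_on_imp_differentiable_at) auto
  qed
  then have "W holomorphic_on UNIV - {0}"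
    by (auto simp: holomorphic_on_def intro: field_differentiable_at_within)
  moreover have "\<omega> z = z powi m * exp (W z)" if z: "z \<noteq> 0" for z
  proof -
    have "\<omega> z = exp (of_int m * Ln z + W z)"
      using V(2) [of "Ln z"] z by (simp add: W_def P_def)
    also have "\<dots> = exp (Ln z) powi m * exp (W z)"
      by (simp add: exp_add exp_power_int)
    finally show ?thesis
      using z by simp
  qed
  ultimately show ?thesis
    by (rule that)
qed

section \<open>Injective self-maps of the punctured plane\<close>

text \<open>
  At an essential singularity all values but one would be attained infinitely often.
\<close>

lemma limit_or_pole_at_isolated_singularity:
  assumes f: "f holomorphic_on punctured_plane" "inj_on f punctured_plane"
  shows "(\<exists>l. (f \<longlongrightarrow> l) (at 0)) \<or> (\<exists>l. ((inverse \<circ> f) \<longlongrightarrow> l) (at 0))"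
proof (rule ccontr)
  assume non: "\<not> ?thesis"
  obtain a where a: "\<And>w. w \<noteq> a \<Longrightarrow> infinite {x. x \<in> UNIV - {0} \<and> f x = w}"
    by (rule great_Picard_infinite [OF open_UNIV UNIV_I f(1)]) (use non in blast)+
  have "finite {x. x \<in> UNIV - {0} \<and> f x = a + 1}"
  proof (cases "\<exists>p. p \<in> UNIV - {0} \<and> f p = a + 1")
    case True
    then obtain p where p: "p \<in> UNIV - {0}" "f p = a + 1" by blast
    have "{x. x \<in> UNIV - {0} \<and> f x = a + 1} \<subseteq> {p}"
      using p f(2) by (auto simp: inj_on_def)
    then show ?thesis
      using finite_subset by blast
  next
    case False
    then have "{x. x \<in> UNIV - {0} \<and> f x = a + 1} = {}" by blast
    then show ?thesis by (simp only: finite.emptyI)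
  qed
  then show False
    using a [of "a + 1"] by simp
qed

text \<open>
  The derivative of an injective polynomial has no zeros and hence is constant.
\<close>

lemma injective_polynomial_linear:
  fixes p :: "complex poly"
  assumes "inj (poly p)"
  obtains b c where "c \<noteq> 0" "\<And>z. poly p z = b + c * z"
proof -
  have "poly (pderiv p) z \<noteq> 0" for z
  proof -
    have "deriv (poly p) z \<noteq> 0"
      using assms by (intro holomorphic_injective_imp_regular [of "poly p" UNIV]) (auto intro!: holomorphic_intros)
    then show ?thesis
      using poly_DERIV [of p z] by (simp add: DERIV_imp_deriv)
  qed
  then have "constant (poly (pderiv p))"
    using Fundamental_Theorem_Algebra.fundamental_theorem_of_algebra by blast
  then have deg: "degree p \<le> 1"
    by (simp add: constant_degree degree_pderiv)
  have eq: "poly p z = coeff p 0 + coeff p 1 * z" for z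
  proof -
    consider "degree p = 0" | "degree p = 1"
      using deg by linarith
    then show ?thesis
      by cases (simp_all add: poly_altdef coeff_eq_0)
  qed
  have "coeff p 1 \<noteq> 0"
    using eq injD [OF assms, of 0 1] by auto
  then show ?thesis
    using that eq by blast
qed

text \<open>
  The extension \<open>\<phi>\<close> of \<open>f\<close> by its limit is entire. It is injective, since a value taken both at \<open>0\<close> and at
  some \<open>p\<close> would by the open mapping theorem have neighbours taken near \<open>0\<close> as well as near \<open>p\<close>. At
  infinity \<open>\<phi>\<close> is no more singular than \<open>f\<close> at \<open>0\<close>, so it is a polynomial, and therefore linear; its zero must
  be \<open>0\<close>.
\<close>

lemma injective_self_map_limit_imp_linear:
  assumes f: "f holomorphic_on punctured_plane" "inj_on f punctured_plane" "f ` punctured_plane \<subseteq> punctured_plane"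
    and lim: "(f \<longlongrightarrow> l) (at 0)"
  obtains a where "a \<noteq> 0" "\<And>z. z \<noteq> 0 \<Longrightarrow> f z = a * z"
proof -
  define \<phi> where "\<phi> = (\<lambda>z. if z = 0 then l else f z)"
  have "\<phi> holomorphic_on UNIV - {0}"
    by (rule holomorphic_transform [OF f(1)]) (auto simp: \<phi>_def)
  moreover have "(\<phi> \<longlongrightarrow> \<phi> 0) (at 0)"
  proof -
    have "(\<phi> \<longlongrightarrow> l) (at 0)"
      using lim by (rule Lim_transform_eventually) (auto simp: \<phi>_def eventually_at intro!: exI [of _ 1])
    then show ?thesis by (simp add: \<phi>_def)
  qed
  ultimately have hol: "\<phi> holomorphic_on UNIV"
    by (intro no_isolated_singularity' [where K = "{0}" and S = UNIV and f = \<phi>]) simp_all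
  have nonconst: "\<not> \<phi> constant_on UNIV"
  proof
    assume "\<phi> constant_on UNIV"
    then obtain y where "\<forall>x\<in>UNIV. \<phi> x = y"
      unfolding constant_on_def by blast
    then have "\<phi> 1 = \<phi> 2"
      by simp
    then have "f 1 = f 2" by (simp add: \<phi>_def)
    then show False
      using inj_onD [OF f(2), of 1 2] by simp
  qed
  have not_l: "f p \<noteq> l" if p: "p \<noteq> 0" for p
  proof
    assume fp: "f p = l"
    define r where "r = norm p / 2"
    have r: "r > 0" using p by (simp add: r_def)
    have disj: "ball 0 r \<inter> ball p r = {}"
    proof (rule ccontr)
      assume "ball 0 r \<inter> ball p r \<noteq> {}"
      then obtain z where "norm z < r" "dist p z < r" by auto
      then have "norm p < 2 * r"
        using norm_triangle_sub [of p z] by (simp add: dist_norm)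
      then show False by (simp add: r_def)
    qed
    have "open (\<phi> ` ball 0 r \<inter> \<phi> ` ball p r)"
      by (intro open_Int open_mapping_thm [OF hol _ _ _ _ nonconst]) auto
    moreover have "l \<in> \<phi> ` ball 0 r \<inter> \<phi> ` ball p r"
    proof
      show "l \<in> \<phi> ` ball 0 r" using r by (intro image_eqI [of _ _ 0]) (auto simp: \<phi>_def)
      show "l \<in> \<phi> ` ball p r" using r p fp by (intro image_eqI [of _ _ p]) (auto simp: \<phi>_def)
    qed
    ultimately obtain e where e: "e > 0" "ball l e \<subseteq> \<phi> ` ball 0 r \<inter> \<phi> ` ball p r"
      using open_contains_ball by blast
    define q where "q = l + of_real (e / 2)"
    have "q \<in> ball l e" "q \<noteq> l"
      using e(1) by (auto simp: q_def dist_norm)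
    then have "q \<in> \<phi> ` ball 0 r" "q \<in> \<phi> ` ball p r"
      using e(2) by auto
    then obtain u v where uv: "u \<in> ball 0 r" "v \<in> ball p r" "q = \<phi> u" "q = \<phi> v"
      by (elim imageE) (rule that)
    have "u \<noteq> 0" "v \<noteq> 0"
      using uv \<open>q \<noteq> l\<close> by (auto simp: \<phi>_def)
    then have "u = v"
      using uv inj_onD [OF f(2), of u v] by (simp add: \<phi>_def)
    then show False
      using uv disj by blast
  qed
  have inj: "inj \<phi>"
  proof (rule injI)
    fix x y assume "\<phi> x = \<phi> y"
    then show "x = y"
      using not_l [of x] not_l [of y] inj_onD [OF f(2), of x y] by (auto simp: \<phi>_def split: if_splits)
  qed
  define g where "g = (\<lambda>z. f (inverse z))"
  have inv: "inverse holomorphic_on punctured_plane" "inverse ` punctured_plane \<subseteq> punctured_plane"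
    by (auto intro!: holomorphic_intros)
  have g: "g holomorphic_on punctured_plane"
    using holomorphic_on_compose_gen [OF inv(1) f(1) inv(2)] by (simp add: o_def g_def)
  have "inj_on g punctured_plane"
  proof (rule inj_onI)
    fix x y assume "x \<in> punctured_plane" "y \<in> punctured_plane" "g x = g y"
    then have "inverse x = inverse y"
      using inj_onD [OF f(2), of "inverse x" "inverse y"] by (simp add: g_def)
    then show "x = y" by simp
  qed
  then have "(\<exists>l. (g \<longlongrightarrow> l) (at 0)) \<or> (\<exists>l. ((inverse \<circ> g) \<longlongrightarrow> l) (at 0))"
    using limit_or_pole_at_isolated_singularity g by blast
  moreover have False if "(g \<longlongrightarrow> m) (at 0)" for m
  proof -
    have "((\<lambda>z. \<phi> (inverse z)) \<longlongrightarrow> m) (at 0)"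
      using that by (rule Lim_transform_eventually) (auto simp: \<phi>_def g_def eventually_at intro!: exI [of _ 1])
    then have "(\<phi> \<longlongrightarrow> m) at_infinity"
      unfolding lim_at_infinity_0 by (simp add: o_def)
    then have "\<phi> z = m" for z
      by (rule Liouville_weak [OF hol])
    then show False
      using nonconst by (auto simp: constant_on_def)
  qed
  ultimately obtain m where "((inverse \<circ> g) \<longlongrightarrow> m) (at 0)"
    by blast
  then have "((\<lambda>z. (inverse \<circ> \<phi>) (inverse z)) \<longlongrightarrow> m) (at 0)"
    by (rule Lim_transform_eventually) (auto simp: \<phi>_def g_def eventually_at intro!: exI [of _ 1])
  then have "((inverse \<circ> \<phi>) \<longlongrightarrow> m) at_infinity"
    unfolding lim_at_infinity_0 by (simp add: o_def)
  then obtain c n where cn: "\<And>z. \<phi> z = (\<Sum>i\<le>n. c i * z ^ i)"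
    using pole_at_infinity [OF hol] by blast
  define P where "P = (\<Sum>i\<le>n. monom (c i) i)"
  have P: "\<phi> = poly P"
    by (auto simp: P_def cn poly_sum poly_monom)
  obtain b a where ab: "a \<noteq> 0" "\<And>z. poly P z = b + a * z"
    using injective_polynomial_linear inj unfolding P by blast
  have "b = 0"
  proof (rule ccontr)
    assume "b \<noteq> 0"
    then have "f (- b / a) = \<phi> (- b / a)"
      using ab(1) by (simp add: \<phi>_def)
    also have "\<dots> = b + a * (- b / a)"
      unfolding P by (rule ab(2))
    also have "\<dots> = 0"
      using ab(1) by simp
    finally have "f (- b / a) = 0" .
    moreover have "- b / a \<in> punctured_plane"
      using \<open>b \<noteq> 0\<close> ab by simp
    then have "f (- b / a) \<in> punctured_plane"
      using f(3) unfolding image_subset_iff by (rule bspec [rotated])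
    ultimately show False
      by simp
  qed
  then have "f z = a * z" if "z \<noteq> 0" for z
    using that ab(2) [of z] fun_cong [OF P, of z] by (simp add: \<phi>_def)
  then show ?thesis
    using that ab by blast
qed

text \<open>
  If \<open>f\<close> has a pole at \<open>0\<close>, apply the preceding lemma to \<open>1 / f\<close>.
\<close>

theorem injective_self_map_punctured_plane:
  assumes f: "f holomorphic_on punctured_plane" "inj_on f punctured_plane" "f ` punctured_plane \<subseteq> punctured_plane"
  obtains a where "a \<noteq> 0" "\<forall>z. z \<noteq> 0 \<longrightarrow> f z = a * z" | a where "a \<noteq> 0" "\<forall>z. z \<noteq> 0 \<longrightarrow> f z = a / z"
proof -
  have nz: "f z \<noteq> 0" if "z \<noteq> 0" for z
    using f(3) that unfolding image_subset_iff by simp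
  consider l where "(f \<longlongrightarrow> l) (at 0)" | l where "((inverse \<circ> f) \<longlongrightarrow> l) (at 0)"
    using limit_or_pole_at_isolated_singularity [OF f(1,2)] by blast
  then show ?thesis
  proof cases
    case 1
    obtain a where "a \<noteq> 0" "\<And>z. z \<noteq> 0 \<Longrightarrow> f z = a * z"
      by (rule injective_self_map_limit_imp_linear [OF f 1]) (rule that)
    then show ?thesis
      using that(1) [of a] by simp
  next
    case 2
    have hol: "(inverse \<circ> f) holomorphic_on punctured_plane"
      unfolding o_def by (rule holomorphic_on_inverse [OF f(1)]) (use nz in simp)
    have inj: "inj_on (inverse \<circ> f) punctured_plane"
      using f(2) by (auto simp: inj_on_def)
    have img: "(inverse \<circ> f) ` punctured_plane \<subseteq> punctured_plane"
      by (simp add: image_subset_iff nz)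
    obtain b where b: "b \<noteq> 0" "\<And>z. z \<noteq> 0 \<Longrightarrow> (inverse \<circ> f) z = b * z"
      by (rule injective_self_map_limit_imp_linear [OF hol inj img 2]) (rule that)
    have "f z = inverse b / z" if "z \<noteq> 0" for z
    proof -
      have "f z = inverse (b * z)"
        using b(2) [OF that] by (metis comp_apply inverse_inverse_eq)
      then show ?thesis
        by (simp add: divide_inverse)
    qed
    then show ?thesis
      using that(2) [of "inverse b"] b(1) by simp
  qed
qed

section \<open>Supercyclic vectors\<close>

locale supercyclic_vector =
  fixes \<omega> \<psi> f :: "complex \<Rightarrow> complex" and T
  defines "T \<equiv> weighted_comp punctured_plane \<omega> \<psi>"
  assumes \<omega>_hol: "\<omega> holomorphic_on punctured_plane"
    and \<psi>_hol: "\<psi> holomorphic_on punctured_plane"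
    and \<psi>_maps: "\<psi> ` punctured_plane \<subseteq> punctured_plane"
    and f_mem: "f \<in> hol_space punctured_plane"
    and dense_orbit: "dense_in_space (hol_topology punctured_plane) {hol_scale c ((T ^^ n) f) | c n. True}"
begin

lemma T_apply: "z \<noteq> 0 \<Longrightarrow> T g z = \<omega> z * g (\<psi> z)"
  by (simp add: T_def weighted_comp_def)

lemma \<psi>_nonzero: "z \<noteq> 0 \<Longrightarrow> \<psi> z \<noteq> 0"
  using \<psi>_maps unfolding image_subset_iff by simp

lemma Tn_mem: "(T ^^ n) f \<in> hol_space punctured_plane"
  by (induction n) (simp_all add: f_mem T_def weighted_comp_in_hol_space [OF \<omega>_hol \<psi>_hol \<psi>_maps])

lemma orbit_near:
  assumes "g holomorphic_on punctured_plane" "compact K" "K \<subseteq> punctured_plane" "e > 0"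
  obtains c n where "\<And>z. z \<in> K \<Longrightarrow> norm (c * (T ^^ n) f z - g z) < e"
proof -
  define g' where "g' = (\<lambda>z. if z = 0 then 0 else g z)"
  have "g' holomorphic_on punctured_plane"
    by (rule holomorphic_transform [OF assms(1)]) (simp add: g'_def)
  then have "g' \<in> hol_space punctured_plane"
    by (simp add: hol_space_def g'_def)
  then obtain d where d: "d \<in> {hol_scale c ((T ^^ n) f) | c n. True}" "\<forall>z\<in>K. norm (d z - g' z) < e"
    using conjunct2 [OF dense_orbit [unfolded dense_in_hol_space_iff], rule_format, of g' K e] assms by auto
  then obtain c n where "d = hol_scale c ((T ^^ n) f)"
    by auto
  then have "norm (c * (T ^^ n) f z - g z) < e" if "z \<in> K" for z
  proof -
    have "z \<noteq> 0"
      using that assms(3) by auto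
    then show ?thesis
      using d(2) that \<open>d = hol_scale c ((T ^^ n) f)\<close> by (auto simp: hol_scale_def g'_def)
  qed
  then show ?thesis by (rule that)
qed

lemma orbit_two_points:
  assumes z: "z1 \<noteq> 0" "z2 \<noteq> 0" "z1 \<noteq> z2" and e: "e > 0"
  obtains c n where "norm (c * (T ^^ n) f z1 - x) < e" "norm (c * (T ^^ n) f z2 - y) < e"
proof -
  define g where "g = (\<lambda>z. x + (y - x) * (z - z1) / (z2 - z1))"
  have "g holomorphic_on punctured_plane"
    unfolding g_def using z by (intro holomorphic_intros) auto
  then obtain c n where "\<And>z. z \<in> {z1, z2} \<Longrightarrow> norm (c * (T ^^ n) f z - g z) < e"
    by (rule orbit_near [where K = "{z1, z2}" and e = e]) (use z e in auto)
  then have "norm (c * (T ^^ n) f z1 - g z1) < e" "norm (c * (T ^^ n) f z2 - g z2) < e"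
    by auto
  then show ?thesis
    using that [of c n] z by (simp add: g_def)
qed

end

text \<open>
  The targets \<open>(1, s)\<close> and \<open>(1, t)\<close> point into different directions: a multiple of \<open>(u1, u2)\<close> close to the former
  forces \<open>\<bar>u2\<bar> < 5/3 * s * \<bar>u1\<bar>\<close>, and one close to the latter forces \<open>\<bar>u2\<bar> > 3 * s * \<bar>u1\<bar>\<close>.
\<close>

lemma separated_directions:
  fixes u1 u2 :: complex and s t :: real
  assumes st: "1 \<le> s" "4 * s \<le> t"
    and s: "norm (b * u1 - 1) < 1/4" "norm (b * u2 - of_real s) < 1/4"
    and t: "norm (c * u1 - 1) < 1/4" "norm (c * u2 - of_real t) < 1/4"
  shows False
proof -
  have b1: "norm b * norm u1 > 3/4"
    using s(1) norm_triangle_ineq2 [of 1 "b * u1"] by (simp add: norm_mult norm_minus_commute)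
  have b2: "norm b * norm u2 < 5/4 * s"
    using s(2) norm_triangle_ineq2 [of "b * u2" "of_real s"] st by (simp add: norm_mult)
  have c1: "norm c * norm u1 < 5/4"
    using t(1) norm_triangle_ineq2 [of "c * u1" 1] by (simp add: norm_mult)
  have c2: "norm c * norm u2 > 15/4 * s"
    using t(2) norm_triangle_ineq2 [of "of_real t" "c * u2"] st by (simp add: norm_mult norm_minus_commute)
  have pos: "norm b > 0" "norm c > 0" "norm u1 > 0"
    using b1 c2 st by (auto intro!: Nat.gr0I simp: zero_less_mult_iff)
  have "norm b * norm u2 * 3 < norm b * norm u1 * (5 * s)"
  proof -
    have "5 * s * (3/4) < 5 * s * (norm b * norm u1)"
      using b1 st by (intro mult_strict_left_mono) auto
    then show ?thesis
      using b2 by (simp add: mult_ac)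
  qed
  then have 1: "norm u2 * 3 < norm u1 * (5 * s)"
    using pos by (simp add: mult.assoc)
  have "norm c * norm u1 * (3 * s) < norm c * norm u2"
  proof -
    have "norm c * norm u1 * (3 * s) < 5/4 * (3 * s)"
      using c1 st by (intro mult_strict_right_mono) auto
    also have "\<dots> = 15/4 * s"
      by simp
    also have "\<dots> < norm c * norm u2"
      by (rule c2)
    finally show ?thesis .
  qed
  then have 2: "norm u1 * (3 * s) < norm u2"
    using pos by (simp add: mult.assoc)
  have "norm u1 * s \<ge> 0"
    using st by simp
  then show False
    using 1 2 by simp
qed

text \<open>
  Two lines cannot both serve three targets in separated directions, here \<open>(1, 1)\<close>, \<open>(1, 4)\<close> and \<open>(1, 16)\<close>.
\<close>

lemma two_lines_not_dense:
  fixes u1 u2 v1 v2 :: complex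
  obtains t :: real where "\<And>c. \<not> (norm (c * u1 - 1) < 1/4 \<and> norm (c * u2 - of_real t) < 1/4)"
    "\<And>c. \<not> (norm (c * v1 - 1) < 1/4 \<and> norm (c * v2 - of_real t) < 1/4)"
proof -
  define hit where "hit = (\<lambda>u1 u2 t::real. \<exists>c::complex. norm (c * u1 - 1) < 1/4 \<and> norm (c * u2 - of_real t) < 1/4)"
  \<comment> \<open>a line hits at most one of the targets\<close>
  have sep: "\<not> (hit u1 u2 s \<and> hit u1 u2 t)" if "1 \<le> s" "4 * s \<le> t" for u1 u2 s t
    unfolding hit_def using separated_directions [OF that] by blast
  have "\<exists>t\<in>{1, 4, 16}. \<not> hit u1 u2 t \<and> \<not> hit v1 v2 t"
    using sep [of 1 4] sep [of 1 16] sep [of 4 16] by auto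
  then show ?thesis
    using that unfolding hit_def by blast
qed

context supercyclic_vector
begin

text \<open>
  The second line is spanned by the values of \<open>f\<close> itself, which is the only member of the orbit without
  \<open>n \<ge> 1\<close>.
\<close>

lemma orbit_not_in_two_lines:
  assumes z: "z1 \<noteq> 0" "z2 \<noteq> 0" "z1 \<noteq> z2"
  shows "\<not> (\<forall>n\<ge>1. \<exists>b. (T ^^ n) f z1 = b * u1 \<and> (T ^^ n) f z2 = b * u2)"
proof
  assume line: "\<forall>n\<ge>1. \<exists>b. (T ^^ n) f z1 = b * u1 \<and> (T ^^ n) f z2 = b * u2"
  obtain t :: real where t: "\<And>c. \<not> (norm (c * u1 - 1) < 1/4 \<and> norm (c * u2 - of_real t) < 1/4)"
      "\<And>c. \<not> (norm (c * f z1 - 1) < 1/4 \<and> norm (c * f z2 - of_real t) < 1/4)"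
    using two_lines_not_dense [of u1 u2 "f z1" "f z2"] by blast
  obtain c n where cn: "norm (c * (T ^^ n) f z1 - 1) < 1/4" "norm (c * (T ^^ n) f z2 - of_real t) < 1/4"
    by (rule orbit_two_points [OF z, of "1/4" 1 "of_real t"]) simp
  show False
  proof (cases n)
    case 0
    then show False using cn t(2) [of c] by simp
  next
    case (Suc m)
    then obtain b where "(T ^^ n) f z1 = b * u1" "(T ^^ n) f z2 = b * u2"
      using line by (metis le_add1 plus_1_eq_Suc)
    then show False using cn t(1) [of "c * b"] by (simp add: mult.assoc)
  qed
qed

lemma weight_nonzero: "\<omega> z \<noteq> 0" if z: "z \<noteq> 0"
proof
  assume 0: "\<omega> z = 0"
  have "\<exists>b. (T ^^ n) f z = b * 0 \<and> (T ^^ n) f (2 * z) = b * 1" if "n \<ge> 1" for n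
  proof -
    obtain m where "n = Suc m" using \<open>n \<ge> 1\<close> by (cases n) auto
    then have "(T ^^ n) f z = 0"
      using 0 z by (simp add: T_apply)
    then show ?thesis by simp
  qed
  then show False
    using orbit_not_in_two_lines [of z "2 * z" 0 1] z by auto
qed

lemma symbol_inj: "inj_on \<psi> punctured_plane"
proof (rule inj_onI, rule ccontr)
  fix z1 z2 assume z: "z1 \<in> punctured_plane" "z2 \<in> punctured_plane" "\<psi> z1 = \<psi> z2" "z1 \<noteq> z2"
  have "\<exists>b. (T ^^ n) f z1 = b * \<omega> z1 \<and> (T ^^ n) f z2 = b * \<omega> z2" if n: "n \<ge> 1" for n
  proof -
    obtain m where "n = Suc m" using n by (cases n) auto
    then have "(T ^^ n) f z1 = (T ^^ m) f (\<psi> z1) * \<omega> z1 \<and> (T ^^ n) f z2 = (T ^^ m) f (\<psi> z1) * \<omega> z2"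
      using z by (simp add: T_apply)
    then show ?thesis by blast
  qed
  then show False
    using orbit_not_in_two_lines [of z1 z2 "\<omega> z1" "\<omega> z2"] z by auto
qed

lemma orbit_at_fixed_point: "\<psi> z = z \<Longrightarrow> z \<noteq> 0 \<Longrightarrow> (T ^^ n) f z = \<omega> z ^ n * f z"
  by (induction n) (simp_all add: T_apply)

text \<open>
  At the fixed points the orbit is \<open>\<omega> z1 ^ n * f z1\<close> and \<open>\<omega> z2 ^ n * f z2\<close>. Since \<open>\<bar>\<omega> z1\<bar> \<le> \<bar>\<omega> z2\<bar>\<close>, the
  quotient of the first by the second is at most \<open>\<bar>f z1\<bar> / \<bar>f z2\<bar>\<close> in modulus, so the target \<open>(M, 1)\<close> is out of reach for large \<open>M\<close>.
\<close>

lemma no_two_fixed_points: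
  assumes z: "z1 \<noteq> 0" "z2 \<noteq> 0" "z1 \<noteq> z2" and fp: "\<psi> z1 = z1" "\<psi> z2 = z2" and le: "norm (\<omega> z1) \<le> norm (\<omega> z2)"
  shows False
proof -
  have key: "\<exists>(c::complex) n. norm c * norm (\<omega> z1) ^ n * norm (f z1) > M - 1/4 \<and> norm c * norm (\<omega> z2) ^ n * norm (f z2) < 5/4 \<and> f z2 \<noteq> 0"
    if M: "M \<ge> 0" for M :: real
  proof -
    obtain c n where cn: "norm (c * (T ^^ n) f z1 - of_real M) < 1/4" "norm (c * (T ^^ n) f z2 - 1) < 1/4"
      by (rule orbit_two_points [OF z, of "1/4" "of_real M" 1]) simp
    have "M - 1/4 < norm (c * (T ^^ n) f z1)"
      using cn(1) norm_triangle_ineq2 [of "of_real M" "c * (T ^^ n) f z1"] M by (simp add: norm_minus_commute)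
    moreover have "norm (c * (T ^^ n) f z2) < 5/4"
      using cn(2) norm_triangle_ineq2 [of "c * (T ^^ n) f z2" 1] by simp
    moreover have "f z2 \<noteq> 0"
      using cn(2) z fp by (auto simp: orbit_at_fixed_point)
    ultimately show ?thesis
      using z fp by (intro exI [of _ c] exI [of _ n]) (simp add: orbit_at_fixed_point norm_mult norm_power mult.assoc)
  qed
  have f2: "norm (f z2) > 0"
    using key [of 0] by auto
  \<comment> \<open>chosen so that \<open>(M - 1/4) * \<bar>f z2\<bar>\<close> exceeds \<open>5/4 * \<bar>f z1\<bar>\<close>\<close>
  define M where "M = 1 + 5/4 * norm (f z1) / norm (f z2)"
  have "M \<ge> 0"
    by (simp add: M_def)
  then obtain c :: complex and n where cn: "norm c * norm (\<omega> z1) ^ n * norm (f z1) > M - 1/4" "norm c * norm (\<omega> z2) ^ n * norm (f z2) < 5/4"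
    using key by blast
  have "(M - 1/4) * norm (f z2) \<le> (norm c * norm (\<omega> z1) ^ n * norm (f z1)) * norm (f z2)"
    using cn(1) by (intro mult_right_mono) auto
  also have "\<dots> \<le> (norm c * norm (\<omega> z2) ^ n * norm (f z1)) * norm (f z2)"
    using le by (intro mult_right_mono mult_left_mono power_mono) auto
  also have "\<dots> = (norm c * norm (\<omega> z2) ^ n * norm (f z2)) * norm (f z1)"
    by simp
  also have "\<dots> \<le> 5/4 * norm (f z1)"
    using cn(2) by (intro mult_right_mono) auto
  finally have "(M - 1/4) * norm (f z2) \<le> 5/4 * norm (f z1)" .
  moreover have "(M - 1/4) * norm (f z2) = 3/4 * norm (f z2) + 5/4 * norm (f z1)"
    using f2 by (simp add: M_def field_simps)
  ultimately show False
    using f2 by simp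
qed

text \<open>
  The two square roots of \<open>a\<close> are fixed points of \<open>z \<mapsto> a / z\<close>.
\<close>

lemma symbol_not_inversion:
  assumes a: "a \<noteq> 0" "\<forall>z. z \<noteq> 0 \<longrightarrow> \<psi> z = a / z"
  shows False
proof -
  define z where "z = csqrt a"
  have z: "z \<noteq> 0" "- z \<noteq> 0" "z \<noteq> - z" "- z \<noteq> z"
    using a(1) by (auto simp: z_def)
  have "z ^ 2 = a"
    by (simp add: z_def)
  then have fp: "\<psi> z = z" "\<psi> (- z) = - z"
    using a(2) z by (auto simp: power2_eq_square)
  show False
    using no_two_fixed_points [OF z(1,2,3) fp] no_two_fixed_points [OF z(2,1,4) fp(2,1)] by linarith
qed

lemma continuous_on_subset_punctured_plane:
  "g \<in> hol_space punctured_plane \<Longrightarrow> A \<subseteq> punctured_plane \<Longrightarrow> continuous_on A g"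
  unfolding hol_space_def by (auto intro: continuous_on_subset holomorphic_on_imp_continuous_on)

text \<open>
  Each application of \<open>T\<close> contributes the index \<open>m\<close> of the weight and replaces the circle by its image
  under multiplication by \<open>a\<close>.
\<close>

lemma orbit_circle_index:
  assumes a: "a \<noteq> 0" "\<forall>z. z \<noteq> 0 \<longrightarrow> \<psi> z = a * z"
    and m: "W holomorphic_on punctured_plane" "\<And>z. z \<noteq> 0 \<Longrightarrow> \<omega> z = z powi m * exp (W z)"
    and c: "c \<noteq> 0" and k: "circle_index f (a ^ n * c) k"
  shows "circle_index ((T ^^ n) f) c (int n * m + k)"
  using c k
proof (induction n arbitrary: c)
  case 0
  then show ?case by simp
next
  case (Suc n)
  have "circle_index ((T ^^ n) f) (a * c) (int n * m + k)"
    using Suc.IH [of "a * c"] Suc.prems a(1) by (simp add: mult_ac)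
  then have "circle_index (\<lambda>z. (T ^^ n) f (a * z)) c (int n * m + k)"
    unfolding circle_index_def by (simp add: mult.assoc)
  moreover have "circle_index (\<lambda>z. exp (W z)) c 0"
    using Suc.prems(1)
    by (intro circle_index_exp continuous_on_subset [OF holomorphic_on_imp_continuous_on [OF m(1)]]) auto
  ultimately have "circle_index (\<lambda>z. z powi m * exp (W z) * (T ^^ n) f (a * z)) c (m + 0 + (int n * m + k))"
    using Suc.prems(1) by (intro circle_index_mult circle_index_powi)
  then have "circle_index ((T ^^ Suc n) f) c (m + 0 + (int n * m + k))"
  proof (rule circle_index_cong)
    fix z :: complex assume "norm z = norm c"
    then have "z \<noteq> 0" using Suc.prems(1) by auto
    then show "z powi m * exp (W z) * (T ^^ n) f (a * z) = (T ^^ Suc n) f z"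
      using a(2) m(2) by (simp add: T_apply)
  qed
  then show ?case
    by (simp add: algebra_simps)
qed

lemma orbit_zero:
  assumes a: "a \<noteq> 0" "\<forall>z. z \<noteq> 0 \<longrightarrow> \<psi> z = a * z"
  shows "z \<noteq> 0 \<Longrightarrow> f (a ^ n * z) = 0 \<Longrightarrow> (T ^^ n) f z = 0"
proof (induction n arbitrary: z)
  case (Suc n)
  have "(T ^^ n) f (a * z) = 0"
    using Suc.IH [of "a * z"] Suc.prems a(1) by (simp add: mult_ac)
  then show ?case
    using Suc.prems a(2) by (simp add: T_apply)
qed simp

text \<open>
  An orbit element close enough to \<open>z powi k\<close> on the circle has index \<open>k\<close> there; in particular it has no zeros,
  which by \<open>orbit_zero\<close> carries over to \<open>f\<close> on the image circle.
\<close>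

lemma every_index_attained:
  assumes a: "a \<noteq> 0" "\<forall>z. z \<noteq> 0 \<longrightarrow> \<psi> z = a * z"
    and m: "W holomorphic_on punctured_plane" "\<And>z. z \<noteq> 0 \<Longrightarrow> \<omega> z = z powi m * exp (W z)"
    and c: "c \<noteq> 0"
  obtains n j where "circle_index f (a ^ n * c) j" "k = int n * m + j"
proof -
  have "(\<lambda>z. z powi k) holomorphic_on punctured_plane"
    by (intro holomorphic_intros) auto
  then obtain b n where near: "\<And>z. z \<in> sphere 0 (norm c) \<Longrightarrow> norm (b * (T ^^ n) f z - z powi k) < norm c powi k"
    by (rule orbit_near [where K = "sphere 0 (norm c)" and e = "norm c powi k"]) (use c in auto)
  have near': "norm (b * (T ^^ n) f z / z powi k - 1) < 1" if "norm z = norm c" for z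
  proof -
    have z: "z \<noteq> 0" using that c by auto
    have "b * (T ^^ n) f z / z powi k - 1 = (b * (T ^^ n) f z - z powi k) / z powi k"
      using z by (simp add: diff_divide_distrib)
    moreover have "norm (b * (T ^^ n) f z - z powi k) < norm (z powi k)"
      using near [of z] that by (simp add: norm_power_int)
    ultimately show ?thesis
      using z by (simp add: norm_divide)
  qed
  have nz: "b \<noteq> 0" "(T ^^ n) f z \<noteq> 0" if "norm z = norm c" for z
    using near' [OF that] by auto
  have cont: "continuous_on (sphere 0 (norm c)) ((T ^^ n) f)"
    using c by (intro continuous_on_subset_punctured_plane Tn_mem) auto
  have "circle_index (\<lambda>z. b * (T ^^ n) f z / z powi k) c 0"
    using c near' by (intro circle_index_near_1 continuous_intros cont) auto
  moreover have b: "b \<noteq> 0"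
    using nz(1) [of c] by simp
  then have "circle_index (\<lambda>z. 1 / b) c 0"
    by (intro circle_index_const) simp
  ultimately have "circle_index (\<lambda>z. 1 / b * (b * (T ^^ n) f z / z powi k * z powi k)) c (0 + (0 + k))"
    by (intro circle_index_mult circle_index_powi c)
  then have "circle_index ((T ^^ n) f) c (0 + (0 + k))"
    by (rule circle_index_cong) (use c b in auto)
  then have k: "circle_index ((T ^^ n) f) c k"
    by simp
  obtain j where j: "circle_index f (a ^ n * c) j"
  proof (rule circle_index_exists)
    show "continuous_on (sphere 0 (norm (a ^ n * c))) f"
      using c a(1) by (intro continuous_on_subset_punctured_plane f_mem) auto
    fix z :: complex assume z: "norm z = norm (a ^ n * c)"
    show "f z \<noteq> 0"
    proof
      assume fz: "f z = 0"
      define y where "y = z / a ^ n"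
      have y: "norm y = norm c" "a ^ n * y = z"
        using a(1) z by (auto simp: y_def norm_divide norm_mult)
      then have "y \<noteq> 0"
        using c by auto
      then have "(T ^^ n) f y = 0"
        using orbit_zero [OF a, of y n] y(2) fz by simp
      then show False
        using nz(2) [OF y(1)] by simp
    qed
  qed
  have "circle_index ((T ^^ n) f) c (int n * m + j)"
    by (rule orbit_circle_index [OF a m c j])
  then have "k = int n * m + j"
    using circle_index_unique [OF k] by blast
  then show ?thesis
    using that j by blast
qed

text \<open>
  Only finitely many radii between \<open>1\<close> and \<open>2\<close> are excluded by zeros of \<open>f\<close>.
\<close>

lemma some_circle_index:
  obtains c w where "c \<noteq> 0" "circle_index f c w"
proof -
  obtain b n where "\<And>z. z \<in> {1} \<Longrightarrow> norm (b * (T ^^ n) f z - 1) < 1/2"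
    by (rule orbit_near [where K = "{1}" and e = "1/2" and g = "\<lambda>_. 1"]) auto
  then have n: "norm (b * (T ^^ n) f 1 - 1) < 1/2"
    by simp
  have "\<exists>p. p \<noteq> 0 \<and> f p \<noteq> 0"
  proof (rule ccontr)
    assume zero: "\<nexists>p. p \<noteq> 0 \<and> f p \<noteq> 0"
    have "(T ^^ n) f z = 0" if "z \<noteq> 0" for z
      using that
    proof (induction n arbitrary: z)
      case 0
      then show ?case using zero by auto
    next
      case (Suc n)
      then show ?case by (simp add: T_apply \<psi>_nonzero)
    qed
    then show False
      using n by simp
  qed
  then obtain p where p: "p \<noteq> 0" "f p \<noteq> 0" by blast
  define A where "A = {z::complex. 1 \<le> norm z \<and> norm z \<le> 2}"
  have "finite {z \<in> A. f z = 0}"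
    using f_mem unfolding A_def
    by (intro finite_zeros_punctured_plane [where f = f, OF _ p(2,1)] compact_annulus) (auto simp: hol_space_def)
  then have "finite (norm ` {z \<in> A. f z = 0})"
    by simp
  then have "infinite ({1..2::real} - norm ` {z \<in> A. f z = 0})"
    by (intro Diff_infinite_finite) (auto simp: infinite_Icc)
  then have "{1..2::real} - norm ` {z \<in> A. f z = 0} \<noteq> {}"
    by (rule infinite_imp_nonempty)
  then obtain r where r: "r \<in> {1..2}" "r \<notin> norm ` {z \<in> A. f z = 0}"
    by blast
  have nr: "norm (complex_of_real r) = r"
    using r by simp
  obtain w where "circle_index f (of_real r) w"
  proof (rule circle_index_exists)
    show "continuous_on (sphere 0 (norm (complex_of_real r))) f"
      using r by (intro continuous_on_subset_punctured_plane f_mem) auto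
    show "f z \<noteq> 0" if "norm z = norm (complex_of_real r)" for z
      using that r unfolding nr A_def by auto
  qed
  then show ?thesis
    using that [of "of_real r" w] r by auto
qed

text \<open>
  Let \<open>w\<close> be the index of \<open>f\<close> on a circle. For \<open>\<bar>a\<bar> \<le> 1\<close> the image circles lie inside, where \<open>f\<close> has index
  at most \<open>w\<close>; so the index \<open>w + 1\<close> can only be attained if \<open>m\<close> is positive. For \<open>\<bar>a\<bar> \<ge> 1\<close> they lie outside, and
  \<open>w - 1\<close> is the index to look at.
\<close>

lemma winding_obstruction:
  assumes a: "a \<noteq> 0" "\<forall>z. z \<noteq> 0 \<longrightarrow> \<psi> z = a * z"
    and m: "W holomorphic_on punctured_plane" "\<And>z. z \<noteq> 0 \<Longrightarrow> \<omega> z = z powi m * exp (W z)"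
  shows "(norm a \<le> 1 \<longrightarrow> m \<ge> 1) \<and> (norm a \<ge> 1 \<longrightarrow> m \<le> - 1)"
proof -
  obtain c w where c: "c \<noteq> 0" "circle_index f c w"
    by (rule some_circle_index)
  have f_hol: "f holomorphic_on UNIV - {0}"
    using f_mem by (simp add: hol_space_def)
  have "m \<ge> 1" if le: "norm a \<le> 1"
  proof (rule ccontr)
    assume "\<not> m \<ge> 1"
    obtain n j where j: "circle_index f (a ^ n * c) j" "w + 1 = int n * m + j"
      by (rule every_index_attained [OF a m c(1), where k = "w + 1"])
    have "norm (a ^ n * c) \<le> 1 * norm c"
      unfolding norm_mult norm_power using le by (intro mult_right_mono power_le_one) auto
    then have "j \<le> w"
      using circle_index_mono [OF f_hol j(1) c(2)] a(1) c(1) by simp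
    moreover have "int n * m \<le> 0"
      using \<open>\<not> m \<ge> 1\<close> by (intro mult_nonneg_nonpos) auto
    ultimately show False
      using j(2) by linarith
  qed
  moreover have "m \<le> - 1" if ge: "norm a \<ge> 1"
  proof (rule ccontr)
    assume "\<not> m \<le> - 1"
    obtain n j where j: "circle_index f (a ^ n * c) j" "w - 1 = int n * m + j"
      by (rule every_index_attained [OF a m c(1), where k = "w - 1"])
    have "1 * norm c \<le> norm (a ^ n * c)"
      unfolding norm_mult norm_power using ge by (intro mult_right_mono one_le_power) auto
    then have "w \<le> j"
      using circle_index_mono [OF f_hol c(2) j(1)] c(1) by simp
    moreover have "int n * m \<ge> 0"
      using \<open>\<not> m \<le> - 1\<close> by (intro mult_nonneg_nonneg) auto
    ultimately show False
      using j(2) by linarith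
  qed
  ultimately show ?thesis by blast
qed

theorem symbol_form:
  "\<exists>(n::nat) W a. n \<ge> 1 \<and> W holomorphic_on punctured_plane \<and> 0 < norm a \<and> norm a < 1 \<and>
     ((\<forall>z. z \<noteq> 0 \<longrightarrow> \<omega> z = z ^ n * exp (W z) \<and> \<psi> z = a * z) \<or>
      (\<forall>z. z \<noteq> 0 \<longrightarrow> \<omega> z = z powi (- int n) * exp (W z) \<and> \<psi> z = (1 / a) * z))"
proof -
  obtain a where a: "a \<noteq> 0" "\<forall>z. z \<noteq> 0 \<longrightarrow> \<psi> z = a * z"
    using injective_self_map_punctured_plane [OF \<psi>_hol symbol_inj \<psi>_maps] symbol_not_inversion by metis
  obtain m W where W: "W holomorphic_on punctured_plane" "\<And>z. z \<noteq> 0 \<Longrightarrow> \<omega> z = z powi m * exp (W z)"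
    using punctured_plane_factorization [OF \<omega>_hol weight_nonzero] by metis
  have wind: "(norm a \<le> 1 \<longrightarrow> m \<ge> 1) \<and> (norm a \<ge> 1 \<longrightarrow> m \<le> - 1)"
    by (rule winding_obstruction [OF a W])
  show ?thesis
  proof (cases "norm a < 1")
    case True
    then have m: "m = int (nat m)" "nat m \<ge> 1"
      using wind by auto
    have "\<omega> z = z ^ nat m * exp (W z)" if "z \<noteq> 0" for z
      using W(2) [OF that] m(1) by (metis power_int_of_nat)
    then show ?thesis
      using True a W(1) m(2) by (intro exI [of _ "nat m"] exI [of _ W] exI [of _ a]) auto
  next
    case False
    then have "norm a \<noteq> 1" "m \<le> - 1"
      using wind by auto
    then have m: "m = - int (nat (- m))" "nat (- m) \<ge> 1" and gt: "norm a > 1"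
      using False by auto
    have "\<omega> z = z powi (- int (nat (- m))) * exp (W z)" if "z \<noteq> 0" for z
      using W(2) [OF that] m(1) by simp
    moreover have "norm (1 / a) < 1" "0 < norm (1 / a)"
      using gt a(1) by (auto simp: norm_divide)
    ultimately show ?thesis
      using a W(1) m(2) by (intro exI [of _ "nat (- m)"] exI [of _ W] exI [of _ "1 / a"]) auto
  qed
qed

end

section \<open>The characterization\<close>

theorem theorem1p3:
  fixes \<omega> \<psi> :: "complex \<Rightarrow> complex"
  assumes "\<omega> holomorphic_on UNIV - {0}"
    and "\<psi> holomorphic_on UNIV - {0}"
    and "\<psi> ` (UNIV - {0}) \<subseteq> UNIV - {0}"
  defines "X \<equiv> hol_topology (UNIV - {0})"
    and "C \<equiv> weighted_comp (UNIV - {0}) \<omega> \<psi>"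
  shows "(supercyclic X hol_scale C \<longleftrightarrow> frequent_hypercyclicity_criterion X C) \<and>
         (frequent_hypercyclicity_criterion X C \<longrightarrow>
            frequently_hypercyclic X C \<and> mixing X C \<and> chaotic X C) \<and>
         (frequent_hypercyclicity_criterion X C \<longleftrightarrow>
            (\<exists>(n::nat) W a. n \<ge> 1 \<and> W holomorphic_on UNIV - {0} \<and> 0 < norm a \<and> norm a < 1 \<and>
               ((\<forall>z. z \<noteq> 0 \<longrightarrow> \<omega> z = z ^ n * exp (W z) \<and> \<psi> z = a * z) \<or>
                (\<forall>z. z \<noteq> 0 \<longrightarrow> \<omega> z = z powi (- int n) * exp (W z) \<and> \<psi> z = (1 / a) * z))))"
    (is "_ \<and> _ \<and> (_ \<longleftrightarrow> ?form)")
proof -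
  have operator: "hol_operator punctured_plane C"
    unfolding C_def hol_operator_def using operator_on_weighted_comp [OF assms(1-3)] by (simp add: open_delete)
  have form: ?form if sc: "supercyclic X hol_scale C"
  proof -
    obtain f where "f \<in> hol_space punctured_plane"
        "dense_in_space X {hol_scale c ((C ^^ n) f) | c n. True}"
      using sc unfolding supercyclic_def X_def topspace_hol_topology by blast
    then interpret supercyclic_vector \<omega> \<psi> f C
      using assms(1-3) unfolding X_def C_def by unfold_locales
    show ?thesis by (rule symbol_form)
  qed
  have fhc: "frequent_hypercyclicity_criterion X C" if f: ?form
  proof -
    obtain n :: nat and W a where nWa: "n \<ge> 1" "W holomorphic_on UNIV - {0}" "0 < norm a" "norm a < 1"
      and form: "(\<forall>z. z \<noteq> 0 \<longrightarrow> \<omega> z = z ^ n * exp (W z) \<and> \<psi> z = a * z) \<or>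
                (\<forall>z. z \<noteq> 0 \<longrightarrow> \<omega> z = z powi (- int n) * exp (W z) \<and> \<psi> z = (1 / a) * z)"
      using f by blast
    from form show ?thesis
    proof
      assume "\<forall>z. z \<noteq> 0 \<longrightarrow> \<omega> z = z ^ n * exp (W z) \<and> \<psi> z = a * z"
      then have "C = weighted_comp punctured_plane (\<lambda>z. z powi int n * exp (W z)) (\<lambda>z. a * z)"
        unfolding C_def by (intro weighted_comp_cong) simp
      then show ?thesis
        unfolding X_def using fhc_criterion_contraction [OF nWa(2,3,4,1)] by simp
    next
      assume "\<forall>z. z \<noteq> 0 \<longrightarrow> \<omega> z = z powi (- int n) * exp (W z) \<and> \<psi> z = (1 / a) * z"
      then have "C = weighted_comp punctured_plane (\<lambda>z. z powi (- int n) * exp (W z)) (\<lambda>z. (1 / a) * z)"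
        unfolding C_def by (intro weighted_comp_cong) simp
      then show ?thesis
        unfolding X_def using fhc_criterion_expansion [OF nWa(2,3,4,1)] by simp
    qed
  qed
  have dynamics: "frequently_hypercyclic X C \<and> mixing X C \<and> chaotic X C"
    if crit: "frequent_hypercyclicity_criterion X C"
  proof -
    obtain X0 S where XS: "dense_in_space X X0" "S ` X0 \<subseteq> X0"
        "\<forall>f\<in>X0. unconditionally_convergent X (\<lambda>n. (C ^^ n) f) {1..} \<and>
                 unconditionally_convergent X (\<lambda>n. (S ^^ n) f) {1..} \<and> C (S f) = f"
      using crit unfolding frequent_hypercyclicity_criterion_def by blast
    interpret hol_operator punctured_plane C
      by (rule operator)
    interpret fhc_criterion punctured_plane C X0 S
      by unfold_locales (use XS in \<open>auto simp: X_def\<close>)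
    obtain D where "countable D" "dense_in_space (hol_topology punctured_plane) D"
      using separable_hol_space_punctured_plane by blast
    then show ?thesis
      unfolding X_def using fhc_imp_frequently_hypercyclic fhc_imp_mixing fhc_imp_chaotic by blast
  qed
  have "supercyclic X hol_scale C" if "frequent_hypercyclicity_criterion X C"
    using frequently_hypercyclic_imp_supercyclic [OF operator] dynamics [OF that] unfolding X_def by blast
  with form fhc dynamics show ?thesis by blast
qed

end
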